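(* Let $A$ be a real $d\times d$ matrix all of whose eigenvalues have strictly negative real parts, let $B$ be a real $d\times m$ matrix such that $(A,B)$ is a controllable pair, and let $a\in\mathbb{R}^d$, $\gamma\in\mathbb{R}^m$. Let $\kappa>0$, $\zeta_2>0$. Assume $\zeta_2<\kappa$ and let $\kappa_d=\sqrt{\kappa^2-\zeta_2^2}$. Let $\lambda$ be the Lyapunov exponent of the system $$dv(t)=Av(t)\,dt+B\,dW(t),\qquad\ddot\varphi(t)+2\zeta_2\dot\varphi(t)+\bigl(\kappa^2-\langle a,v(t)\rangle\bigr)\varphi(t)=\sum_{\ell=1}^m\gamma_\ell\,\varphi(t)\,\dot W_\ell(t).$$ Then $$\lambda\le-\zeta_2+\frac{\sqrt{\langle a,Ra\rangle}}{2\kappa_d}+\frac{\|\gamma\|^2}{2\kappa_d^2},$$ where $R=\int_0^\infty e^{tA}BB^*e^{tA^*}dt$. In particular, let $\zeta_1,\chi,\nu>0$ and consider the block and pendulum setting $$\ddot\eta(t)+2\zeta_1\dot\eta(t)+\chi^2\eta(t)=\nu\dot W(t),\qquad\ddot\varphi(t)+2\zeta_2\dot\varphi(t)+\bigl(\kappa^2+2\zeta_1\dot\eta(t)+\chi^2\eta(t)\bigr)\varphi(t)=\nu\varphi(t)\dot W(t)$$ ($d=2$, $m=1$, $v=(\eta,\dot\eta)^{T}$). Then its Lyapunov exponent satisfies $$\lambda\le-\zeta_2+\frac{\nu}{2\kappa_d}\sqrt{\frac{\chi^2+4\zeta_1^2}{4\zeta_1}}+\frac{\nu^2}{2\kapp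a_d^2}.$$
   Context: $W=(W_1,\dots,W_m)$ is a standard $m$-dimensional Brownian motion. $(A,B)$ is a controllable pair if $\mathrm{rank}\{B,AB,\dots,A^{d-1}B\}=d$. $R$ is the covariance matrix of the stationary (mean-zero Gaussian) probability measure of $v$. The second order equations for $\varphi$ are understood as It\^o (equivalently Stratonovich) SDEs for $(\varphi,\dot\varphi)$, e.g. $d\varphi=\dot\varphi\,dt$, $d\dot\varphi=[-2\zeta_2\dot\varphi-(\kappa^2-\langle a,v\rangle)\varphi]dt+\varphi\sum_\ell\gamma_\ell\,dW_\ell$. The Lyapunov exponent is the almost-sure limit $\lambda=\lim_{t\to\infty}\frac1t\log\|(\varphi(t),\dot\varphi(t))\|$, which exists and takes the same (nonrandom) value for all initial conditions with $(\varphi(0),\dot\varphi(0))\ne(0,0)$. *)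

theory Defs
  imports "HOL-Probability.Probability"
begin

section \<open>Matrices\<close>

definition matrix_power :: "real^'n^'n \<Rightarrow> nat \<Rightarrow> real^'n^'n"
  where "matrix_power A k = (((**) A) ^^ k) (mat 1)"

definition matrix_exp :: "real^'n^'n \<Rightarrow> real^'n^'n"
  where "matrix_exp A = (\<Sum>k. (1 / fact k) *\<^sub>R matrix_power A k)"

definition complex_eigenvalue :: "real^'n^'n \<Rightarrow> complex \<Rightarrow> bool"
  where "complex_eigenvalue A \<mu> \<longleftrightarrow> (\<exists>x. x \<noteq> 0 \<and> map_matrix complex_of_real A *v x = \<mu> *s x)"

text \<open>The rank of the block matrix with blocks \<open>B, AB, \<dots>, A\<^sup>d\<^sup>-\<^sup>1B\<close> is taken as its column rank.\<close>

definition controllable_pair :: "real^'d^'d \<Rightarrow> real^'m^'d \<Rightarrow> bool"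
  where "controllable_pair A B \<longleftrightarrow>
    dim (\<Union>k<CARD('d). columns (matrix_power A k ** B)) = CARD('d)"

definition stationary_covariance :: "real^'d^'d \<Rightarrow> real^'m^'d \<Rightarrow> real^'d^'d"
  where "stationary_covariance A B =
    integral {0..} (\<lambda>t. matrix_exp (t *\<^sub>R A) ** B ** transpose B ** matrix_exp (t *\<^sub>R transpose A))"

section \<open>Brownian motion\<close>

text \<open>Time is \<open>[0, \<infinity>)\<close>; processes and filtrations are indexed by all reals, but only their values
  at nonnegative times matter (extend a filtration by \<open>F t = F 0\<close> for \<open>t < 0\<close>).
  The product of normal densities is the density of \<open>N(0, (t - s) I)\<close>.\<close>

definition brownian_motion ::
    "'w measure \<Rightarrow> (real \<Rightarrow> 'w measure) \<Rightarrow> (real \<Rightarrow> 'w \<Rightarrow> real^'m) \<Rightarrow> bool"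
  where "brownian_motion M F W \<longleftrightarrow>
    (\<forall>t\<ge>0. W t \<in> borel_measurable (F t)) \<and>
    (\<forall>\<omega>\<in>space M. continuous_on {0..} (\<lambda>t. W t \<omega>)) \<and>
    (AE \<omega> in M. W 0 \<omega> = 0) \<and>
    (\<forall>s t. 0 \<le> s \<and> s < t \<longrightarrow>
      distributed M lborel (\<lambda>\<omega>. W t \<omega> - W s \<omega>)
        (\<lambda>x. ennreal (\<Prod>i\<in>UNIV. normal_density 0 (sqrt (t - s)) (x $ i))) \<and>
      prob_space.indep_set M (sets (F s))
        {(\<lambda>\<omega>. W t \<omega> - W s \<omega>) -` S \<inter> space M | S. S \<in> sets borel})"

section \<open>The Ito integral\<close>

definition tends_to_0_in_prob :: "'w measure \<Rightarrow> (nat \<Rightarrow> 'w \<Rightarrow> ennreal) \<Rightarrow> bool"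
  where "tends_to_0_in_prob M Z \<longleftrightarrow>
    (\<forall>\<epsilon>>0. (\<lambda>k. measure M {\<omega> \<in> space M. ennreal \<epsilon> < Z k \<omega>}) \<longlonglongrightarrow> 0)"

text \<open>A list of triples \<open>(s, u, \<xi>)\<close> encodes the simple process \<open>\<Sum> \<xi> 1\<^bsub>(s,u]\<^esub>\<close>. The intervals may
  overlap; refining them yields the usual disjoint form.\<close>

definition simple_process_on ::
    "'w measure \<Rightarrow> (real \<Rightarrow> 'w measure) \<Rightarrow> real \<Rightarrow> (real \<times> real \<times> ('w \<Rightarrow> real)) list \<Rightarrow> bool"
  where "simple_process_on M F T h \<longleftrightarrow>
    (\<forall>(s, u, \<xi>) \<in> set h. 0 \<le> s \<and> s \<le> u \<and> u \<le> T \<and>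
      \<xi> \<in> borel_measurable (F s) \<and> (\<exists>c. \<forall>\<omega>\<in>space M. \<bar>\<xi> \<omega>\<bar> \<le> c))"

definition simple_process :: "(real \<times> real \<times> ('w \<Rightarrow> real)) list \<Rightarrow> real \<Rightarrow> 'w \<Rightarrow> real"
  where "simple_process h r \<omega> = (\<Sum>(s, u, \<xi>)\<leftarrow>h. \<xi> \<omega> * indicator {s<..u} r)"

definition simple_integral ::
    "(real \<times> real \<times> ('w \<Rightarrow> real)) list \<Rightarrow> (real \<Rightarrow> 'w \<Rightarrow> real) \<Rightarrow> 'w \<Rightarrow> real"
  where "simple_integral h \<beta> \<omega> = (\<Sum>(s, u, \<xi>)\<leftarrow>h. \<xi> \<omega> * (\<beta> u \<omega> - \<beta> s \<omega>))"

definition progressive_on ::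
    "(real \<Rightarrow> 'w measure) \<Rightarrow> real \<Rightarrow> (real \<Rightarrow> 'w \<Rightarrow> real) \<Rightarrow> bool"
  where "progressive_on F T H \<longleftrightarrow>
    (\<forall>t\<in>{0..T}. (\<lambda>(s, \<omega>). H s \<omega>) \<in> borel_measurable (restrict_space borel {0..t} \<Otimes>\<^sub>M F t))"

text \<open>\<open>I\<close> is (a version of) the Ito integral of \<open>H\<close> over \<open>[0, T]\<close> against the scalar Brownian
  motion \<open>\<beta>\<close>. Almost sure finiteness of the integral of \<open>H\<^sup>2\<close> over \<open>[0, T]\<close> is implied by the
  existence of the approximating sequence.\<close>

definition has_ito_integral ::
    "'w measure \<Rightarrow> (real \<Rightarrow> 'w measure) \<Rightarrow> (real \<Rightarrow> 'w \<Rightarrow> real) \<Rightarrow> real \<Rightarrow>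
     (real \<Rightarrow> 'w \<Rightarrow> real) \<Rightarrow> ('w \<Rightarrow> real) \<Rightarrow> bool"
  where "has_ito_integral M F \<beta> T H I \<longleftrightarrow>
    progressive_on F T H \<and> I \<in> borel_measurable M \<and>
    (\<exists>h. (\<forall>k. simple_process_on M F T (h k)) \<and>
      tends_to_0_in_prob M
        (\<lambda>k \<omega>. \<integral>\<^sup>+s\<in>{0..T}. ennreal ((simple_process (h k) s \<omega> - H s \<omega>)\<^sup>2) \<partial>lborel) \<and>
      tends_to_0_in_prob M (\<lambda>k \<omega>. ennreal \<bar>simple_integral (h k) \<beta> \<omega> - I \<omega>\<bar>))"

section \<open>Stochastic differential equations\<close>

text \<open>\<open>dX = b(X) dt + \<Sum>\<^sub>l \<sigma>\<^sub>l(X) dW\<^sub>l\<close> in the Ito sense, written coordinatewise in integrated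
  form. The initial value \<open>X 0\<close> is any \<open>F 0\<close>-measurable random vector.\<close>

definition solves_sde ::
    "'w measure \<Rightarrow> (real \<Rightarrow> 'w measure) \<Rightarrow> (real \<Rightarrow> 'w \<Rightarrow> real^'m) \<Rightarrow>
     ('a::euclidean_space \<Rightarrow> 'a) \<Rightarrow> ('a \<Rightarrow> 'm \<Rightarrow> 'a) \<Rightarrow> (real \<Rightarrow> 'w \<Rightarrow> 'a) \<Rightarrow> bool"
  where "solves_sde M F W b \<sigma> X \<longleftrightarrow>
    (\<forall>t\<ge>0. X t \<in> borel_measurable (F t)) \<and>
    (\<forall>\<omega>\<in>space M. continuous_on {0..} (\<lambda>t. X t \<omega>)) \<and>
    (\<forall>t\<ge>0. \<forall>e\<in>Basis. \<exists>I.
      (\<forall>l. has_ito_integral M F (\<lambda>s \<omega>. W s \<omega> $ l) t (\<lambda>s \<omega>. \<sigma> (X s \<omega>) l \<bullet> e) (I l)) \<and>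
      (AE \<omega> in M. set_integrable lborel {0..t} (\<lambda>s. b (X s \<omega>) \<bullet> e) \<and>
        X t \<omega> \<bullet> e = X 0 \<omega> \<bullet> e + (LINT s:{0..t}|lborel. b (X s \<omega>) \<bullet> e) + (\<Sum>l\<in>UNIV. I l \<omega>)))"

text \<open>The state of the system driven by \<open>v\<close> is \<open>(v, \<phi>, \<phi>')\<close>, where \<open>\<phi>'\<close> is the time derivative
  of \<open>\<phi>\<close>.\<close>

definition oscillator_drift ::
    "real^'d^'d \<Rightarrow> real^'d \<Rightarrow> real \<Rightarrow> real \<Rightarrow> (real^'d) \<times> real \<times> real \<Rightarrow> (real^'d) \<times> real \<times> real"
  where "oscillator_drift A a \<kappa> \<zeta>2 =
    (\<lambda>(v, \<phi>, \<phi>'). (A *v v, \<phi>', - 2 * \<zeta>2 * \<phi>' - (\<kappa>\<^sup>2 - a \<bullet> v) * \<phi>))"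

definition oscillator_diffusion ::
    "real^'m^'d \<Rightarrow> real^'m \<Rightarrow> (real^'d) \<times> real \<times> real \<Rightarrow> 'm \<Rightarrow> (real^'d) \<times> real \<times> real"
  where "oscillator_diffusion B \<gamma> = (\<lambda>(v, \<phi>, \<phi>') l. (column l B, 0, \<gamma> $ l * \<phi>))"

text \<open>The state of the block and pendulum system is \<open>(\<eta>, \<eta>', \<phi>, \<phi>')\<close>; the noise is scalar.\<close>

definition pendulum_drift ::
    "real \<Rightarrow> real \<Rightarrow> real \<Rightarrow> real \<Rightarrow> real \<times> real \<times> real \<times> real \<Rightarrow> real \<times> real \<times> real \<times> real"
  where "pendulum_drift \<zeta>1 chi \<kappa> \<zeta>2 =
    (\<lambda>(\<eta>, \<eta>', \<phi>, \<phi>'). (\<eta>', - 2 * \<zeta>1 * \<eta>' - chi\<^sup>2 * \<eta>,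
      \<phi>', - 2 * \<zeta>2 * \<phi>' - (\<kappa>\<^sup>2 + 2 * \<zeta>1 * \<eta>' + chi\<^sup>2 * \<eta>) * \<phi>))"

definition pendulum_diffusion ::
    "real \<Rightarrow> real \<times> real \<times> real \<times> real \<Rightarrow> 1 \<Rightarrow> real \<times> real \<times> real \<times> real"
  where "pendulum_diffusion \<nu> = (\<lambda>(\<eta>, \<eta>', \<phi>, \<phi>') l. (0, \<nu>, 0, \<nu> * \<phi>))"

text \<open>\<open>lam\<close> is the Lyapunov exponent along the trajectory \<open>x = (\<phi>, \<phi>')\<close>, which is required to start
  away from the origin (almost surely). For the systems above the value is the same for all such
  trajectories, so requiring the limit along a single one is the weakest hypothesis. The norm on \<^typ>\<open>real \<times> real\<close> is the Euclidean one.\<close>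

definition lyapunov_exponent :: "'w measure \<Rightarrow> (real \<Rightarrow> 'w \<Rightarrow> real \<times> real) \<Rightarrow> real \<Rightarrow> bool"
  where "lyapunov_exponent M x lam \<longleftrightarrow>
    (AE \<omega> in M. x 0 \<omega> \<noteq> (0, 0)) \<and>
    (AE \<omega> in M. ((\<lambda>t. ln (norm (x t \<omega>)) / t) \<longlongrightarrow> lam) at_top)"

end

theory Submission
  imports
    Defs
    "HOL-Computational_Algebra.Fundamental_Theorem_Algebra"
    "HOL-Real_Asymp.Real_Asymp"
begin

text \<open>Put \<open>y = \<phi>' + \<zeta>2 \<phi>\<close> and \<open>R = \<kappa>d\<^sup>2 \<phi>\<^sup>2 + y\<^sup>2\<close>. Since \<open>ln (1 + u) \<le> u\<close>, the growth of \<open>ln R\<close> over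
  \<open>[0, T]\<close> is at most the sum of the relative increments of \<open>R\<close> over a fine grid, hence up to a
  pathwise negligible error at most
  \<open>- 2 \<zeta>2 T + \<Sum> \<bar>\<langle>a, v\<rangle>\<bar> \<Delta>t / \<kappa>d + \<Sum> (\<Delta>w)\<^sup>2 / \<kappa>d\<^sup>2 + \<Sum> (2 y \<phi> / R) \<Delta>w\<close> with \<open>w = \<langle>\<gamma>, W\<rangle>\<close>.
  The last sum is a martingale with coefficients bounded by \<open>1 / \<kappa>d\<close>, of order \<open>\<surd>T\<close> in mean, and
  \<open>\<langle>a, v t\<rangle>\<close> has up to a decaying term at most its stationary variance. Fatou's lemma, first for the mesh
  tending to 0 and then for \<open>T \<rightarrow> \<infinity>\<close>, gives the bound. No Ito formula is needed: as \<open>\<phi>\<close> is continuously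
  differentiable, all Ito integrals in the equations are pathwise integrals, by integration by
  parts.\<close>

section \<open>Interval functions of small increments\<close>

text \<open>In the coordinates \<open>(\<kappa>d \<phi>, y)\<close> the noiseless oscillator is
  \<open>- \<zeta>2\<close> times the identity plus a rotation of speed \<open>\<kappa>d\<close>,
  because \<open>\<kappa>\<^sup>2 = \<kappa>d\<^sup>2 + \<zeta>2\<^sup>2\<close>. So
  \<open>R\<close> decays at rate exactly \<open>2 \<zeta>2\<close>, and the perturbations enter
  through the second coordinate only. The bounds
  \<open>\<bar>2 y \<phi>\<bar> / R \<le> 1 / \<kappa>d\<close> and
  \<open>\<phi>\<^sup>2 / R \<le> 1 / \<kappa>d\<^sup>2\<close> give the two correction terms; the
  halves appear because \<open>R\<close> is a squared norm. The initial state is arbitrary: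
  \<open>v\<close> need not be stationary and \<open>X 0\<close> need not have moments. The
  transient \<open>e^{tA} v 0\<close> is therefore removed from \<open>v\<close> before any
  expectation is taken; its total effect is a random constant that disappears after division by
  \<open>T\<close>. Fatou's lemma wants nonnegative variables, while the martingale sum has no sign.
  Both it and the observation are treated by
  \<open>\<bar>x\<bar> \<le> (x\<^sup>2 / r + r) / 2\<close>: the scale \<open>r = sqrt T\<close>
  makes the martingale cost of order \<open>sqrt T\<close>, and the stationary standard deviation as
  \<open>r\<close> makes the second estimate as sharp as Cauchy-Schwarz.\<close>

definition small_cells :: "real \<Rightarrow> (real \<times> real) filter"
  where "small_cells T = (INF \<delta>\<in>{0<..}. principal {(s, t). 0 \<le> s \<and> s \<le> t \<and> t \<le> T \<and> t - s < \<delta>})"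

definition vanishing_on :: "real \<Rightarrow> (real \<Rightarrow> real \<Rightarrow> real) \<Rightarrow> bool"
  where "vanishing_on T e \<longleftrightarrow> (\<lambda>p. e (fst p) (snd p)) \<in> o[small_cells T](\<lambda>_. 1 :: real)"

text \<open>Errors of this size add up to nothing over a grid of mesh \<open>T / n\<close>.
  Smallness is phrased through a filter of cells shrinking uniformly on \<open>[0, T]\<close>, so
  that its closure properties are those of Landau symbols.\<close>

definition negligible_on :: "real \<Rightarrow> (real \<Rightarrow> real \<Rightarrow> real) \<Rightarrow> bool"
  where "negligible_on T e \<longleftrightarrow> (\<lambda>p. e (fst p) (snd p)) \<in> o[small_cells T](\<lambda>p. snd p - fst p)"

text \<open>The generating sets are nested in \<delta> and so form a filter base; an eventual
  property is tested on a single one of them.\<close>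

lemma eventually_small_cells:
  "eventually P (small_cells T) \<longleftrightarrow>
    (\<exists>\<delta>>0. \<forall>s t. 0 \<le> s \<and> s \<le> t \<and> t \<le> T \<and> t - s < \<delta> \<longrightarrow> P (s, t))"
proof -
  let ?C = "\<lambda>\<delta>. {(s, t). 0 \<le> s \<and> s \<le> t \<and> t \<le> T \<and> t - s < \<delta>}"
  have base: "\<exists>x\<in>{0<..}. principal (?C x) \<le> principal (?C a) \<sqinter> principal (?C b)"
    if "a \<in> {0<..}" "b \<in> {0<..}" for a b :: real
    using that by (intro bexI[of _ "min a b"]) auto
  have "eventually P (small_cells T) \<longleftrightarrow> (\<exists>\<delta>\<in>{0<..}. eventually P (principal (?C \<delta>)))"
    unfolding small_cells_def by (rule eventually_INF_base[OF _ base]) (auto intro: exI[of _ 1])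
  then show ?thesis by (auto simp: eventually_principal)
qed

lemma eventually_small_cellsI:
  assumes "\<And>s t. 0 \<le> s \<Longrightarrow> s \<le> t \<Longrightarrow> t \<le> T \<Longrightarrow> P s t"
  shows "\<forall>\<^sub>F p in small_cells T. P (fst p) (snd p)"
  unfolding eventually_small_cells using assms by (intro exI[of _ 1]) simp

lemma vanishing_on_iff:
  "vanishing_on T e \<longleftrightarrow>
    (\<forall>\<epsilon>>0. \<exists>\<delta>>0. \<forall>s t. 0 \<le> s \<and> s \<le> t \<and> t \<le> T \<and> t - s < \<delta> \<longrightarrow> \<bar>e s t\<bar> \<le> \<epsilon>)"
  by (simp add: vanishing_on_def smallo_def eventually_small_cells)

lemma negligible_on_iff:
  "negligible_on T e \<longleftrightarrow>
    (\<forall>\<epsilon>>0. \<exists>\<delta>>0. \<forall>s t. 0 \<le> s \<and> s \<le> t \<and> t \<le> T \<and> t - s < \<delta> \<longrightarrow> \<bar>e s t\<bar> \<le> \<epsilon> * (t - s))"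
  by (simp add: negligible_on_def smallo_def eventually_small_cells cong: imp_cong conj_cong)

lemma vanishing_onD:
  assumes "vanishing_on T e" "\<epsilon> > 0"
  obtains \<delta> where "\<delta> > 0" "\<And>s t. 0 \<le> s \<Longrightarrow> s \<le> t \<Longrightarrow> t \<le> T \<Longrightarrow> t - s < \<delta> \<Longrightarrow> \<bar>e s t\<bar> \<le> \<epsilon>"
  using assms(1)[unfolded vanishing_on_iff, rule_format, OF assms(2)] that by (elim exE conjE) simp

lemma negligible_onD:
  assumes "negligible_on T e" "\<epsilon> > 0"
  obtains \<delta> where "\<delta> > 0"
    "\<And>s t. 0 \<le> s \<Longrightarrow> s \<le> t \<Longrightarrow> t \<le> T \<Longrightarrow> t - s < \<delta> \<Longrightarrow> \<bar>e s t\<bar> \<le> \<epsilon> * (t - s)"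
  using assms(1)[unfolded negligible_on_iff, rule_format, OF assms(2)] that by (elim exE conjE) simp

lemma negligible_on_cong:
  assumes "negligible_on T e" "\<And>s t. 0 \<le> s \<Longrightarrow> s \<le> t \<Longrightarrow> t \<le> T \<Longrightarrow> e s t = e' s t"
  shows "negligible_on T e'"
  using assms(1) landau_o.small.in_cong[OF eventually_small_cellsI[of T "\<lambda>s t. e s t = e' s t"]] assms(2)
  by (simp add: negligible_on_def)

lemma bounded_in_bigo_small_cells:
  fixes b :: "real \<Rightarrow> real \<Rightarrow> real"
  assumes "\<And>s t. 0 \<le> s \<Longrightarrow> s \<le> t \<Longrightarrow> t \<le> T \<Longrightarrow> \<bar>b s t\<bar> \<le> K"
  shows "(\<lambda>p. b (fst p) (snd p)) \<in> O[small_cells T](\<lambda>_. 1 :: real)"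
  by (rule bigoI[of _ K]) (use eventually_small_cellsI[OF assms] in simp)

lemma vanishing_on_add:
  "vanishing_on T e \<Longrightarrow> vanishing_on T f \<Longrightarrow> vanishing_on T (\<lambda>s t. e s t + f s t)"
  unfolding vanishing_on_def by (rule sum_in_smallo(1))

lemma vanishing_on_bounded_mult:
  assumes "vanishing_on T e" "\<And>s t. 0 \<le> s \<Longrightarrow> s \<le> t \<Longrightarrow> t \<le> T \<Longrightarrow> \<bar>b s t\<bar> \<le> K"
  shows "vanishing_on T (\<lambda>s t. b s t * e s t)"
  using landau_o.big_small_mult[OF bounded_in_bigo_small_cells[OF assms(2)]
      assms(1)[unfolded vanishing_on_def]]
  by (simp add: vanishing_on_def)

lemma negligible_on_add:
  "negligible_on T e \<Longrightarrow> negligible_on T f \<Longrightarrow> negligible_on T (\<lambda>s t. e s t + f s t)"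
  unfolding negligible_on_def by (rule sum_in_smallo(1))

lemma negligible_on_sum:
  "(\<And>i. i \<in> S \<Longrightarrow> negligible_on T (e i)) \<Longrightarrow> negligible_on T (\<lambda>s t. \<Sum>i\<in>S. e i s t)"
  unfolding negligible_on_def by (rule big_sum_in_smallo)

lemma negligible_on_bounded_mult:
  assumes "negligible_on T e" "\<And>s t. 0 \<le> s \<Longrightarrow> s \<le> t \<Longrightarrow> t \<le> T \<Longrightarrow> \<bar>b s t\<bar> \<le> K"
  shows "negligible_on T (\<lambda>s t. b s t * e s t)"
  using landau_o.big_small_mult[OF bounded_in_bigo_small_cells[OF assms(2)]
      assms(1)[unfolded negligible_on_def]]
  by (simp add: negligible_on_def)

lemma negligible_on_cmult:
  "negligible_on T e \<Longrightarrow> negligible_on T (\<lambda>s t. c * e s t)"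
  by (rule negligible_on_bounded_mult[where K = "\<bar>c\<bar>"]) auto

section \<open>Small errors produced by continuous paths\<close>

lemma continuous_on_abs_bounded:
  fixes f :: "real \<Rightarrow> real"
  assumes "continuous_on {a..b} f"
  obtains K where "K \<ge> 0" "\<And>t. a \<le> t \<Longrightarrow> t \<le> b \<Longrightarrow> \<bar>f t\<bar> \<le> K"
proof -
  have "bounded (f ` {a..b})"
    using assms by (simp add: compact_continuous_image compact_imp_bounded)
  then obtain K where "K > 0" "\<And>x. x \<in> f ` {a..b} \<Longrightarrow> norm x \<le> K"
    by (auto simp: bounded_pos)
  then show ?thesis using that[of K] by auto
qed

lemma vanishing_on_continuous:
  assumes "continuous_on {0..T} f"
  shows "vanishing_on T (\<lambda>s t. f t - f s)"
  unfolding vanishing_on_iff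
proof (intro allI impI)
  fix \<epsilon> :: real assume "\<epsilon> > 0"
  have "uniformly_continuous_on {0..T} f"
    using assms by (simp add: compact_uniformly_continuous)
  then obtain d where "d > 0" and
    d: "\<And>x y. x \<in> {0..T} \<Longrightarrow> y \<in> {0..T} \<Longrightarrow> dist y x < d \<Longrightarrow> dist (f y) (f x) < \<epsilon>"
    using \<open>\<epsilon> > 0\<close> unfolding uniformly_continuous_on_def by metis
  have "\<bar>f t - f s\<bar> \<le> \<epsilon>" if "0 \<le> s \<and> s \<le> t \<and> t \<le> T \<and> t - s < d" for s t
    using d[of s t] that by (auto simp: dist_real_def)
  then show "\<exists>\<delta>>0. \<forall>s t. 0 \<le> s \<and> s \<le> t \<and> t \<le> T \<and> t - s < \<delta> \<longrightarrow> \<bar>f t - f s\<bar> \<le> \<epsilon>"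
    using \<open>d > 0\<close> by blast
qed

lemma negligible_on_vanishing_mult:
  assumes "vanishing_on T e" "negligible_on T f"
  shows "negligible_on T (\<lambda>s t. e s t * f s t)"
  using landau_o.small_mult[OF assms[unfolded vanishing_on_def negligible_on_def]]
  by (simp add: negligible_on_def)

lemma negligible_on_vanishing_linear:
  assumes "vanishing_on T e" "continuous_on {0..T} b"
  shows "negligible_on T (\<lambda>s t. e s t * (b s * (t - s)))"
proof -
  obtain K where K: "\<And>t. 0 \<le> t \<Longrightarrow> t \<le> T \<Longrightarrow> \<bar>b t\<bar> \<le> K"
    using continuous_on_abs_bounded[OF assms(2)] by blast
  have "\<forall>\<^sub>F p in small_cells T. norm (b (fst p) * (snd p - fst p)) \<le> K * norm (snd p - fst p)"
    using K by (intro eventually_small_cellsI) (simp add: abs_mult mult_right_mono)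
  then have "(\<lambda>p. b (fst p) * (snd p - fst p)) \<in> O[small_cells T](\<lambda>p. snd p - fst p)"
    by (rule bigoI)
  from landau_o.small_big_mult[OF assms(1)[unfolded vanishing_on_def] this]
  show ?thesis by (simp add: negligible_on_def)
qed

lemma integrable_on_subinterval_continuous:
  fixes f :: "real \<Rightarrow> real"
  assumes "continuous_on {0..T} f" "0 \<le> s" "t \<le> T"
  shows "f integrable_on {s..t}"
proof (rule integrable_continuous_interval)
  show "continuous_on {s..t} f"
    by (rule continuous_on_subset[OF assms(1)]) (use assms in auto)
qed

lemma abs_integral_le:
  fixes f :: "real \<Rightarrow> real"
  assumes "f integrable_on {s..t}" "\<And>r. r \<in> {s..t} \<Longrightarrow> \<bar>f r\<bar> \<le> K" "s \<le> t"
  shows "\<bar>integral {s..t} f\<bar> \<le> K * (t - s)"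
proof -
  have "norm (integral {s..t} f) \<le> integral {s..t} (\<lambda>_. K)"
    by (rule integral_norm_bound_integral) (use assms in auto)
  also have "\<dots> = K * (t - s)" using \<open>s \<le> t\<close> by simp
  finally show ?thesis by simp
qed

text \<open>Freezing the integrand at the left end costs the modulus of continuity of
  \<open>f\<close> times the length of the cell.\<close>

lemma negligible_on_integral:
  assumes f: "continuous_on {0..T} f"
  shows "negligible_on T (\<lambda>s t. integral {s..t} f - f s * (t - s))"
  unfolding negligible_on_iff
proof (intro allI impI)
  fix \<epsilon> :: real assume "\<epsilon> > 0"
  obtain d where d: "d > 0"
    "\<And>s t. 0 \<le> s \<Longrightarrow> s \<le> t \<Longrightarrow> t \<le> T \<Longrightarrow> t - s < d \<Longrightarrow> \<bar>f t - f s\<bar> \<le> \<epsilon>"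
    using vanishing_onD[OF vanishing_on_continuous[OF f] \<open>\<epsilon> > 0\<close>] by blast
  have "\<bar>integral {s..t} f - f s * (t - s)\<bar> \<le> \<epsilon> * (t - s)"
    if st: "0 \<le> s \<and> s \<le> t \<and> t \<le> T \<and> t - s < d" for s t
  proof -
    have i: "f integrable_on {s..t}"
      using integrable_on_subinterval_continuous[OF f] st by blast
    have "integral {s..t} (\<lambda>r. f r - f s) = integral {s..t} f - f s * (t - s)"
      using st i by (subst integral_diff) auto
    moreover have "\<bar>integral {s..t} (\<lambda>r. f r - f s)\<bar> \<le> \<epsilon> * (t - s)"
      by (rule abs_integral_le) (use st i d in \<open>auto intro!: integrable_diff\<close>)
    ultimately show ?thesis by simp
  qed
  then show "\<exists>\<delta>>0. \<forall>s t. 0 \<le> s \<and> s \<le> t \<and> t \<le> T \<and> t - s < \<delta> \<longrightarrow>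
      \<bar>integral {s..t} f - f s * (t - s)\<bar> \<le> \<epsilon> * (t - s)"
    using d(1) by blast
qed

lemma negligible_on_integral_increment:
  assumes w: "continuous_on {0..T} w" and f: "continuous_on {0..T} f"
  shows "negligible_on T (\<lambda>s t. integral {s..t} (\<lambda>r. (w t - w r) * f r))"
  unfolding negligible_on_iff
proof (intro allI impI)
  fix \<epsilon> :: real assume "\<epsilon> > 0"
  obtain K where K: "K \<ge> 0" "\<And>t. 0 \<le> t \<Longrightarrow> t \<le> T \<Longrightarrow> \<bar>f t\<bar> \<le> K"
    using continuous_on_abs_bounded[OF f] by blast
  \<comment> \<open>\<open>K + 1\<close> in place of \<open>K\<close> keeps the quotient meaningful
    when \<open>f\<close> vanishes.\<close>
  have h: "\<epsilon> / (K + 1) > 0" using K \<open>\<epsilon> > 0\<close> by simp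
  obtain d where d: "d > 0"
    "\<And>s t. 0 \<le> s \<Longrightarrow> s \<le> t \<Longrightarrow> t \<le> T \<Longrightarrow> t - s < d \<Longrightarrow> \<bar>w t - w s\<bar> \<le> \<epsilon> / (K + 1)"
    using vanishing_onD[OF vanishing_on_continuous[OF w] h] by blast
  have "\<bar>integral {s..t} (\<lambda>r. (w t - w r) * f r)\<bar> \<le> \<epsilon> * (t - s)"
    if st: "0 \<le> s \<and> s \<le> t \<and> t \<le> T \<and> t - s < d" for s t
  proof (rule abs_integral_le)
    have c: "continuous_on {0..T} (\<lambda>r. (w t - w r) * f r)"
      by (intro continuous_intros w f)
    show "(\<lambda>r. (w t - w r) * f r) integrable_on {s..t}"
      using integrable_on_subinterval_continuous[OF c] st by blast
    fix r assume r: "r \<in> {s..t}"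
    have "\<bar>(w t - w r) * f r\<bar> \<le> \<epsilon> / (K + 1) * (K + 1)"
      unfolding abs_mult using d(2)[of r t] K(2)[of r] K(1) st r \<open>\<epsilon> > 0\<close>
      by (intro mult_mono) auto
    then show "\<bar>(w t - w r) * f r\<bar> \<le> \<epsilon>" using K by simp
  qed (use st in auto)
  then show "\<exists>\<delta>>0. \<forall>s t. 0 \<le> s \<and> s \<le> t \<and> t \<le> T \<and> t - s < \<delta> \<longrightarrow>
      \<bar>integral {s..t} (\<lambda>r. (w t - w r) * f r)\<bar> \<le> \<epsilon> * (t - s)"
    using d(1) by blast
qed

lemma integral_increment:
  fixes f :: "real \<Rightarrow> real"
  assumes "continuous_on {0..T} f" "0 \<le> s" "s \<le> t" "t \<le> T"
  shows "integral {0..t} f - integral {0..s} f = integral {s..t} f"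
proof -
  have "integral {0..s} f + integral {s..t} f = integral {0..t} f"
    using assms(2,3) integrable_on_subinterval_continuous[OF assms(1) order_refl assms(4)]
    by (rule Henstock_Kurzweil_Integration.integral_combine)
  then show ?thesis by simp
qed

text \<open>\<open>r\<close> is the part without a derivative, such as the noise; its increment
  stays exact while the drift is frozen at the left end.\<close>

lemma negligible_on_primitive:
  assumes f: "\<And>t. 0 \<le> t \<Longrightarrow> t \<le> T \<Longrightarrow> f t - f 0 = integral {0..t} f' + r t"
    and f': "continuous_on {0..T} f'"
  shows "negligible_on T (\<lambda>s t. f t - f s - f' s * (t - s) - (r t - r s))"
proof (rule negligible_on_cong[OF negligible_on_integral[OF f']])
  fix s t assume st: "0 \<le> s" "s \<le> t" "t \<le> T"
  then show "integral {s..t} f' - f' s * (t - s) = f t - f s - f' s * (t - s) - (r t - r s)"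
    using f[of s] f[of t] integral_increment[OF f' st] by simp
qed

section \<open>Uniform grids and limits of Riemann sums\<close>

definition grid :: "real \<Rightarrow> nat \<Rightarrow> nat \<Rightarrow> real"
  where "grid T n i = T * real i / real n"

lemma grid_0 [simp]: "grid T n 0 = 0"
  by (simp add: grid_def)

lemma grid_last [simp]: "n > 0 \<Longrightarrow> grid T n n = T"
  by (simp add: grid_def)

lemma grid_step: "grid T n (Suc i) - grid T n i = T / n"
  by (simp add: grid_def diff_divide_distrib[symmetric] algebra_simps)

lemma grid_nonneg: "0 \<le> T \<Longrightarrow> 0 \<le> grid T n i"
  by (simp add: grid_def)

lemma grid_mono: "0 \<le> T \<Longrightarrow> i \<le> j \<Longrightarrow> grid T n i \<le> grid T n j"
  unfolding grid_def by (intro divide_right_mono mult_left_mono) auto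

text \<open>For \<open>n = 0\<close> division by zero puts every grid point at 0, so the bound
  survives there.\<close>

lemma grid_le: "0 \<le> T \<Longrightarrow> i \<le> n \<Longrightarrow> grid T n i \<le> T"
  by (cases "n = 0") (use grid_mono[of T i n n] in \<open>auto simp: grid_def\<close>)

lemma negligible_on_riemann_sum:
  assumes e: "negligible_on T e" and T: "T > 0"
  shows "(\<lambda>n. \<Sum>i<n. e (grid T n i) (grid T n (Suc i))) \<longlonglongrightarrow> 0"
proof (rule LIMSEQ_I)
  fix r :: real assume "r > 0"
  \<comment> \<open>At \<open>r / (2 * T)\<close> per unit length the whole grid contributes at most
    \<open>r / 2\<close>, strictly below \<open>r\<close>.\<close>
  then have h: "r / (2 * T) > 0" using T by simp
  obtain d where d: "d > 0"
    "\<And>s t. 0 \<le> s \<Longrightarrow> s \<le> t \<Longrightarrow> t \<le> T \<Longrightarrow> t - s < d \<Longrightarrow> \<bar>e s t\<bar> \<le> r / (2 * T) * (t - s)"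
    using negligible_onD[OF e h] by blast
  obtain N :: nat where N: "T / d < N" using reals_Archimedean2 by blast
  have "norm ((\<Sum>i<n. e (grid T n i) (grid T n (Suc i))) - 0) < r" if "n \<ge> Suc N" for n
  proof -
    have n: "T / d < n" "n > 0" using N that by auto
    then have mesh: "T / n < d" using d(1) T by (simp add: field_simps)
    have "\<bar>\<Sum>i<n. e (grid T n i) (grid T n (Suc i))\<bar>
        \<le> (\<Sum>i<n. \<bar>e (grid T n i) (grid T n (Suc i))\<bar>)" by (rule sum_abs)
    also have "\<dots> \<le> (\<Sum>i<n. r / (2 * T) * (T / n))"
    proof (rule sum_mono)
      fix i assume "i \<in> {..<n}"
      then show "\<bar>e (grid T n i) (grid T n (Suc i))\<bar> \<le> r / (2 * T) * (T / n)"
        using d(2)[of "grid T n i" "grid T n (Suc i)"] mesh T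
        by (simp add: grid_step grid_nonneg grid_mono grid_le)
    qed
    also have "\<dots> = r / 2" using T n by simp
    finally show ?thesis using \<open>r > 0\<close> by simp
  qed
  then show "\<exists>no. \<forall>n\<ge>no. norm ((\<Sum>i<n. e (grid T n i) (grid T n (Suc i))) - 0) < r"
    by blast
qed

lemma sum_grid_telescope:
  fixes f :: "real \<Rightarrow> real"
  assumes "n > 0"
  shows "(\<Sum>i<n. f (grid T n (Suc i)) - f (grid T n i)) = f T - f 0"
  using sum_lessThan_telescope[of "\<lambda>i. f (grid T n i)" n] assms by simp

text \<open>Telescoping turns a local expansion into a limit of sums: one guesses the primitive
  \<open>f\<close> and has to compare only its increments with \<open>G\<close>. Stochastic sums are
  treated this way too, path by path.\<close>

lemma riemann_sum_tendsto:
  assumes e: "negligible_on T (\<lambda>s t. f t - f s - G s t)" and T: "T > 0"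
  shows "(\<lambda>n. \<Sum>i<n. G (grid T n i) (grid T n (Suc i))) \<longlonglongrightarrow> f T - f 0"
proof -
  let ?E = "\<lambda>n. \<Sum>i<n. f (grid T n (Suc i)) - f (grid T n i)
      - G (grid T n i) (grid T n (Suc i))"
  have "(\<lambda>n. (f T - f 0) - ?E n) \<longlonglongrightarrow> (f T - f 0) - 0"
    by (intro tendsto_diff tendsto_const negligible_on_riemann_sum[OF e T])
  moreover have "\<forall>\<^sub>F n in sequentially. (f T - f 0) - ?E n
      = (\<Sum>i<n. G (grid T n i) (grid T n (Suc i)))"
    using eventually_gt_at_top[of 0]
  proof eventually_elim
    case (elim n)
    have "?E n = (\<Sum>i<n. f (grid T n (Suc i)) - f (grid T n i))
        - (\<Sum>i<n. G (grid T n i) (grid T n (Suc i)))" by (rule sum_subtractf)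
    also have "(\<Sum>i<n. f (grid T n (Suc i)) - f (grid T n i)) = f T - f 0"
      using elim by (rule sum_grid_telescope)
    finally show ?case by simp
  qed
  ultimately show ?thesis by (simp add: filterlim_cong)
qed

lemma riemann_sum_tendsto_integral:
  assumes f: "continuous_on {0..T} f" and T: "T > 0"
  shows "(\<lambda>n. \<Sum>i<n. f (grid T n i) * (T / n)) \<longlonglongrightarrow> integral {0..T} f"
proof -
  have "negligible_on T (\<lambda>s t. integral {0..t} f - integral {0..s} f - f s * (t - s))"
  proof (rule negligible_on_cong[OF negligible_on_integral[OF f]])
    fix s t assume st: "0 \<le> s" "s \<le> t" "t \<le> T"
    have "integral {0..s} f + integral {s..t} f = integral {0..t} f"
      using integrable_on_subinterval_continuous[OF f] st
      by (intro Henstock_Kurzweil_Integration.integral_combine) auto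
    then show "integral {s..t} f - f s * (t - s)
        = integral {0..t} f - integral {0..s} f - f s * (t - s)" by simp
  qed
  from riemann_sum_tendsto[OF this T] show ?thesis by (simp add: grid_step)
qed

section \<open>The matrix exponential\<close>

lemma matrix_power_0 [simp]: "matrix_power A 0 = mat 1"
  by (simp add: matrix_power_def)

lemma matrix_power_Suc: "matrix_power A (Suc k) = A ** matrix_power A k"
  by (simp add: matrix_power_def)

lemma matrix_power_Suc_right: "matrix_power A (Suc k) = matrix_power A k ** A"
proof (induction k)
  case (Suc k)
  then show ?case by (simp add: matrix_power_Suc matrix_mul_assoc)
qed (simp add: matrix_power_Suc)

lemma matrix_power_scaleR: "matrix_power (t *\<^sub>R A) k = t ^ k *\<^sub>R matrix_power A k"
  by (induction k) (simp_all add: matrix_power_Suc scalar_matrix_assoc[symmetric] matrix_scalar_ac scaleR_matrix_vector_assoc ac_simps)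

lemma transpose_matrix_power: "transpose (matrix_power A k) = matrix_power (transpose A) k"
proof (induction k)
  case (Suc k)
  have "transpose (matrix_power A (Suc k)) = transpose (matrix_power A k ** A)"
    by (simp only: matrix_power_Suc_right)
  then show ?case using Suc by (simp add: matrix_transpose_mul matrix_power_Suc)
qed simp

text \<open>The sum of all absolute entries dominates every row sum, so each further factor
  \<open>A\<close> costs one more power of it. This makes the exponential series comparable with a
  scalar one.\<close>

lemma abs_matrix_power_le:
  "\<bar>matrix_power A k $ i $ j\<bar> \<le> (\<Sum>i\<in>UNIV. \<Sum>j\<in>UNIV. \<bar>A $ i $ j\<bar>) ^ k"
proof (induction k arbitrary: i j)
  case 0
  then show ?case by (simp add: mat_def)
next
  case (Suc k)
  let ?a = "\<Sum>i\<in>UNIV. \<Sum>j\<in>UNIV. \<bar>A $ i $ j\<bar>"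
  have "\<bar>matrix_power A (Suc k) $ i $ j\<bar> = \<bar>\<Sum>l\<in>UNIV. A $ i $ l * matrix_power A k $ l $ j\<bar>"
    by (simp add: matrix_power_Suc matrix_matrix_mult_def)
  also have "\<dots> \<le> (\<Sum>l\<in>UNIV. \<bar>A $ i $ l\<bar> * ?a ^ k)"
    by (rule order_trans[OF sum_abs]) (auto intro!: sum_mono mult_left_mono Suc simp: abs_mult)
  also have "\<dots> = (\<Sum>l\<in>UNIV. \<bar>A $ i $ l\<bar>) * ?a ^ k" by (simp add: sum_distrib_right)
  also have "\<dots> \<le> ?a * ?a ^ k"
    by (intro mult_right_mono member_le_sum[of i UNIV "\<lambda>i. \<Sum>l\<in>UNIV. \<bar>A $ i $ l\<bar>"])
       (auto intro!: sum_nonneg zero_le_power)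
  finally show ?case by simp
qed

lemma summable_matrix_power_entry:
  "summable (\<lambda>k. matrix_power A k $ i $ j / fact k * (t::real) ^ k)"
proof (rule summable_comparison_test')
  let ?a = "\<Sum>i\<in>UNIV. \<Sum>j\<in>UNIV. \<bar>A $ i $ j\<bar>"
  show "summable (\<lambda>k. inverse (fact k) * (?a * \<bar>t\<bar>) ^ k)"
    by (rule summable_exp)
  fix k :: nat
  show "norm (matrix_power A k $ i $ j / fact k * t ^ k) \<le> inverse (fact k) * (?a * \<bar>t\<bar>) ^ k"
    using mult_right_mono[OF abs_matrix_power_le[of A k i j], of "\<bar>t\<bar> ^ k / fact k"]
    by (simp add: abs_mult power_mult_distrib power_abs field_simps)
qed

text \<open>Convergence of matrices is coordinatewise, so each entry is a real power series in
  \<open>t\<close> that converges everywhere and may be differentiated term by term.\<close>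

lemma matrix_exp_entry:
  "matrix_exp (t *\<^sub>R A) $ i $ j = (\<Sum>k. matrix_power A k $ i $ j / fact k * t ^ k)"
proof -
  have "(\<lambda>k. (1 / fact k) *\<^sub>R matrix_power (t *\<^sub>R A) k)
      sums (\<chi> i j. \<Sum>k. matrix_power A k $ i $ j / fact k * t ^ k)"
    unfolding sums_def
  proof (intro vec_tendstoI)
    fix i j
    have "(\<lambda>n. \<Sum>k<n. matrix_power A k $ i $ j / fact k * t ^ k)
        \<longlonglongrightarrow> (\<Sum>k. matrix_power A k $ i $ j / fact k * t ^ k)"
      by (rule summable_LIMSEQ[OF summable_matrix_power_entry])
    then show "(\<lambda>n. (\<Sum>k<n. (1 / fact k) *\<^sub>R matrix_power (t *\<^sub>R A) k) $ i $ j)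
        \<longlonglongrightarrow> (\<chi> i j. \<Sum>k. matrix_power A k $ i $ j / fact k * t ^ k) $ i $ j"
      by (simp add: matrix_power_scaleR mult.commute)
  qed
  from sums_unique[OF this]
  have "matrix_exp (t *\<^sub>R A) = (\<chi> i j. \<Sum>k. matrix_power A k $ i $ j / fact k * t ^ k)"
    by (simp only: matrix_exp_def)
  then show ?thesis by simp
qed

lemma transpose_matrix_exp: "transpose (matrix_exp (t *\<^sub>R A)) = matrix_exp (t *\<^sub>R transpose A)"
  by (simp add: vec_eq_iff transpose_def[of "matrix_exp _"] matrix_exp_entry
      transpose_matrix_power[symmetric]) (simp add: transpose_def)

lemma matrix_exp_0 [simp]: "matrix_exp (0 *\<^sub>R A) = mat 1"
proof -
  have "(\<Sum>k. matrix_power A k $ i $ j / fact k * 0 ^ k) = mat 1 $ i $ j" for i j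
    using powser_zero[of "\<lambda>k. matrix_power A k $ i $ j / fact k"] by simp
  then show ?thesis by (simp add: vec_eq_iff matrix_exp_entry del: scaleR_zero_left)
qed

lemma DERIV_matrix_exp_entry_aux:
  "((\<lambda>t. matrix_exp (t *\<^sub>R A) $ i $ j) has_real_derivative
    (\<Sum>k. matrix_power A (Suc k) $ i $ j / fact k * t ^ k)) (at t)"
proof -
  have "((\<lambda>t. \<Sum>k. matrix_power A k $ i $ j / fact k * t ^ k) has_real_derivative
      (\<Sum>k. diffs (\<lambda>k. matrix_power A k $ i $ j / fact k) k * t ^ k)) (at t)"
    by (rule termdiffs_strong_converges_everywhere[OF summable_matrix_power_entry])
  moreover have "diffs (\<lambda>k. matrix_power A k $ i $ j / fact k) k
      = matrix_power A (Suc k) $ i $ j / fact k" for k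
    by (simp add: diffs_def field_simps del: of_nat_Suc)
  ultimately show ?thesis by (simp add: matrix_exp_entry)
qed

text \<open>Splitting off the last factor of each power leaves \<open>A\<close> on the right, where
  it acts on the initial vector.\<close>

lemma DERIV_matrix_exp_entry:
  "((\<lambda>t. matrix_exp (t *\<^sub>R A) $ i $ j) has_real_derivative
    (matrix_exp (t *\<^sub>R A) ** A) $ i $ j) (at t)"
proof -
  have "(\<Sum>k. matrix_power A (Suc k) $ i $ j / fact k * t ^ k)
      = (\<Sum>k. \<Sum>l\<in>UNIV. matrix_power A k $ i $ l / fact k * t ^ k * A $ l $ j)"
    by (simp add: matrix_power_Suc_right matrix_matrix_mult_def sum_divide_distrib
        sum_distrib_right sum_distrib_left mult.assoc mult.commute mult.left_commute)
  also have "\<dots> = (\<Sum>l\<in>UNIV. \<Sum>k. matrix_power A k $ i $ l / fact k * t ^ k * A $ l $ j)"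
    by (intro suminf_sum summable_mult2 summable_matrix_power_entry)
  also have "\<dots> = (matrix_exp (t *\<^sub>R A) ** A) $ i $ j"
    by (simp only: matrix_matrix_mult_def vec_lambda_beta matrix_exp_entry
        suminf_mult2[OF summable_matrix_power_entry])
  finally show ?thesis using DERIV_matrix_exp_entry_aux[of A i j t] by simp
qed

lemma inner_matrix_vector_mult_sum:
  fixes M :: "real^'n^'m"
  shows "a \<bullet> (M *v x) = (\<Sum>i\<in>UNIV. \<Sum>j\<in>UNIV. a $ i * M $ i $ j * x $ j)"
  by (simp add: inner_vec_def matrix_vector_mult_def sum_distrib_left mult.assoc)

lemma DERIV_inner_matrix_exp:
  "((\<lambda>t. a \<bullet> (matrix_exp (t *\<^sub>R A) *v x)) has_real_derivative
    a \<bullet> (matrix_exp (t *\<^sub>R A) *v (A *v x))) (at t)"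
  unfolding matrix_vector_mul_assoc
  by (simp only: inner_matrix_vector_mult_sum)
     (auto intro!: derivative_eq_intros DERIV_matrix_exp_entry sum.cong simp: mult_ac)

lemma continuous_on_inner_matrix_exp:
  "continuous_on S (\<lambda>t. a \<bullet> (matrix_exp (t *\<^sub>R A) *v x))"
  by (intro continuous_at_imp_continuous_on ballI DERIV_isCont[OF DERIV_inner_matrix_exp])


section \<open>Exponential decay\<close>

text \<open>This is \<open>p(A) x\<close> in Horner form; acting on a vector avoids polynomials of
  matrices.\<close>

definition apply_poly :: "complex^'n^'n \<Rightarrow> complex poly \<Rightarrow> complex^'n \<Rightarrow> complex^'n"
  where "apply_poly A p x = fold_coeffs (\<lambda>c y. c *s x + A *v y) p 0"

lemma apply_poly_0 [simp]: "apply_poly A 0 x = 0"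
  by (simp add: apply_poly_def)

lemma apply_poly_pCons [simp]: "apply_poly A (pCons c p) x = c *s x + A *v apply_poly A p x"
  by (cases "c = 0 \<and> p = 0") (auto simp: apply_poly_def)

lemma apply_poly_add: "apply_poly A (p + q) x = apply_poly A p x + apply_poly A q x"
  by (induction p q rule: poly_induct2)
     (simp_all add: matrix_vector_right_distrib vector_sadd_rdistrib algebra_simps)

lemma apply_poly_smult: "apply_poly A (smult c p) x = c *s apply_poly A p x"
  by (induction p) (simp_all add: vector_add_ldistrib vector_smult_assoc vector_scalar_commute)

lemma apply_poly_monom:
  "apply_poly A (monom c k) x = c *s (((\<lambda>y. A *v y) ^^ k) x)"
  by (induction k) (simp_all add: monom_0 monom_Suc vector_scalar_commute)

lemma apply_poly_commute: "apply_poly A p (A *v x) = A *v apply_poly A p x"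
  by (induction p) (simp_all add: matrix_vector_right_distrib vector_scalar_commute)

lemma apply_poly_diff_vec: "apply_poly A p (x - y) = apply_poly A p x - apply_poly A p y"
  by (induction p) (simp_all add: matrix_vector_mult_diff_distrib vector_ssub_ldistrib add_diff_add)

lemma apply_poly_smult_vec: "apply_poly A p (c *s x) = c *s apply_poly A p x"
  by (induction p) (simp_all add: vector_scalar_commute vector_add_ldistrib vector_smult_assoc mult.commute)

lemma apply_poly_linear_factor:
  "apply_poly A ([:- \<mu>, 1:] * p) x = A *v apply_poly A p x - \<mu> *s apply_poly A p x"
proof -
  have "[:- \<mu>, 1:] * p = smult (- \<mu>) p + pCons 0 p" by simp
  then show ?thesis by (simp only: apply_poly_add apply_poly_smult apply_poly_pCons) simp
qed

text \<open>Coefficients are attached to indices because \<open>y\<close> may repeat values;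
  induction splits off the last vector.\<close>

lemma span_image_lessThan:
  fixes y :: "nat \<Rightarrow> 'a::real_vector"
  assumes "x \<in> span (y ` {..<m})"
  shows "\<exists>c. x = (\<Sum>k<m. c k *\<^sub>R y k)"
  using assms
proof (induction m arbitrary: x)
  case (Suc m)
  then obtain r where "x - r *\<^sub>R y m \<in> span (y ` {..<m})"
    by (auto simp: lessThan_Suc span_breakdown_eq)
  then obtain c where "x - r *\<^sub>R y m = (\<Sum>k<m. c k *\<^sub>R y k)" using Suc.IH by blast
  then have "x = (\<Sum>k<Suc m. (c(m := r)) k *\<^sub>R y k)" by (simp add: algebra_simps)
  then show ?case by blast
qed simp

text \<open>Some Krylov vector among \<open>x\<close>, \<open>A x\<close>, \<open>A (A x)\<close>,
  ... lies in the span of its predecessors, since otherwise there would be more independent vectors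
  than the dimension allows. The polynomial belongs to this one \<open>x\<close>, which takes the
  place of the Cayley-Hamilton theorem.\<close>

lemma exists_annihilating_poly:
  fixes A :: "real^'n^'n" and x :: "real^'n"
  obtains p where "p \<noteq> 0"
    "apply_poly (map_matrix complex_of_real A) p (\<chi> i. complex_of_real (x $ i)) = 0"
proof -
  define y where "y k = ((\<lambda>y. A *v y) ^^ k) x" for k
  have "\<exists>m. y m \<in> span (y ` {..<m})"
  proof (rule ccontr)
    assume n: "\<not> ?thesis"
    have "independent (y ` {..<m}) \<and> card (y ` {..<m}) = m" for m
    proof (induction m)
      case (Suc m)
      have "y m \<notin> span (y ` {..<m})" using n by blast
      moreover from this have "y m \<notin> y ` {..<m}" by (meson span_base)
      ultimately show ?case using Suc by (simp add: lessThan_Suc independent_insertI)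
    qed (simp add: independent_empty)
    then have "independent (y ` {..<Suc (DIM(real^'n))})"
      "card (y ` {..<Suc (DIM(real^'n))}) = Suc (DIM(real^'n))" by blast+
    then show False using independent_bound[of "y ` {..<Suc (DIM(real^'n))}"] by linarith
  qed
  then obtain m where "y m \<in> span (y ` {..<m})" by blast
  from span_image_lessThan[OF this]
  obtain c where c: "y m = (\<Sum>k<m. c k *\<^sub>R y k)" ..
  let ?C = "map_matrix complex_of_real A" and ?emb = "\<lambda>x::real^'n. \<chi> i. complex_of_real (x $ i)"
  have emb: "((\<lambda>y. ?C *v y) ^^ k) (?emb x) = ?emb (y k)" for k
    by (induction k) (simp_all add: y_def vec_eq_iff matrix_vector_mult_def)
  \<comment> \<open>The coefficient 1 at degree \<open>m\<close>, above all subtracted monomials,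
    keeps \<open>p\<close> nonzero.\<close>
  define p where "p = monom 1 m - (\<Sum>k<m. monom (complex_of_real (c k)) k)"
  have "coeff p m = 1" by (simp add: p_def coeff_sum)
  then have "p \<noteq> 0" by auto
  have sum: "apply_poly ?C (\<Sum>k\<in>S. f k) z = (\<Sum>k\<in>S. apply_poly ?C (f k) z)"
    if "finite S" for S :: "nat set" and f z
    using that by (induction S rule: finite_induct) (simp_all add: apply_poly_add)
  \<comment> \<open>The subtracted sum is added back, so that additivity of
    \<open>apply_poly\<close> in the polynomial suffices.\<close>
  have "apply_poly ?C (p + (\<Sum>k<m. monom (complex_of_real (c k)) k)) (?emb x) = ?emb (y m)"
    by (simp add: p_def apply_poly_monom emb)
  then have "apply_poly ?C p (?emb x) + (\<Sum>k<m. complex_of_real (c k) *s ?emb (y k)) = ?emb (y m)"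
    by (simp add: apply_poly_add sum apply_poly_monom emb)
  moreover have "?emb (y m) = (\<Sum>k<m. complex_of_real (c k) *s ?emb (y k))"
    by (subst c) (simp add: vec_eq_iff sum_component)
  ultimately have "apply_poly ?C p (?emb x) = 0" by simp
  then show ?thesis using that \<open>p \<noteq> 0\<close> by blast
qed

definition decaying :: "real^'n^'n \<Rightarrow> complex^'n \<Rightarrow> bool"
  where "decaying A z \<longleftrightarrow> (\<exists>C c. c > 0 \<and> (\<forall>t\<ge>0. \<forall>i.
    norm ((map_matrix complex_of_real (matrix_exp (t *\<^sub>R A)) *v z) $ i) \<le> C * exp (- c * t)))"

lemma map_matrix_of_real_mult:
  "map_matrix complex_of_real (A ** B) = map_matrix complex_of_real A ** map_matrix complex_of_real B"
  by (simp add: vec_eq_iff matrix_matrix_mult_def)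

lemma has_vector_derivative_matrix_exp_complex:
  "((\<lambda>t. (map_matrix complex_of_real (matrix_exp (t *\<^sub>R A)) *v z) $ i) has_vector_derivative
    (map_matrix complex_of_real (matrix_exp (t *\<^sub>R A)) *v (map_matrix complex_of_real A *v z)) $ i)
   (at t)"
proof -
  have "((\<lambda>t. \<Sum>j\<in>UNIV. complex_of_real (matrix_exp (t *\<^sub>R A) $ i $ j) * z $ j) has_vector_derivative
    (\<Sum>j\<in>UNIV. complex_of_real ((matrix_exp (t *\<^sub>R A) ** A) $ i $ j) * z $ j)) (at t)"
    by (intro has_vector_derivative_sum has_vector_derivative_mult_left
        has_vector_derivative_of_real)
      (rule DERIV_matrix_exp_entry)
  then show ?thesis
    by (simp add: matrix_vector_mul_assoc map_matrix_of_real_mult[symmetric])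
       (simp add: matrix_vector_mult_def)
qed

text \<open>Variation of constants: \<open>exp (- \<mu> t) e^{tA} z\<close> has derivative
  \<open>exp (- \<mu> t) e^{tA} (A z - \<mu> z)\<close>, whose last factor decays by assumption.
  Integrating and multiplying back by \<open>exp (\<mu> t)\<close> gives the claim.\<close>

lemma decaying_step:
  fixes A :: "real^'n^'n"
  assumes \<mu>: "Re \<mu> < 0" and d: "decaying A (map_matrix complex_of_real A *v z - \<mu> *s z)"
  shows "decaying A z"
proof -
  let ?C = "map_matrix complex_of_real A"
  define E where "E t = map_matrix complex_of_real (matrix_exp (t *\<^sub>R A))" for t
  define y where "y = ?C *v z - \<mu> *s z"
  obtain C c where c: "c > 0" and C: "\<And>t i. t \<ge> 0 \<Longrightarrow> norm ((E t *v y) $ i) \<le> C * exp (- c * t)"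
    using d unfolding decaying_def E_def y_def by blast
  have C0: "C \<ge> 0" using order_trans[OF norm_ge_zero C[of 0]] by simp
  \<comment> \<open>The new rate must stay strictly below \<open>- Re \<mu>\<close> for
    \<open>b\<close> to be positive. If both rates agreed, integration would produce a polynomial
    factor; the half excludes this resonance.\<close>
  define c' where "c' = min c (- Re \<mu> / 2)"
  define b where "b = - Re \<mu> - c'"
  have c': "c' > 0" "c' \<le> c" "b > 0" using c \<mu> by (auto simp: c'_def b_def)
  have der: "((\<lambda>t. exp (- \<mu> * of_real t) * (E t *v z) $ i) has_vector_derivative
      exp (- \<mu> * of_real t) * (E t *v y) $ i) (at t)" for t i
  proof -
    have 1: "((\<lambda>t. exp (- \<mu> * of_real t)) has_vector_derivative - \<mu> * exp (- \<mu> * of_real t)) (at t)"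
      by (rule has_vector_derivative_real_field) (auto intro!: derivative_eq_intros)
    have 2: "((\<lambda>t. (E t *v z) $ i) has_vector_derivative (E t *v (?C *v z)) $ i) (at t)"
      unfolding E_def by (rule has_vector_derivative_matrix_exp_complex)
    have "?C *v z = y + \<mu> *s z" by (simp add: y_def)
    then have 3: "(E t *v (?C *v z)) $ i = (E t *v y) $ i + \<mu> * (E t *v z) $ i"
      by (simp add: matrix_vector_right_distrib vector_scalar_commute)
    show ?thesis
      using has_vector_derivative_mult[OF 1 2] unfolding 3 by (simp add: algebra_simps)
  qed
  \<comment> \<open>The sum bounds the initial value, and \<open>C / b\<close> comes from
    integrating \<open>C * exp (b * x)\<close>.\<close>
  define K where "K = (\<Sum>i\<in>UNIV. norm (z $ i)) + C / b"
  have bound: "norm ((E t *v z) $ i) \<le> K * exp (- c' * t)" if t: "t \<ge> 0" for t i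
  proof -
    let ?h = "\<lambda>t. exp (- \<mu> * of_real t) * (E t *v z) $ i"
    \<comment> \<open>Mean value inequality, with a primitive of the bound on the derivative as
      comparison function.\<close>
    have n: "norm (?h t - ?h 0) \<le> C / b * exp (b * t) - C / b * exp (b * 0)"
    proof (cases "t = 0")
      case False
      show ?thesis
      proof (rule differentiable_bound_general)
        show "0 < t" using t False by simp
        show "continuous_on {0..t} ?h"
          by (intro continuous_at_imp_continuous_on ballI
              has_vector_derivative_continuous[OF der])
        show "continuous_on {0..t} (\<lambda>t. C / b * exp (b * t))" by (intro continuous_intros)
        fix x assume x: "0 < x" "x < t"
        show "(?h has_vector_derivative exp (- \<mu> * of_real x) * (E x *v y) $ i) (at x)" by (rule der)
        show "((\<lambda>t. C / b * exp (b * t)) has_vector_derivative C * exp (b * x)) (at x)"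
          unfolding has_real_derivative_iff_has_vector_derivative[symmetric]
          using c' by (auto intro!: derivative_eq_intros)
        have "norm (exp (- \<mu> * of_real x) * (E x *v y) $ i) \<le> exp (- Re \<mu> * x) * (C * exp (- c * x))"
          unfolding norm_mult using C[of x i] x by (intro mult_mono) auto
        also have "\<dots> \<le> exp (- Re \<mu> * x) * (C * exp (- c' * x))"
          using c' x C0 by (intro mult_left_mono) auto
        also have "\<dots> = C * exp (b * x)" by (simp add: b_def exp_add[symmetric] algebra_simps)
        finally show "norm (exp (- \<mu> * of_real x) * (E x *v y) $ i) \<le> C * exp (b * x)" .
      qed
    qed simp
    have "E 0 = mat 1"
      using matrix_exp_0[of A] by (simp add: E_def vec_eq_iff mat_def)
    then have "norm (?h 0) \<le> (\<Sum>i\<in>UNIV. norm (z $ i))"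
      using member_le_sum[of i UNIV "\<lambda>i. norm (z $ i)"] by simp
    then have "norm (?h t) \<le> (\<Sum>i\<in>UNIV. norm (z $ i)) + C / b * exp (b * t)"
      using n norm_triangle_ineq2[of "?h t" "?h 0"] divide_nonneg_pos[OF C0 c'(3)]
      by (simp del: norm_mult)
    also have "\<dots> \<le> (\<Sum>i\<in>UNIV. norm (z $ i)) * exp (b * t) + C / b * exp (b * t)"
      using c' t mult_left_mono[of 1 "exp (b * t)" "\<Sum>i\<in>UNIV. norm (z $ i)"]
      by (simp add: sum_nonneg)
    also have "\<dots> = K * exp (b * t)" by (simp add: K_def algebra_simps)
    finally have "exp (- Re \<mu> * t) * norm ((E t *v z) $ i) \<le> K * exp (b * t)"
      by (simp add: norm_mult)
    then have "exp (Re \<mu> * t) * (exp (- Re \<mu> * t) * norm ((E t *v z) $ i))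
        \<le> exp (Re \<mu> * t) * (K * exp (b * t))" by (rule mult_left_mono) simp
    also have "\<dots> = K * exp (- c' * t)" by (simp add: b_def exp_add[symmetric] algebra_simps)
    finally show ?thesis by (simp add: mult.assoc[symmetric] exp_add[symmetric])
  qed
  then show ?thesis unfolding decaying_def E_def using c'(1) by blast
qed

text \<open>Linear factors \<open>X - \<mu>\<close> of an annihilating polynomial are split off one by one: if \<open>\<mu>\<close> is not an
  eigenvalue, the factor can be cancelled; otherwise \<open>Re \<mu> < 0\<close> and variation of constants applies.\<close>

lemma decaying_of_annihilating_poly:
  fixes A :: "real^'n^'n"
  assumes stable: "\<And>\<mu>. complex_eigenvalue A \<mu> \<Longrightarrow> Re \<mu> < 0"
    and "p \<noteq> 0" "apply_poly (map_matrix complex_of_real A) p z = 0"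
  shows "decaying A z"
  using assms(2,3)
proof (induction "degree p" arbitrary: p z)
  case 0
  obtain c where c: "p = [:c:]" using 0(1) by (elim degree_eq_zeroE[OF sym])
  then have "c \<noteq> 0" using 0(2) by simp
  moreover have "c *s z = 0" using 0(3) c by simp
  ultimately have "z = 0" by simp
  then show ?case by (auto simp: decaying_def intro!: exI[of _ 0] exI[of _ 1])
next
  case (Suc n)
  let ?C = "map_matrix complex_of_real A"
  have "\<not> constant (poly p)" using Suc.hyps(2) by (simp add: constant_degree)
  then obtain \<mu> where "poly p \<mu> = 0" using fundamental_theorem_of_algebra by blast
  then obtain q where q: "p = [:- \<mu>, 1:] * q" using poly_eq_0_iff_dvd by blast
  have "q \<noteq> 0" using q Suc.prems by auto
  then have "degree p = degree [:- \<mu>, 1:] + degree q"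
    unfolding q by (intro degree_mult_eq) auto
  then have deg: "n = degree q" using Suc.hyps(2) by simp
  let ?w = "apply_poly ?C q z"
  have w: "?C *v ?w = \<mu> *s ?w"
    using Suc.prems(2) unfolding q apply_poly_linear_factor by simp
  show ?case
  proof (cases "?w = 0")
    case True
    then show ?thesis using Suc.hyps(1)[OF deg \<open>q \<noteq> 0\<close>] by blast
  next
    case False
    then have "complex_eigenvalue A \<mu>" using w unfolding complex_eigenvalue_def by blast
    then have "Re \<mu> < 0" by (rule stable)
    moreover have "apply_poly ?C q (?C *v z - \<mu> *s z) = 0"
      using w by (simp add: apply_poly_diff_vec apply_poly_smult_vec apply_poly_commute)
    then have "decaying A (?C *v z - \<mu> *s z)" using Suc.hyps(1)[OF deg \<open>q \<noteq> 0\<close>] by blast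
    ultimately show ?thesis by (rule decaying_step)
  qed
qed

text \<open>The columns of \<open>e^{tA}\<close> are its values at the axis vectors, each of which
  decays. As there are finitely many, the slowest rate and the sum of the constants serve for all
  entries.\<close>

lemma matrix_exp_decay:
  fixes A :: "real^'n^'n"
  assumes stable: "\<And>\<mu>. complex_eigenvalue A \<mu> \<Longrightarrow> Re \<mu> < 0"
  obtains C c where "C \<ge> 0" "c > 0"
    "\<And>t a x. t \<ge> 0 \<Longrightarrow> \<bar>a \<bullet> (matrix_exp (t *\<^sub>R A) *v x)\<bar> \<le> C * exp (- c * t) * (norm a * norm x)"
proof -
  have "\<exists>C c. c > 0 \<and> (\<forall>t\<ge>0. \<forall>i. \<bar>matrix_exp (t *\<^sub>R A) $ i $ j\<bar> \<le> C * exp (- c * t))" for j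
  proof -
    let ?z = "\<chi> i. complex_of_real ((axis j 1 :: real^'n) $ i)"
    obtain p where "p \<noteq> 0" "apply_poly (map_matrix complex_of_real A) p ?z = 0"
      by (rule exists_annihilating_poly)
    then have "decaying A ?z" using decaying_of_annihilating_poly[OF stable] by blast
    moreover have "(map_matrix complex_of_real (matrix_exp (t *\<^sub>R A)) *v ?z) $ i
        = complex_of_real (matrix_exp (t *\<^sub>R A) $ i $ j)" for t i
      by (simp add: matrix_vector_mult_def axis_def if_distrib cong: if_cong)
    ultimately show ?thesis unfolding decaying_def by simp
  qed
  then obtain C c where c: "\<And>j. c j > 0" and
    C: "\<And>j t i. t \<ge> 0 \<Longrightarrow> \<bar>matrix_exp (t *\<^sub>R A) $ i $ j\<bar> \<le> C j * exp (- c j * t)" by metis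
  have C0: "C j \<ge> 0" for j using order_trans[OF abs_ge_zero C[of 0 _ j]] by simp
  define c' where "c' = Min (range c)"
  have c': "c' > 0" "\<And>j. c' \<le> c j" using c by (simp_all add: c'_def)
  define K where "K = (\<Sum>i\<in>(UNIV::'n set). \<Sum>j\<in>UNIV. C j)"
  have "\<bar>a \<bullet> (matrix_exp (t *\<^sub>R A) *v x)\<bar> \<le> K * exp (- c' * t) * (norm a * norm x)"
    if t: "t \<ge> 0" for t a x
  proof -
    have "\<bar>a $ i * matrix_exp (t *\<^sub>R A) $ i $ j * x $ j\<bar>
        \<le> C j * exp (- c' * t) * (norm a * norm x)" for i j
    proof -
      have "\<bar>matrix_exp (t *\<^sub>R A) $ i $ j\<bar> \<le> C j * exp (- c j * t)" by (rule C[OF t])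
      also have "\<dots> \<le> C j * exp (- c' * t)"
        using c'(2)[of j] t C0[of j] by (intro mult_left_mono) (auto intro: mult_right_mono)
      finally have "\<bar>a $ i\<bar> * \<bar>matrix_exp (t *\<^sub>R A) $ i $ j\<bar> * \<bar>x $ j\<bar>
          \<le> norm a * (C j * exp (- c' * t)) * norm x"
        using C0[of j] by (intro mult_mono component_le_norm_cart) auto
      then show ?thesis by (simp add: abs_mult mult_ac)
    qed
    then have "\<bar>a \<bullet> (matrix_exp (t *\<^sub>R A) *v x)\<bar>
        \<le> (\<Sum>i\<in>(UNIV::'n set). \<Sum>j\<in>UNIV. C j * exp (- c' * t) * (norm a * norm x))"
      unfolding inner_matrix_vector_mult_sum
      by (intro order_trans[OF sum_abs] sum_mono)
    then show ?thesis by (simp only: K_def sum_distrib_right)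
  qed
  moreover have "K \<ge> 0" unfolding K_def by (intro sum_nonneg C0)
  ultimately show ?thesis using that c'(1) by blast
qed

text \<open>The squared norm of \<open>B^T e^{tA^T} a\<close>: the rate at which noise of age
  \<open>t\<close> contributes to the variance of \<open>\<langle>a, v\<rangle>\<close>. Its
  integral over the half line is the stationary variance.\<close>

definition noise_intensity :: "real^'d^'d \<Rightarrow> real^'m^'d \<Rightarrow> real^'d \<Rightarrow> real \<Rightarrow> real"
  where "noise_intensity A B a t =
    (\<Sum>l\<in>UNIV. (a \<bullet> (matrix_exp (t *\<^sub>R A) *v column l B))\<^sup>2)"

lemma noise_intensity_nonneg: "noise_intensity A B a t \<ge> 0"
  by (simp add: noise_intensity_def sum_nonneg)

lemma continuous_on_noise_intensity: "continuous_on S (noise_intensity A B a)"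
  unfolding noise_intensity_def
  by (intro continuous_intros continuous_on_inner_matrix_exp)

lemma inner_matrix_vector_transpose:
  fixes M :: "real^'n^'m"
  shows "b \<bullet> (M *v y) = (transpose M *v b) \<bullet> y"
  using dot_lmul_matrix[of b M y] by simp

text \<open>Two vectors are allowed so that the formula covers both the matrix entries, needed for
  integrability, and the quadratic form at \<open>a\<close>, where it becomes
  \<open>noise_intensity\<close>.\<close>

lemma inner_covariance_integrand:
  fixes A :: "real^'d^'d" and B :: "real^'m^'d"
  shows "b \<bullet> ((matrix_exp (t *\<^sub>R A) ** B ** transpose B ** matrix_exp (t *\<^sub>R transpose A)) *v b') =
    (\<Sum>l\<in>UNIV. (b \<bullet> (matrix_exp (t *\<^sub>R A) *v column l B)) * (b' \<bullet> (matrix_exp (t *\<^sub>R A) *v column l B)))"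
proof -
  let ?E = "matrix_exp (t *\<^sub>R A)"
  have comp: "(transpose B *v (transpose ?E *v b)) $ l = b \<bullet> (?E *v column l B)" for b l
  proof -
    have "(transpose B *v (transpose ?E *v b)) $ l = column l B \<bullet> (transpose ?E *v b)"
      unfolding matrix_vector_mul_component by (simp add: column_def transpose_def)
    then show ?thesis by (simp only: inner_matrix_vector_transpose[of b] inner_commute)
  qed
  have "b \<bullet> ((?E ** B ** transpose B ** transpose ?E) *v b')
      = b \<bullet> (?E *v (B *v (transpose B *v (transpose ?E *v b'))))"
    by (simp only: matrix_vector_mul_assoc matrix_mul_assoc)
  also have "\<dots> = (transpose B *v (transpose ?E *v b)) \<bullet> (transpose B *v (transpose ?E *v b'))"
    by (simp only: inner_matrix_vector_transpose)
  also have "\<dots> = (\<Sum>l\<in>UNIV. (b \<bullet> (?E *v column l B)) * (b' \<bullet> (?E *v column l B)))"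
    unfolding inner_vec_def[of "transpose B *v _"] comp by simp
  finally show ?thesis by (simp only: transpose_matrix_exp)
qed

lemma matrix_integrable_onI:
  fixes f :: "real \<Rightarrow> real^'n^'m"
  assumes "\<And>i j. (\<lambda>t. axis i 1 \<bullet> (f t *v axis j 1)) integrable_on S"
  shows "f integrable_on S"
proof (rule integrable_componentwise)
  fix b :: "real^'n^'m" assume "b \<in> Basis"
  then obtain i u where "b = axis i u" "u \<in> Basis" by (auto simp: Basis_vec_def)
  moreover then obtain j where "u = axis j 1" by (auto simp: Basis_vec_def)
  ultimately have "f t \<bullet> b = axis i 1 \<bullet> (f t *v axis j 1)" for t
    by (simp add: inner_axis inner_axis' matrix_vector_mul_component)
  then show "(\<lambda>t. f t \<bullet> b) integrable_on S" using assms by simp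
qed

text \<open>The integral defining \<open>stationary_covariance\<close> has the intended value only
  once integrability is known; exponential decay provides it entry by entry. Then the linear
  functional \<open>M \<mapsto> a \<bullet> (M *v a)\<close> passes under the integral.\<close>

lemma inner_stationary_covariance:
  fixes A :: "real^'d^'d" and B :: "real^'m^'d"
  assumes stable: "\<And>\<mu>. complex_eigenvalue A \<mu> \<Longrightarrow> Re \<mu> < 0"
  shows "(noise_intensity A B a has_integral a \<bullet> (stationary_covariance A B *v a)) {0..}"
proof -
  let ?G = "\<lambda>t. matrix_exp (t *\<^sub>R A) ** B ** transpose B ** matrix_exp (t *\<^sub>R transpose A)"
  obtain C c where C: "C \<ge> 0" and c: "c > 0" and
    decay: "\<And>t a x. t \<ge> 0 \<Longrightarrow> \<bar>a \<bullet> (matrix_exp (t *\<^sub>R A) *v x)\<bar> \<le> C * exp (- c * t) * (norm a * norm x)"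
    using matrix_exp_decay[OF stable] by blast
  have "?G integrable_on {0..}"
  proof (rule matrix_integrable_onI)
    fix i j
    let ?f = "\<lambda>t l. (axis i 1 \<bullet> (matrix_exp (t *\<^sub>R A) *v column l B)) *
        (axis j 1 \<bullet> (matrix_exp (t *\<^sub>R A) *v column l B))"
    have "(\<lambda>t. \<Sum>l\<in>UNIV. ?f t l) integrable_on {0..}"
    proof (intro integrable_sum absolutely_integrable_on_def[THEN iffD1, THEN conjunct1])
      fix l
      let ?K = "(C * norm (column l B))\<^sup>2"
      have cont: "continuous_on {0..} (\<lambda>t. ?f t l)"
        by (intro continuous_intros continuous_on_inner_matrix_exp)
      show "(\<lambda>t. ?f t l) absolutely_integrable_on {0..}"
      proof (rule measurable_bounded_by_integrable_imp_absolutely_integrable)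
        show "(\<lambda>t. ?f t l) \<in> borel_measurable (lebesgue_on {0..})"
          by (intro continuous_imp_measurable_on_sets_lebesgue cont) simp
        show "(\<lambda>t. ?K * exp (- (2 * c) * t)) integrable_on {0..}"
          using integrable_on_mult_right[OF integrable_on_exp_minus_to_infinity[of "2 * c" 0]] c
          by simp
        fix t :: real assume "t \<in> {0..}"
        then have "\<bar>axis k 1 \<bullet> (matrix_exp (t *\<^sub>R A) *v column l B)\<bar> \<le> C * norm (column l B) * exp (- c * t)" for k
          using decay[of t "axis k 1" "column l B"] by (simp add: mult_ac)
        then have "\<bar>?f t l\<bar> \<le> (C * norm (column l B) * exp (- c * t)) * (C * norm (column l B) * exp (- c * t))"
          unfolding abs_mult using C by (intro mult_mono) auto
        also have "\<dots> = ?K * exp (- (2 * c) * t)"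
          by (simp add: power2_eq_square mult_exp_exp mult_ac)
        finally show "norm (?f t l) \<le> ?K * exp (- (2 * c) * t)" by simp
      qed simp
    qed simp
    then show "(\<lambda>t. axis i 1 \<bullet> (?G t *v axis j 1)) integrable_on {0..}"
      by (simp only: inner_covariance_integrand)
  qed
  then have "(?G has_integral stationary_covariance A B) {0..}"
    unfolding stationary_covariance_def by (rule integrable_integral)
  moreover have "linear (\<lambda>M :: real^'d^'d. a \<bullet> (M *v a))"
    by (rule linearI) (simp_all add: matrix_vector_mult_add_rdistrib inner_add_right
        scaleR_matrix_vector_assoc[symmetric])
  ultimately have "((\<lambda>t. a \<bullet> (?G t *v a)) has_integral a \<bullet> (stationary_covariance A B *v a)) {0..}"
    using has_integral_linear[of ?G _ "{0..}" "\<lambda>M. a \<bullet> (M *v a)"]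
    by (simp add: o_def linear_conv_bounded_linear)
  then show ?thesis
    by (simp only: inner_covariance_integrand noise_intensity_def[abs_def] power2_eq_square)
qed

text \<open>A nonnegative integrand over a smaller set. At \<open>t = 0\<close> this also yields
  that \<open>\<langle>a, R a\<rangle>\<close> is nonnegative, which is how the square root is
  controlled later.\<close>

lemma integral_noise_intensity_le:
  fixes A :: "real^'d^'d" and B :: "real^'m^'d"
  assumes stable: "\<And>\<mu>. complex_eigenvalue A \<mu> \<Longrightarrow> Re \<mu> < 0"
  shows "integral {0..t} (noise_intensity A B a) \<le> a \<bullet> (stationary_covariance A B *v a)"
proof -
  note h = inner_stationary_covariance[of A B a, OF stable]
  have "integral {0..t} (noise_intensity A B a) \<le> integral {0..} (noise_intensity A B a)"
    using h by (intro integral_subset_le)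
      (auto intro!: integrable_continuous_interval continuous_on_noise_intensity noise_intensity_nonneg)
  then show ?thesis using h by (simp add: integral_unique)
qed

section \<open>Brownian increments\<close>

text \<open>A joint distribution is a product as soon as it factorizes on rectangles, which generate
  the product algebra and are stable under intersection.\<close>

lemma (in prob_space) indep_varI_rectangles:
  assumes [measurable]: "random_variable S X" "random_variable T Y"
    and eq: "\<And>A B. A \<in> sets S \<Longrightarrow> B \<in> sets T \<Longrightarrow>
      emeasure M ((X -` A \<inter> space M) \<inter> (Y -` B \<inter> space M))
        = emeasure M (X -` A \<inter> space M) * emeasure M (Y -` B \<inter> space M)"
  shows "indep_var S X T Y"
  unfolding indep_var_distribution_eq
proof (intro conjI assms(1,2) pair_measure_eqI)
  show "sigma_finite_measure (distr M S X)" "sigma_finite_measure (distr M T Y)"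
    by (auto intro!: prob_space_imp_sigma_finite prob_space_distr)
  fix A B assume "A \<in> sets (distr M S X)" "B \<in> sets (distr M T Y)"
  then have [measurable]: "A \<in> sets S" "B \<in> sets T" by auto
  have "(\<lambda>x. (X x, Y x)) -` (A \<times> B) \<inter> space M = (X -` A \<inter> space M) \<inter> (Y -` B \<inter> space M)" by auto
  then show "emeasure (distr M S X) A * emeasure (distr M T Y) B
      = emeasure (distr M (S \<Otimes>\<^sub>M T) (\<lambda>x. (X x, Y x))) (A \<times> B)"
    by (simp add: emeasure_distr eq)
qed simp

lemma nn_integral_normal_density:
  "\<sigma> > 0 \<Longrightarrow> (\<integral>\<^sup>+x. ennreal (normal_density \<mu> \<sigma> x) \<partial>lborel) = 1"
  using prob_space.emeasure_space_1[OF prob_space_normal_density, of \<sigma> \<mu>]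
  by (simp add: emeasure_density)

lemma nn_integral_vec_prod:
  fixes f :: "'m::finite \<Rightarrow> real \<Rightarrow> ennreal"
  assumes "\<And>i. f i \<in> borel_measurable borel"
  shows "(\<integral>\<^sup>+x. (\<Prod>i\<in>UNIV. f i ((x::real^'m) $ i)) \<partial>lborel) = (\<Prod>i\<in>UNIV. \<integral>\<^sup>+x. f i x \<partial>lborel)"
proof -
  \<comment> \<open>Lebesgue measure factorizes over \<open>Basis\<close>; \<open>idx\<close>
    recovers the coordinate from its basis vector.\<close>
  define idx :: "real^'m \<Rightarrow> 'm" where "idx b = (THE i. b = axis i 1)" for b
  have idx [simp]: "idx (axis i 1) = i" for i by (simp add: idx_def axis_eq_axis)
  have B: "(Basis :: (real^'m) set) = range (\<lambda>i. axis i 1)" by (auto simp: Basis_vec_def)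
  have inj: "inj (\<lambda>i::'m. axis i (1::real))" by (auto simp: inj_on_def axis_eq_axis)
  have "(\<integral>\<^sup>+x. (\<Prod>b\<in>Basis. f (idx b) ((x::real^'m) \<bullet> b)) \<partial>lborel)
      = (\<Prod>b\<in>Basis. \<integral>\<^sup>+x. f (idx b) x \<partial>lborel)"
    by (rule nn_integral_lborel_prod) (use assms in auto)
  then show ?thesis by (simp add: B prod.reindex[OF inj] inner_axis)
qed

text \<open>Everything is read off from the probabilities of product boxes: unwanted coordinates get
  the factor \<open>UNIV\<close>, which contributes 1.\<close>

lemma (in prob_space) normal_vector_components:
  fixes X :: "'a \<Rightarrow> real^'m"
  assumes \<sigma>: "\<sigma> > 0"
    and D: "distributed M lborel X (\<lambda>x. ennreal (\<Prod>i\<in>UNIV. normal_density 0 \<sigma> (x $ i)))"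
  shows normal_vector_component: "distributed M lborel (\<lambda>\<omega>. X \<omega> $ i) (normal_density 0 \<sigma>)"
    and normal_vector_indep: "i \<noteq> j \<Longrightarrow> indep_var borel (\<lambda>\<omega>. X \<omega> $ i) borel (\<lambda>\<omega>. X \<omega> $ j)"
proof -
  have [measurable]: "X \<in> borel_measurable M" using distributed_measurable[OF D] by simp
  have comp [measurable]: "random_variable borel (\<lambda>\<omega>. X \<omega> $ i)" for i
    by (rule borel_measurable_continuous_on[of "\<lambda>x. x $ i"]) (auto intro: continuous_intros)
  define n where "n A = (\<integral>\<^sup>+x. ennreal (normal_density 0 \<sigma> x) * indicator A x \<partial>lborel)" for A
  have n1: "n UNIV = 1" using nn_integral_normal_density[OF \<sigma>] by (simp add: n_def)
  have prod: "emeasure M {\<omega>\<in>space M. \<forall>i. X \<omega> $ i \<in> A i} = (\<Prod>i\<in>UNIV. n (A i))"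
    if [measurable]: "\<And>i. A i \<in> sets borel" for A
  proof -
    have "{x::real^'m. \<forall>i. x $ i \<in> A i} \<in> sets lborel" by simp
    then have "emeasure M (X -` {x. \<forall>i. x $ i \<in> A i} \<inter> space M)
        = (\<integral>\<^sup>+x. ennreal (\<Prod>i\<in>UNIV. normal_density 0 \<sigma> (x $ i)) * indicator {x. \<forall>i. x $ i \<in> A i} x \<partial>lborel)"
      by (rule distributed_emeasure[OF D])
    also have "\<dots> = (\<integral>\<^sup>+x. (\<Prod>i\<in>UNIV. ennreal (normal_density 0 \<sigma> (x $ i)) * indicator (A i) (x $ i)) \<partial>lborel)"
    proof (rule nn_integral_cong)
      fix x :: "real^'m"
      have "indicator {x. \<forall>i. x $ i \<in> A i} x = (\<Prod>i\<in>UNIV. indicator (A i) (x $ i) :: ennreal)"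
        by (auto simp: indicator_def prod_zero_iff)
      then show "ennreal (\<Prod>i\<in>UNIV. normal_density 0 \<sigma> (x $ i)) * indicator {x. \<forall>i. x $ i \<in> A i} x
          = (\<Prod>i\<in>UNIV. ennreal (normal_density 0 \<sigma> (x $ i)) * indicator (A i) (x $ i))"
        by (simp add: prod.distrib prod_ennreal)
    qed
    also have "\<dots> = (\<Prod>i\<in>UNIV. n (A i))"
      unfolding n_def by (rule nn_integral_vec_prod) simp
    also have "X -` {x. \<forall>i. x $ i \<in> A i} \<inter> space M = {\<omega>\<in>space M. \<forall>i. X \<omega> $ i \<in> A i}" by auto
    finally show ?thesis .
  qed
  have single: "emeasure M ((\<lambda>\<omega>. X \<omega> $ i) -` A \<inter> space M) = n A" if A: "A \<in> sets borel" for A i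
  proof -
    let ?A = "\<lambda>k. if k = i then A else UNIV"
    have "emeasure M {\<omega>\<in>space M. \<forall>k. X \<omega> $ k \<in> ?A k} = (\<Prod>k\<in>UNIV. n (?A k))"
      by (rule prod) (use A in auto)
    also have "(\<Prod>k\<in>UNIV. n (?A k)) = (\<Prod>k\<in>UNIV. if k = i then n A else 1)"
      by (intro prod.cong) (auto simp: n1)
    also have "\<dots> = n A" by simp
    also have "{\<omega>\<in>space M. \<forall>k. X \<omega> $ k \<in> ?A k} = (\<lambda>\<omega>. X \<omega> $ i) -` A \<inter> space M" by auto
    finally show ?thesis .
  qed
  show "distributed M lborel (\<lambda>\<omega>. X \<omega> $ i) (normal_density 0 \<sigma>)"
    unfolding distributed_def
  proof (intro conjI measure_eqI)
    fix A assume "A \<in> sets (distr M lborel (\<lambda>\<omega>. X \<omega> $ i))"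
    then have A: "A \<in> sets borel" by simp
    then show "emeasure (distr M lborel (\<lambda>\<omega>. X \<omega> $ i)) A
        = emeasure (density lborel (\<lambda>x. ennreal (normal_density 0 \<sigma> x))) A"
      using single[OF A, of i] by (subst emeasure_distr) (simp_all add: comp emeasure_density n_def)
  qed auto
  show "indep_var borel (\<lambda>\<omega>. X \<omega> $ i) borel (\<lambda>\<omega>. X \<omega> $ j)" if ij: "i \<noteq> j"
  proof (rule indep_varI_rectangles)
    fix A B :: "real set" assume AB: "A \<in> sets borel" "B \<in> sets borel"
    let ?A = "\<lambda>k. if k = i then A else if k = j then B else UNIV"
    have "emeasure M {\<omega>\<in>space M. \<forall>k. X \<omega> $ k \<in> ?A k} = (\<Prod>k\<in>UNIV. n (?A k))"
      by (rule prod) (use AB in auto)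
    also have "(\<Prod>k\<in>UNIV. n (?A k)) = (\<Prod>k\<in>UNIV. (if k = i then n A else 1) * (if k = j then n B else 1))"
      using ij by (intro prod.cong) (auto simp: n1)
    also have "\<dots> = n A * n B" by (simp add: prod.distrib)
    also have "{\<omega>\<in>space M. \<forall>k. X \<omega> $ k \<in> ?A k}
        = ((\<lambda>\<omega>. X \<omega> $ i) -` A \<inter> space M) \<inter> ((\<lambda>\<omega>. X \<omega> $ j) -` B \<inter> space M)"
      using ij by (auto split: if_splits)
    finally show "emeasure M (((\<lambda>\<omega>. X \<omega> $ i) -` A \<inter> space M) \<inter> ((\<lambda>\<omega>. X \<omega> $ j) -` B \<inter> space M))
        = emeasure M ((\<lambda>\<omega>. X \<omega> $ i) -` A \<inter> space M) * emeasure M ((\<lambda>\<omega>. X \<omega> $ j) -` B \<inter> space M)"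
      using AB by (simp add: single)
  qed simp_all
qed

text \<open>Pairwise independence is enough: the square expands into a double sum of which only the
  diagonal has nonzero expectation.\<close>

lemma (in prob_space) normal_vector_moments:
  fixes X :: "'a \<Rightarrow> real^'m"
  assumes \<sigma>: "\<sigma> > 0"
    and D: "distributed M lborel X (\<lambda>x. ennreal (\<Prod>i\<in>UNIV. normal_density 0 \<sigma> (x $ i)))"
  shows "integrable M (\<lambda>\<omega>. c \<bullet> X \<omega>)" "expectation (\<lambda>\<omega>. c \<bullet> X \<omega>) = 0"
    "integrable M (\<lambda>\<omega>. (c \<bullet> X \<omega>)\<^sup>2)" "expectation (\<lambda>\<omega>. (c \<bullet> X \<omega>)\<^sup>2) = \<sigma>\<^sup>2 * (norm c)\<^sup>2"
proof -
  note comp = normal_vector_component[OF \<sigma> D]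
  have i1: "integrable M (\<lambda>\<omega>. X \<omega> $ i)" for i
    using integrable_normal_moment[OF \<sigma>, of 0 1] distributed_integrable[OF comp[of i], of "\<lambda>x. x"]
    by simp
  have e1: "expectation (\<lambda>\<omega>. X \<omega> $ i) = 0" for i
    by (rule normal_distributed_expectation[OF \<sigma> comp])
  have i2: "integrable M (\<lambda>\<omega>. X \<omega> $ i * X \<omega> $ i)" for i
    using integrable_normal_moment[OF \<sigma>, of 0 2] distributed_integrable[OF comp[of i], of "\<lambda>x. x\<^sup>2"]
    by (simp add: power2_eq_square)
  have e2: "expectation (\<lambda>\<omega>. X \<omega> $ i * X \<omega> $ i) = \<sigma>\<^sup>2" for i
    using normal_distributed_variance[OF \<sigma> comp[of i]] e1[of i] by (simp add: power2_eq_square)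
  have i3: "integrable M (\<lambda>\<omega>. X \<omega> $ i * X \<omega> $ j)"
    and e3: "expectation (\<lambda>\<omega>. X \<omega> $ i * X \<omega> $ j) = (if i = j then \<sigma>\<^sup>2 else 0)" for i j
    using i2[of i] e2[of i] indep_var_integrable[OF normal_vector_indep[OF \<sigma> D, of i j] i1 i1]
      indep_var_lebesgue_integral[OF normal_vector_indep[OF \<sigma> D, of i j] i1 i1] e1
    by (cases "i = j"; simp)+
  show "integrable M (\<lambda>\<omega>. c \<bullet> X \<omega>)" "expectation (\<lambda>\<omega>. c \<bullet> X \<omega>) = 0"
    using i1 e1 by (simp_all add: inner_vec_def)
  have sq: "(c \<bullet> X \<omega>)\<^sup>2 = (\<Sum>i\<in>UNIV. \<Sum>j\<in>UNIV. c $ i * c $ j * (X \<omega> $ i * X \<omega> $ j))" for \<omega>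
    by (simp add: inner_vec_def power2_eq_square sum_product mult_ac)
  show "integrable M (\<lambda>\<omega>. (c \<bullet> X \<omega>)\<^sup>2)" unfolding sq using i3 by simp
  have "expectation (\<lambda>\<omega>. (c \<bullet> X \<omega>)\<^sup>2) = (\<Sum>i\<in>UNIV. \<Sum>j\<in>UNIV. c $ i * c $ j * (if i = j then \<sigma>\<^sup>2 else 0))"
    unfolding sq using i3 e3 by simp
  also have "\<dots> = (\<Sum>i\<in>UNIV. c $ i * c $ i * \<sigma>\<^sup>2)"
    by (simp add: if_distrib[of "\<lambda>x. _ * x"] cong: if_cong)
  also have "\<dots> = \<sigma>\<^sup>2 * (norm c)\<^sup>2"
    by (simp add: power2_norm_eq_inner inner_vec_def sum_distrib_left mult_ac)
  finally show "expectation (\<lambda>\<omega>. (c \<bullet> X \<omega>)\<^sup>2) = \<sigma>\<^sup>2 * (norm c)\<^sup>2" .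
qed

section \<open>Filtrations, independent increments and the discrete isometry\<close>

locale brownian_setting = prob_space M + filtration "space M" F
  for M :: "'w measure" and F :: "real \<Rightarrow> 'w measure" +
  fixes W :: "real \<Rightarrow> 'w \<Rightarrow> real^'m"
  assumes subalgebra_F: "subalgebra M (F t)"
    and brownian: "brownian_motion M F W"
begin

lemma measurable_F_mono:
  assumes "f \<in> measurable (F s) N" "s \<le> t"
  shows "f \<in> measurable (F t) N"
  using assms sets_F_mono[OF assms(2)] by (auto simp: measurable_def space_F)

lemma measurable_F_imp_M: "f \<in> measurable (F s) N \<Longrightarrow> f \<in> measurable M N"
  using subalgebra_F[of s] by (auto intro: measurable_from_subalg)

lemma W_adapted: "t \<ge> 0 \<Longrightarrow> W t \<in> borel_measurable (F t)"
  using brownian by (simp add: brownian_motion_def)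

lemma W_measurable: "t \<ge> 0 \<Longrightarrow> W t \<in> borel_measurable M"
  by (rule measurable_F_imp_M[OF W_adapted])

lemma W_continuous: "\<omega> \<in> space M \<Longrightarrow> continuous_on {0..} (\<lambda>t. W t \<omega>)"
  using brownian by (simp add: brownian_motion_def)

lemma increment_moments:
  assumes "0 \<le> s" "s \<le> t"
  shows "integrable M (\<lambda>\<omega>. c \<bullet> (W t \<omega> - W s \<omega>))" "expectation (\<lambda>\<omega>. c \<bullet> (W t \<omega> - W s \<omega>)) = 0"
    "integrable M (\<lambda>\<omega>. (c \<bullet> (W t \<omega> - W s \<omega>))\<^sup>2)"
    "expectation (\<lambda>\<omega>. (c \<bullet> (W t \<omega> - W s \<omega>))\<^sup>2) = (t - s) * (norm c)\<^sup>2"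
proof -
  \<comment> \<open>A density exists only for \<open>s < t\<close>; for equal times the increment is
    0.\<close>
  consider "s = t" | "s < t" using assms by linarith
  then have "integrable M (\<lambda>\<omega>. c \<bullet> (W t \<omega> - W s \<omega>)) \<and> expectation (\<lambda>\<omega>. c \<bullet> (W t \<omega> - W s \<omega>)) = 0 \<and>
    integrable M (\<lambda>\<omega>. (c \<bullet> (W t \<omega> - W s \<omega>))\<^sup>2) \<and>
    expectation (\<lambda>\<omega>. (c \<bullet> (W t \<omega> - W s \<omega>))\<^sup>2) = (t - s) * (norm c)\<^sup>2"
  proof cases
    case 2
    then have "distributed M lborel (\<lambda>\<omega>. W t \<omega> - W s \<omega>)
        (\<lambda>x. ennreal (\<Prod>i\<in>UNIV. normal_density 0 (sqrt (t - s)) (x $ i)))"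
      using brownian assms by (simp add: brownian_motion_def)
    from normal_vector_moments[OF _ this, of c] show ?thesis using 2 by simp
  qed simp
  then show "integrable M (\<lambda>\<omega>. c \<bullet> (W t \<omega> - W s \<omega>))" "expectation (\<lambda>\<omega>. c \<bullet> (W t \<omega> - W s \<omega>)) = 0"
    "integrable M (\<lambda>\<omega>. (c \<bullet> (W t \<omega> - W s \<omega>))\<^sup>2)"
    "expectation (\<lambda>\<omega>. (c \<bullet> (W t \<omega> - W s \<omega>))\<^sup>2) = (t - s) * (norm c)\<^sup>2"
    by blast+
qed

text \<open>Preimages under a function of the increment are again preimages under the increment,
  hence members of the independent family.\<close>

lemma increment_indep:
  fixes \<eta> :: "'w \<Rightarrow> real" and g :: "real^'m \<Rightarrow> real"
  assumes "0 \<le> s" "s < t" "\<eta> \<in> borel_measurable (F s)" and g: "g \<in> borel_measurable borel"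
  shows "indep_var borel \<eta> borel (\<lambda>\<omega>. g (W t \<omega> - W s \<omega>))"
proof (rule indep_varI_rectangles)
  show "random_variable borel \<eta>" using assms(3) by (rule measurable_F_imp_M)
  have "random_variable borel (\<lambda>\<omega>. W t \<omega> - W s \<omega>)"
    using assms W_measurable by (intro borel_measurable_diff) auto
  then show "random_variable borel (\<lambda>\<omega>. g (W t \<omega> - W s \<omega>))" using g by simp
  fix A B :: "real set" assume "A \<in> sets borel" "B \<in> sets borel"
  then have 1: "\<eta> -` A \<inter> space M \<in> sets (F s)"
    using measurable_sets[OF assms(3)] by (simp add: space_F)
  have 2: "g -` B \<in> sets borel" using measurable_sets[OF g \<open>B \<in> sets borel\<close>] by simp
  have "(\<lambda>\<omega>. g (W t \<omega> - W s \<omega>)) -` B = (\<lambda>\<omega>. W t \<omega> - W s \<omega>) -` (g -` B)" by auto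
  then show "emeasure M ((\<eta> -` A \<inter> space M) \<inter> ((\<lambda>\<omega>. g (W t \<omega> - W s \<omega>)) -` B \<inter> space M))
      = emeasure M (\<eta> -` A \<inter> space M) * emeasure M ((\<lambda>\<omega>. g (W t \<omega> - W s \<omega>)) -` B \<inter> space M)"
    using brownian assms(1,2) 1 2
    by (subst (1 2 3) emeasure_eq_measure, subst ennreal_mult[symmetric])
       (auto simp: brownian_motion_def intro!: arg_cong[where f = ennreal] indep_setD)
qed

lemma increment_product:
  fixes \<eta> :: "'w \<Rightarrow> real"
  assumes st: "0 \<le> s" "s \<le> t" and \<eta>: "\<eta> \<in> borel_measurable (F s)" "integrable M \<eta>"
    and g [measurable]: "g \<in> borel_measurable borel" and "integrable M (\<lambda>\<omega>. g (W t \<omega> - W s \<omega>))"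
  shows "integrable M (\<lambda>\<omega>. \<eta> \<omega> * g (W t \<omega> - W s \<omega>))"
    "expectation (\<lambda>\<omega>. \<eta> \<omega> * g (W t \<omega> - W s \<omega>)) = expectation \<eta> * expectation (\<lambda>\<omega>. g (W t \<omega> - W s \<omega>))"
proof -
  consider "s = t" | "s < t" using st by linarith
  then have "integrable M (\<lambda>\<omega>. \<eta> \<omega> * g (W t \<omega> - W s \<omega>)) \<and>
    expectation (\<lambda>\<omega>. \<eta> \<omega> * g (W t \<omega> - W s \<omega>)) = expectation \<eta> * expectation (\<lambda>\<omega>. g (W t \<omega> - W s \<omega>))"
  proof cases
    case 1
    then show ?thesis using \<eta> by (simp add: prob_space)
  next
    case 2
    have "indep_var borel \<eta> borel (\<lambda>\<omega>. g (W t \<omega> - W s \<omega>))"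
      by (rule increment_indep[OF st(1) 2 \<eta>(1) g])
    from indep_var_integrable[OF this] indep_var_lebesgue_integral[OF this] assms(4,6)
    show ?thesis by simp
  qed
  then show "integrable M (\<lambda>\<omega>. \<eta> \<omega> * g (W t \<omega> - W s \<omega>))"
    "expectation (\<lambda>\<omega>. \<eta> \<omega> * g (W t \<omega> - W s \<omega>)) = expectation \<eta> * expectation (\<lambda>\<omega>. g (W t \<omega> - W s \<omega>))"
    by blast+
qed

text \<open>Orthogonality of martingale increments, by induction on the number of cells. The vectors
  \<open>c i\<close> may vary so that one statement serves Wiener integrals with a deterministic
  kernel as well as random coefficients in a fixed direction.\<close>

lemma discrete_isometry:
  fixes \<tau> :: "nat \<Rightarrow> real" and \<xi> :: "nat \<Rightarrow> 'w \<Rightarrow> real" and c :: "nat \<Rightarrow> real^'m"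
  assumes mono: "\<And>i. i < n \<Longrightarrow> 0 \<le> \<tau> i \<and> \<tau> i \<le> \<tau> (Suc i)"
    and \<xi>: "\<And>i. i < n \<Longrightarrow> \<xi> i \<in> borel_measurable (F (\<tau> i))"
    and bdd: "\<And>i. i < n \<Longrightarrow> \<exists>K. \<forall>\<omega>\<in>space M. \<bar>\<xi> i \<omega>\<bar> \<le> K"
  shows "integrable M (\<lambda>\<omega>. (\<Sum>i<n. \<xi> i \<omega> * (c i \<bullet> (W (\<tau> (Suc i)) \<omega> - W (\<tau> i) \<omega>)))\<^sup>2)"
    "expectation (\<lambda>\<omega>. (\<Sum>i<n. \<xi> i \<omega> * (c i \<bullet> (W (\<tau> (Suc i)) \<omega> - W (\<tau> i) \<omega>)))\<^sup>2)
      = (\<Sum>i<n. expectation (\<lambda>\<omega>. (\<xi> i \<omega>)\<^sup>2) * (norm (c i))\<^sup>2 * (\<tau> (Suc i) - \<tau> i))"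
proof -
  let ?D = "\<lambda>i \<omega>. W (\<tau> (Suc i)) \<omega> - W (\<tau> i) \<omega>"
  let ?S = "\<lambda>n \<omega>. \<Sum>i<n. \<xi> i \<omega> * (c i \<bullet> ?D i \<omega>)"
  have \<tau>0: "0 \<le> \<tau> i" if "i \<le> n" "n > 0" for i
    using that mono[of i] mono[of "n - 1"] by (cases "i = n") auto
  have \<tau>m: "\<tau> i \<le> \<tau> j" if "i \<le> j" "j \<le> n" for i j
    using that(1,2) by (induction rule: dec_induct) (use mono in \<open>auto intro: order_trans\<close>)
  have "integrable M (\<lambda>\<omega>. (?S k \<omega>)\<^sup>2) \<and> expectation (\<lambda>\<omega>. (?S k \<omega>)\<^sup>2)
      = (\<Sum>i<k. expectation (\<lambda>\<omega>. (\<xi> i \<omega>)\<^sup>2) * (norm (c i))\<^sup>2 * (\<tau> (Suc i) - \<tau> i))" if "k \<le> n" for k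
    using that
  proof (induction k)
    case (Suc k)
    then have IH1: "integrable M (\<lambda>\<omega>. (?S k \<omega>)\<^sup>2)" and
      IH2: "expectation (\<lambda>\<omega>. (?S k \<omega>)\<^sup>2)
        = (\<Sum>i<k. expectation (\<lambda>\<omega>. (\<xi> i \<omega>)\<^sup>2) * (norm (c i))\<^sup>2 * (\<tau> (Suc i) - \<tau> i))" by auto
    have k: "k < n" using Suc.prems by simp
    have st: "0 \<le> \<tau> k" "\<tau> k \<le> \<tau> (Suc k)" using mono[OF k] by auto
    obtain K where K: "\<And>\<omega>. \<omega> \<in> space M \<Longrightarrow> \<bar>\<xi> k \<omega>\<bar> \<le> K" using bdd[OF k] by blast
    have [measurable]: "\<xi> k \<in> borel_measurable M" using measurable_F_imp_M[OF \<xi>[OF k]] .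
    have Sm: "?S k \<in> borel_measurable (F (\<tau> k))"
    proof (intro borel_measurable_sum borel_measurable_times borel_measurable_inner
        borel_measurable_const borel_measurable_diff)
      fix i assume "i \<in> {..<k}"
      then have i: "i < k" by simp
      show "\<xi> i \<in> borel_measurable (F (\<tau> k))"
        using i k by (intro measurable_F_mono[OF \<xi>[of i] \<tau>m]) auto
      show "W (\<tau> (Suc i)) \<in> borel_measurable (F (\<tau> k))" "W (\<tau> i) \<in> borel_measurable (F (\<tau> k))"
        using i k by (auto intro!: measurable_F_mono[OF W_adapted \<tau>m] \<tau>0)
    qed
    have [measurable]: "?S k \<in> borel_measurable M" by (rule measurable_F_imp_M[OF Sm])
    have i1: "integrable M (?S k)"
      by (rule square_integrable_imp_integrable[OF _ IH1]) measurable
    have i2: "integrable M (\<lambda>\<omega>. ?S k \<omega> * \<xi> k \<omega>)"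
    proof (rule Bochner_Integration.integrable_bound)
      show "integrable M (\<lambda>\<omega>. K * ?S k \<omega>)" using i1 by simp
      show "AE \<omega> in M. norm (?S k \<omega> * \<xi> k \<omega>) \<le> norm (K * ?S k \<omega>)"
      proof (rule AE_I2)
        fix \<omega> assume "\<omega> \<in> space M"
        then have "\<bar>\<xi> k \<omega>\<bar> \<le> \<bar>K\<bar>" using K[of \<omega>] by linarith
        then show "norm (?S k \<omega> * \<xi> k \<omega>) \<le> norm (K * ?S k \<omega>)"
          unfolding real_norm_def abs_mult
          by (subst mult.commute) (rule mult_right_mono, simp_all)
      qed
    qed measurable
    have i3: "integrable M (\<lambda>\<omega>. (\<xi> k \<omega>)\<^sup>2)"
    proof (rule integrable_const_bound[of _ "K\<^sup>2"])
      show "AE \<omega> in M. norm ((\<xi> k \<omega>)\<^sup>2) \<le> K\<^sup>2"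
        using K by (auto intro!: AE_I2 abs_le_square_iff[THEN iffD1] order_trans[OF _ abs_ge_self])
    qed measurable
    have m2: "(\<lambda>\<omega>. ?S k \<omega> * \<xi> k \<omega>) \<in> borel_measurable (F (\<tau> k))"
      "(\<lambda>\<omega>. (\<xi> k \<omega>)\<^sup>2) \<in> borel_measurable (F (\<tau> k))"
      using Sm \<xi>[OF k] by auto
    \<comment> \<open>The cross term: the past sum times the new coefficient is known at
      \<open>\<tau> k\<close>, while the increment after it is independent and centered.\<close>
    have p1: "integrable M (\<lambda>\<omega>. ?S k \<omega> * \<xi> k \<omega> * (c k \<bullet> ?D k \<omega>))"
      "expectation (\<lambda>\<omega>. ?S k \<omega> * \<xi> k \<omega> * (c k \<bullet> ?D k \<omega>)) = 0"
      using increment_product[OF st m2(1) i2, of "\<lambda>x. c k \<bullet> x"] increment_moments[OF st, of "c k"]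
      by auto
    have p2: "integrable M (\<lambda>\<omega>. (\<xi> k \<omega>)\<^sup>2 * (c k \<bullet> ?D k \<omega>)\<^sup>2)"
      "expectation (\<lambda>\<omega>. (\<xi> k \<omega>)\<^sup>2 * (c k \<bullet> ?D k \<omega>)\<^sup>2)
        = expectation (\<lambda>\<omega>. (\<xi> k \<omega>)\<^sup>2) * ((\<tau> (Suc k) - \<tau> k) * (norm (c k))\<^sup>2)"
      using increment_product[OF st m2(2) i3, of "\<lambda>x. (c k \<bullet> x)\<^sup>2"] increment_moments[OF st, of "c k"]
      by auto
    have sq: "(?S (Suc k) \<omega>)\<^sup>2 = (?S k \<omega>)\<^sup>2 + 2 * (?S k \<omega> * \<xi> k \<omega> * (c k \<bullet> ?D k \<omega>))
        + (\<xi> k \<omega>)\<^sup>2 * (c k \<bullet> ?D k \<omega>)\<^sup>2" for \<omega>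
      by (simp add: power2_eq_square algebra_simps)
    show ?case
      unfolding sq using IH1 IH2 p1 p2 by simp
  qed simp
  then show "integrable M (\<lambda>\<omega>. (?S n \<omega>)\<^sup>2)"
    "expectation (\<lambda>\<omega>. (?S n \<omega>)\<^sup>2)
      = (\<Sum>i<n. expectation (\<lambda>\<omega>. (\<xi> i \<omega>)\<^sup>2) * (norm (c i))\<^sup>2 * (\<tau> (Suc i) - \<tau> i))"
    by blast+
qed

end

section \<open>Identification of Ito integrals\<close>

lemma simple_process_Nil [simp]: "simple_process [] r = (\<lambda>\<omega>. 0)"
  by (simp add: simple_process_def fun_eq_iff)

lemma simple_process_Cons [simp]:
  "simple_process ((s, u, \<xi>) # h) r \<omega> = \<xi> \<omega> * indicator {s<..u} r + simple_process h r \<omega>"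
  by (simp add: simple_process_def)

lemma simple_process_append:
  "simple_process (g @ h) r \<omega> = simple_process g r \<omega> + simple_process h r \<omega>"
  by (simp add: simple_process_def)

lemma simple_integral_Nil [simp]: "simple_integral [] \<beta> \<omega> = 0"
  by (simp add: simple_integral_def)

lemma simple_integral_Cons [simp]:
  "simple_integral ((s, u, \<xi>) # h) \<beta> \<omega> = \<xi> \<omega> * (\<beta> u \<omega> - \<beta> s \<omega>) + simple_integral h \<beta> \<omega>"
  by (simp add: simple_integral_def)

lemma simple_integral_append:
  "simple_integral (g @ h) \<beta> \<omega> = simple_integral g \<beta> \<omega> + simple_integral h \<beta> \<omega>"
  by (simp add: simple_integral_def)

text \<open>Differences of simple processes are encoded as
  \<open>g @ negate_simple h\<close>.\<close>

definition negate_simple :: "(real \<times> real \<times> ('w \<Rightarrow> real)) list \<Rightarrow> (real \<times> real \<times> ('w \<Rightarrow> real)) list"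
  where "negate_simple h = map (\<lambda>(s, u, \<xi>). (s, u, \<lambda>\<omega>. - \<xi> \<omega>)) h"

lemma simple_process_negate: "simple_process (negate_simple h) r \<omega> = - simple_process h r \<omega>"
  by (induction h) (auto simp: negate_simple_def)

lemma simple_integral_negate: "simple_integral (negate_simple h) \<beta> \<omega> = - simple_integral h \<beta> \<omega>"
  by (induction h) (auto simp: negate_simple_def algebra_simps)

lemma simple_process_on_negate: "simple_process_on M F T h \<Longrightarrow> simple_process_on M F T (negate_simple h)"
  by (fastforce simp: simple_process_on_def negate_simple_def)

lemma simple_process_on_append:
  "simple_process_on M F T g \<Longrightarrow> simple_process_on M F T h \<Longrightarrow> simple_process_on M F T (g @ h)"
  by (auto simp: simple_process_on_def)

lemma simple_process_on_Cons:
  "simple_process_on M F T ((s, u, \<xi>) # h) \<longleftrightarrow>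
    0 \<le> s \<and> s \<le> u \<and> u \<le> T \<and> \<xi> \<in> borel_measurable (F s) \<and> (\<exists>c. \<forall>\<omega>\<in>space M. \<bar>\<xi> \<omega>\<bar> \<le> c) \<and>
    simple_process_on M F T h"
  by (auto simp: simple_process_on_def)

lemma simple_process_borel [measurable]: "(\<lambda>r. simple_process h r \<omega>) \<in> borel_measurable borel"
proof (induction h)
  case (Cons x h)
  obtain s u \<xi> where "x = (s, u, \<xi>)" by (cases x) auto
  then show ?case using Cons by (simp del: split_paired_All)
qed simp

text \<open>The intervals in a list may overlap; on a grid containing all their ends the process
  becomes a step function with one value per cell.\<close>

definition on_grid :: "(nat \<Rightarrow> real) \<Rightarrow> nat \<Rightarrow> (real \<times> real \<times> ('w \<Rightarrow> real)) list \<Rightarrow> bool"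
  where "on_grid \<tau> n h \<longleftrightarrow>
    (\<forall>(s, u, \<xi>) \<in> set h. \<exists>a b. a \<le> b \<and> b \<le> n \<and> s = \<tau> a \<and> u = \<tau> b)"

lemma on_grid_Cons:
  "on_grid \<tau> n ((s, u, \<xi>) # h) \<longleftrightarrow>
    (\<exists>a b. a \<le> b \<and> b \<le> n \<and> s = \<tau> a \<and> u = \<tau> b) \<and> on_grid \<tau> n h"
  by (simp add: on_grid_def)

lemma grid_indicator:
  fixes \<tau> :: "nat \<Rightarrow> real"
  assumes mono: "strict_mono_on {..n} \<tau>" and "a \<le> b" "b \<le> n" "i < n" "r \<in> {\<tau> i<..\<tau> (Suc i)}"
  shows "indicator {\<tau> a<..\<tau> b} r = (if a \<le> i \<and> i < b then 1 else 0 :: real)"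
proof -
  have le: "\<tau> j \<le> \<tau> k" if "j \<le> k" "k \<le> n" for j k
    using strict_mono_onD[OF mono, of j k] that by (cases "j = k") auto
  show ?thesis
  proof (cases "a \<le> i \<and> i < b")
    case True
    then show ?thesis using le[of a i] le[of "Suc i" b] assms by auto
  next
    case False
    then consider "Suc i \<le> a" | "b \<le> i" by linarith
    then show ?thesis
      using le[of "Suc i" a] le[of b i] assms False by cases auto
  qed
qed

text \<open>Intervals are open on the left and closed on the right, so the value on a cell is read
  off at its right end.\<close>

lemma simple_process_const_on_grid:
  assumes "strict_mono_on {..n} \<tau>" "on_grid \<tau> n h" "i < n" "r \<in> {\<tau> i<..\<tau> (Suc i)}"
  shows "simple_process h r \<omega> = simple_process h (\<tau> (Suc i)) \<omega>"
  using assms(2)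
proof (induction h)
  case (Cons x h)
  obtain s u \<xi> where x: "x = (s, u, \<xi>)" by (cases x) auto
  then obtain a b where ab: "a \<le> b" "b \<le> n" "s = \<tau> a" "u = \<tau> b" and h: "on_grid \<tau> n h"
    using Cons.prems by (auto simp: on_grid_Cons)
  have "\<tau> (Suc i) \<in> {\<tau> i<..\<tau> (Suc i)}" using strict_mono_onD[OF assms(1), of i "Suc i"] assms(3) by auto
  then show ?case
    using Cons.IH[OF h] grid_indicator[OF assms(1) ab(1,2) assms(3)] assms(4) ab(3,4) x by simp
qed simp

text \<open>Each \<open>\<beta> u - \<beta> s\<close> telescopes over the cells between
  \<open>s\<close> and \<open>u\<close>.\<close>

lemma simple_integral_on_grid:
  assumes mono: "strict_mono_on {..n} \<tau>" and "on_grid \<tau> n h"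
  shows "simple_integral h \<beta> \<omega>
    = (\<Sum>i<n. simple_process h (\<tau> (Suc i)) \<omega> * (\<beta> (\<tau> (Suc i)) \<omega> - \<beta> (\<tau> i) \<omega>))"
  using assms(2)
proof (induction h)
  case (Cons x h)
  obtain s u \<xi> where x: "x = (s, u, \<xi>)" by (cases x) auto
  then obtain a b where ab: "a \<le> b" "b \<le> n" "s = \<tau> a" "u = \<tau> b" and h: "on_grid \<tau> n h"
    using Cons.prems by (auto simp: on_grid_Cons)
  have tel: "(\<Sum>i<n. (if a \<le> i \<and> i < b then f (Suc i) - f i else 0)) = f b - f a" for f :: "nat \<Rightarrow> real"
  proof -
    have "(\<Sum>i<n. (if a \<le> i \<and> i < b then f (Suc i) - f i else 0)) = (\<Sum>i=a..<b. f (Suc i) - f i)"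
      using ab(2) by (intro sum.mono_neutral_cong_right) auto
    then show ?thesis using sum_Suc_diff'[OF ab(1), of f] by simp
  qed
  have "indicator {s<..u} (\<tau> (Suc i)) = (if a \<le> i \<and> i < b then 1 else 0 :: real)" if "i < n" for i
    using grid_indicator[OF mono ab(1,2) that, of "\<tau> (Suc i)"] strict_mono_onD[OF mono, of i "Suc i"] that ab(3,4)
    by auto
  then have "(\<Sum>i<n. simple_process (x # h) (\<tau> (Suc i)) \<omega> * (\<beta> (\<tau> (Suc i)) \<omega> - \<beta> (\<tau> i) \<omega>))
    = (\<Sum>i<n. \<xi> \<omega> * (if a \<le> i \<and> i < b then \<beta> (\<tau> (Suc i)) \<omega> - \<beta> (\<tau> i) \<omega> else 0)
        + simple_process h (\<tau> (Suc i)) \<omega> * (\<beta> (\<tau> (Suc i)) \<omega> - \<beta> (\<tau> i) \<omega>))"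
    unfolding x by (intro sum.cong) (auto simp: algebra_simps)
  also have "\<dots> = \<xi> \<omega> * (\<beta> u \<omega> - \<beta> s \<omega>) + simple_integral h \<beta> \<omega>"
    using tel[of "\<lambda>i. \<beta> (\<tau> i) \<omega>"] Cons.IH[OF h] ab(3,4)
    by (simp add: sum.distrib sum_distrib_left[symmetric])
  finally show ?case by (simp add: x)
qed simp

lemma exists_grid:
  assumes "simple_process_on M F T h" "0 \<le> T"
  obtains \<tau> n where "strict_mono_on {..n} \<tau>" "on_grid \<tau> n h" "\<And>i. i \<le> n \<Longrightarrow> \<tau> i \<in> {0..T}"
proof -
  \<comment> \<open>Including 0 keeps the list of nodes nonempty, so that
    \<open>length xs - 1\<close> is its last index even for an empty \<open>h\<close>.\<close>
  define P where "P = insert 0 (fst ` set h \<union> (fst \<circ> snd) ` set h)"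
  define xs where "xs = sorted_list_of_set P"
  define n where "n = length xs - 1"
  have "finite P" "P \<noteq> {}" by (auto simp: P_def)
  then have set: "set xs = P" and xs: "sorted_wrt (<) xs" "xs \<noteq> []"
    by (auto simp: xs_def sorted_list_of_set.strict_sorted_key_list_of_set)
  have n: "i \<le> n \<longleftrightarrow> i < length xs" for i using xs(2) by (cases xs) (auto simp: n_def)
  have "strict_mono_on {..n} ((!) xs)"
    using xs(1) by (auto simp: strict_mono_on_def n sorted_wrt_iff_nth_less)
  moreover have "on_grid ((!) xs) n h"
    unfolding on_grid_def
  proof safe
    fix s u \<xi> assume m: "(s, u, \<xi>) \<in> set h"
    then have su: "s \<le> u" using assms(1) by (auto simp: simple_process_on_def)
    have "s \<in> P" "u \<in> P"
      using imageI[OF m, of fst] imageI[OF m, of "fst \<circ> snd"] by (simp_all add: P_def)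
    then obtain a b where ab: "a < length xs" "xs ! a = s" "b < length xs" "xs ! b = u"
      unfolding set[symmetric] by (auto simp: in_set_conv_nth)
    have "a \<le> b"
    proof (rule ccontr)
      assume "\<not> a \<le> b"
      then have "xs ! b < xs ! a" using xs(1) ab by (auto simp: sorted_wrt_iff_nth_less)
      then show False using ab su by simp
    qed
    then show "\<exists>a b. a \<le> b \<and> b \<le> n \<and> s = xs ! a \<and> u = xs ! b" using ab n by blast
  qed
  moreover have "xs ! i \<in> {0..T}" if "i \<le> n" for i
  proof -
    have "xs ! i \<in> P" using that n set nth_mem by blast
    then show ?thesis using assms by (auto simp: P_def simple_process_on_def)
  qed
  ultimately show ?thesis using that by blast
qed

text \<open>The cells are disjoint subintervals of \<open>[0, T]\<close> on which the process is
  constant; outside them the integrand is merely nonnegative.\<close>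

lemma nn_integral_simple_process_ge:
  assumes mono: "strict_mono_on {..n} \<tau>" and g: "on_grid \<tau> n h" and T: "\<And>i. i \<le> n \<Longrightarrow> \<tau> i \<in> {0..T}"
  shows "ennreal (\<Sum>i<n. (simple_process h (\<tau> (Suc i)) \<omega>)\<^sup>2 * (\<tau> (Suc i) - \<tau> i))
    \<le> (\<integral>\<^sup>+s\<in>{0..T}. ennreal ((simple_process h s \<omega>)\<^sup>2) \<partial>lborel)"
proof -
  have le: "\<tau> j \<le> \<tau> k" if "j \<le> k" "k \<le> n" for j k
    using strict_mono_onD[OF mono, of j k] that by (cases "j = k") auto
  let ?I = "\<lambda>i. {\<tau> i<..\<tau> (Suc i)}"
  let ?v = "\<lambda>i. ennreal ((simple_process h (\<tau> (Suc i)) \<omega>)\<^sup>2)"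
  have "ennreal (\<Sum>i<n. (simple_process h (\<tau> (Suc i)) \<omega>)\<^sup>2 * (\<tau> (Suc i) - \<tau> i))
      = (\<Sum>i<n. ?v i * emeasure lborel (?I i))"
    using le by (subst sum_ennreal[symmetric]) (auto simp: ennreal_mult intro!: sum.cong)
  also have "\<dots> = (\<integral>\<^sup>+s. (\<Sum>i<n. ?v i * indicator (?I i) s) \<partial>lborel)"
    by (subst nn_integral_sum) (auto simp: nn_integral_cmult_indicator)
  also have "\<dots> \<le> (\<integral>\<^sup>+s\<in>{0..T}. ennreal ((simple_process h s \<omega>)\<^sup>2) \<partial>lborel)"
  proof (rule nn_integral_mono)
    fix s
    show "(\<Sum>i<n. ?v i * indicator (?I i) s) \<le> ennreal ((simple_process h s \<omega>)\<^sup>2) * indicator {0..T} s"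
    proof (cases "\<exists>i<n. s \<in> ?I i")
      case True
      then obtain i where i: "i < n" "s \<in> ?I i" by blast
      have "s \<notin> ?I j" if "j < n" "j \<noteq> i" for j
        using le[of "Suc i" j] le[of "Suc j" i] i that by (cases "i < j") auto
      then have "(\<Sum>j<n. ?v j * indicator (?I j) s) = (\<Sum>j<n. if j = i then ?v i else 0)"
        using i(2) by (intro sum.cong) (auto split: split_indicator)
      also have "\<dots> = ennreal ((simple_process h s \<omega>)\<^sup>2)"
        using i simple_process_const_on_grid[OF mono g i] by simp
      finally show ?thesis using i(2) T[of i] T[of "Suc i"] i(1) by simp
    next
      case False
      then have "(\<Sum>i<n. ?v i * indicator (?I i) s) = 0" by (intro sum.neutral) auto
      then show ?thesis by simp
    qed
  qed
  finally show ?thesis .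
qed

text \<open>A discrete stopping argument: partial sums increase, so the terms kept form an initial
  segment and add up to the last partial sum not above \<open>\<delta>\<close>.\<close>

lemma truncated_sum_le:
  fixes a :: "nat \<Rightarrow> real"
  assumes "\<And>i. a i \<ge> 0" "\<delta> \<ge> 0"
  shows "(\<Sum>i<n. if (\<Sum>j\<le>i. a j) \<le> \<delta> then a i else 0) \<le> \<delta>"
proof (induction n)
  case (Suc n)
  show ?case
  proof (cases "(\<Sum>j\<le>n. a j) \<le> \<delta>")
    case True
    have "(\<Sum>i<Suc n. if (\<Sum>j\<le>i. a j) \<le> \<delta> then a i else 0) \<le> (\<Sum>i<Suc n. a i)"
      by (intro sum_mono) (use assms in auto)
    also have "\<dots> \<le> \<delta>" using True by (simp add: lessThan_Suc_atMost)
    finally show ?thesis .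
  qed (use Suc in simp)
qed (use assms in simp)

context brownian_setting
begin

text \<open>Although evaluated at the right end, the value is already known at the left end: every
  interval covering the cell begins at or before \<open>\<tau> i\<close>.\<close>

lemma simple_process_value_measurable:
  assumes "strict_mono_on {..n} \<tau>" "on_grid \<tau> n h" "simple_process_on M F T h" "i < n"
  shows "(\<lambda>\<omega>. simple_process h (\<tau> (Suc i)) \<omega>) \<in> borel_measurable (F (\<tau> i))"
    "\<exists>K. \<forall>\<omega>\<in>space M. \<bar>simple_process h (\<tau> (Suc i)) \<omega>\<bar> \<le> K"
proof -
  have "(\<lambda>\<omega>. simple_process h (\<tau> (Suc i)) \<omega>) \<in> borel_measurable (F (\<tau> i)) \<and>
    (\<exists>K. \<forall>\<omega>\<in>space M. \<bar>simple_process h (\<tau> (Suc i)) \<omega>\<bar> \<le> K)"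
    using assms(2,3)
  proof (induction h)
    case (Cons x h)
    obtain s u \<xi> where x: "x = (s, u, \<xi>)" by (cases x) auto
    then obtain a b where ab: "a \<le> b" "b \<le> n" "s = \<tau> a" "u = \<tau> b" and h: "on_grid \<tau> n h"
      using Cons.prems by (auto simp: on_grid_Cons)
    have \<xi>: "\<xi> \<in> borel_measurable (F s)" and h': "simple_process_on M F T h"
      using Cons.prems x by (auto simp: simple_process_on_Cons)
    obtain c where c: "\<And>\<omega>. \<omega> \<in> space M \<Longrightarrow> \<bar>\<xi> \<omega>\<bar> \<le> c"
      using Cons.prems x by (auto simp: simple_process_on_Cons)
    from Cons.IH[OF h h'] obtain K where
      IH: "(\<lambda>\<omega>. simple_process h (\<tau> (Suc i)) \<omega>) \<in> borel_measurable (F (\<tau> i))"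
      and K: "\<And>\<omega>. \<omega> \<in> space M \<Longrightarrow> \<bar>simple_process h (\<tau> (Suc i)) \<omega>\<bar> \<le> K" by blast
    have ind: "indicator {s<..u} (\<tau> (Suc i)) = (if a \<le> i \<and> i < b then 1 else 0 :: real)"
      using grid_indicator[OF assms(1) ab(1,2) assms(4), of "\<tau> (Suc i)"]
        strict_mono_onD[OF assms(1), of i "Suc i"] assms(4) ab(3,4) by auto
    have 1: "(\<lambda>\<omega>. \<xi> \<omega> * indicator {s<..u} (\<tau> (Suc i))) \<in> borel_measurable (F (\<tau> i))"
    proof (cases "a \<le> i \<and> i < b")
      case True
      then have "s \<le> \<tau> i"
        using strict_mono_onD[OF assms(1), of a i] assms(4) ab(3) by (cases "a = i") auto
      then show ?thesis using measurable_F_mono[OF \<xi>] by (simp add: ind True)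
    next
      case False
      then have "indicator {s<..u} (\<tau> (Suc i)) = (0::real)" by (simp add: ind)
      then show ?thesis by simp
    qed
    have 2: "\<bar>\<xi> \<omega> * indicator {s<..u} (\<tau> (Suc i)) + simple_process h (\<tau> (Suc i)) \<omega>\<bar> \<le> \<bar>c\<bar> + K"
      if "\<omega> \<in> space M" for \<omega>
    proof -
      have "\<bar>\<xi> \<omega> * indicator {s<..u} (\<tau> (Suc i))\<bar> \<le> \<bar>c\<bar>"
        using order_trans[OF c[OF that] abs_ge_self] by (simp add: ind)
      then show ?thesis using K[OF that] by linarith
    qed
    show ?case using borel_measurable_add[OF 1 IH] 2 by (auto simp: x)
  qed auto
  then show "(\<lambda>\<omega>. simple_process h (\<tau> (Suc i)) \<omega>) \<in> borel_measurable (F (\<tau> i))"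
    "\<exists>K. \<forall>\<omega>\<in>space M. \<bar>simple_process h (\<tau> (Suc i)) \<omega>\<bar> \<le> K" by blast+
qed

text \<open>The simple process is stopped before the integral of its square exceeds \<open>\<delta>\<close>; the isometry
  bounds the variance of the stopped integral by \<open>\<delta>\<close>.\<close>

lemma prob_simple_integral_le:
  assumes h: "simple_process_on M F T h" and T: "0 \<le> T" and "\<epsilon> > 0" "\<delta> \<ge> 0" and D: "D \<in> events"
    and sub: "\<And>\<omega>. \<omega> \<in> space M \<Longrightarrow>
      ennreal \<delta> < (\<integral>\<^sup>+s\<in>{0..T}. ennreal ((simple_process h s \<omega>)\<^sup>2) \<partial>lborel) \<Longrightarrow> \<omega> \<in> D"
  shows "prob {\<omega>\<in>space M. \<epsilon> < \<bar>simple_integral h (\<lambda>s \<omega>. W s \<omega> $ l) \<omega>\<bar>} \<le> prob D + \<delta> / \<epsilon>\<^sup>2"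
proof -
  obtain \<tau> n where \<tau>: "strict_mono_on {..n} \<tau>" "on_grid \<tau> n h" "\<And>i. i \<le> n \<Longrightarrow> \<tau> i \<in> {0..T}"
    by (rule exists_grid[OF h T]) blast
  have le: "\<tau> j \<le> \<tau> k" if "j \<le> k" "k \<le> n" for j k
    using strict_mono_onD[OF \<tau>(1), of j k] that by (cases "j = k") auto
  let ?\<eta> = "\<lambda>i \<omega>. simple_process h (\<tau> (Suc i)) \<omega>"
  note \<eta> = simple_process_value_measurable[OF \<tau>(1,2) h]
  define a where "a i \<omega> = (if i < n then (?\<eta> i \<omega>)\<^sup>2 * (\<tau> (Suc i) - \<tau> i) else 0)" for i \<omega>
  \<comment> \<open>The test includes cell \<open>i\<close> itself. This is still a decision made at
    time \<open>\<tau> i\<close>, because the value on the cell is known there.\<close>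
  define J where "J i \<omega> = (if (\<Sum>j\<le>i. a j \<omega>) \<le> \<delta> then 1 else 0 :: real)" for i \<omega>
  have a0: "a i \<omega> \<ge> 0" for i \<omega> using le by (simp add: a_def)
  let ?D = "\<lambda>i \<omega>. axis l 1 \<bullet> (W (\<tau> (Suc i)) \<omega> - W (\<tau> i) \<omega>)"
  define N where "N \<omega> = (\<Sum>i<n. (J i \<omega> * ?\<eta> i \<omega>) * ?D i \<omega>)" for \<omega>
  have am: "a j \<in> borel_measurable (F (\<tau> i))" if "j \<le> i" "i < n" for i j
  proof -
    have "?\<eta> j \<in> borel_measurable (F (\<tau> i))"
      using that by (intro measurable_F_mono[OF \<eta>(1) le]) auto
    then show ?thesis unfolding a_def[abs_def] using that by simp
  qed
  have Jm: "(\<lambda>\<omega>. J i \<omega> * ?\<eta> i \<omega>) \<in> borel_measurable (F (\<tau> i))" if "i < n" for i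
  proof -
    have [measurable]: "(\<lambda>\<omega>. \<Sum>j\<le>i. a j \<omega>) \<in> borel_measurable (F (\<tau> i))"
      using am that by (intro borel_measurable_sum) auto
    have [measurable]: "?\<eta> i \<in> borel_measurable (F (\<tau> i))" using \<eta>(1)[OF that] .
    show ?thesis unfolding J_def[abs_def] by measurable
  qed
  have Jb: "\<exists>K. \<forall>\<omega>\<in>space M. \<bar>J i \<omega> * ?\<eta> i \<omega>\<bar> \<le> K" if i: "i < n" for i
  proof -
    obtain K where K: "\<And>\<omega>. \<omega> \<in> space M \<Longrightarrow> \<bar>?\<eta> i \<omega>\<bar> \<le> K" using \<eta>(2)[OF i] by blast
    have "\<bar>J i \<omega> * ?\<eta> i \<omega>\<bar> \<le> \<bar>K\<bar>" if "\<omega> \<in> space M" for \<omega>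
      using K[OF that] by (auto simp: J_def)
    then show ?thesis by blast
  qed
  have step: "0 \<le> \<tau> i \<and> \<tau> i \<le> \<tau> (Suc i)" if "i < n" for i
    using \<tau>(3)[of i] le[of i "Suc i"] that by auto
  have J2: "integrable M (\<lambda>\<omega>. (J i \<omega> * ?\<eta> i \<omega>)\<^sup>2)" if i: "i < n" for i
  proof -
    obtain K where K: "\<And>\<omega>. \<omega> \<in> space M \<Longrightarrow> \<bar>J i \<omega> * ?\<eta> i \<omega>\<bar> \<le> K" using Jb[OF i] by blast
    show ?thesis
    proof (rule integrable_const_bound[of _ "K\<^sup>2"])
      show "AE \<omega> in M. norm ((J i \<omega> * ?\<eta> i \<omega>)\<^sup>2) \<le> K\<^sup>2"
        using power_mono[OF K abs_ge_zero, of _ 2] by (intro AE_I2) simp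
      show "(\<lambda>\<omega>. (J i \<omega> * ?\<eta> i \<omega>)\<^sup>2) \<in> borel_measurable M"
        using measurable_F_imp_M[OF Jm[OF i]] by (rule borel_measurable_power)
    qed
  qed
  note iso = discrete_isometry[of n \<tau> "\<lambda>i \<omega>. J i \<omega> * ?\<eta> i \<omega>" "\<lambda>_. axis l 1", OF step Jm Jb,
      folded N_def]
  have "expectation (\<lambda>\<omega>. (N \<omega>)\<^sup>2) = expectation (\<lambda>\<omega>. \<Sum>i<n. (J i \<omega> * ?\<eta> i \<omega>)\<^sup>2 * (\<tau> (Suc i) - \<tau> i))"
    using iso(2) J2 by (simp add: norm_axis_1)
  also have "\<dots> \<le> expectation (\<lambda>_. \<delta>)"
  proof (rule integral_mono)
    fix \<omega> assume "\<omega> \<in> space M"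
    have "(\<Sum>i<n. (J i \<omega> * ?\<eta> i \<omega>)\<^sup>2 * (\<tau> (Suc i) - \<tau> i))
        = (\<Sum>i<n. if (\<Sum>j\<le>i. a j \<omega>) \<le> \<delta> then a i \<omega> else 0)"
      by (intro sum.cong) (auto simp: J_def a_def)
    also have "\<dots> \<le> \<delta>" by (rule truncated_sum_le[OF a0 \<open>\<delta> \<ge> 0\<close>])
    finally show "(\<Sum>i<n. (J i \<omega> * ?\<eta> i \<omega>)\<^sup>2 * (\<tau> (Suc i) - \<tau> i)) \<le> \<delta>" .
  qed (use J2 in auto)
  finally have EN: "expectation (\<lambda>\<omega>. (N \<omega>)\<^sup>2) \<le> \<delta>" by (simp add: prob_space)
  have "prob {\<omega>\<in>space M. \<epsilon>\<^sup>2 \<le> (N \<omega>)\<^sup>2} \<le> expectation (\<lambda>\<omega>. (N \<omega>)\<^sup>2) / \<epsilon>\<^sup>2"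
    using integral_Markov_inequality_measure[OF iso(1), of "space M" "\<epsilon>\<^sup>2"] \<open>\<epsilon> > 0\<close> by simp
  also have "\<dots> \<le> \<delta> / \<epsilon>\<^sup>2" using EN by (intro divide_right_mono) auto
  finally have M: "prob {\<omega>\<in>space M. \<epsilon>\<^sup>2 \<le> (N \<omega>)\<^sup>2} \<le> \<delta> / \<epsilon>\<^sup>2" .
  have [measurable]: "N \<in> borel_measurable M"
    unfolding N_def[abs_def]
  proof (intro borel_measurable_sum borel_measurable_times[OF measurable_F_imp_M[OF Jm]])
    fix i assume i: "i \<in> {..<n}"
    have "W (\<tau> (Suc i)) \<in> borel_measurable M" "W (\<tau> i) \<in> borel_measurable M"
      using \<tau>(3)[of i] \<tau>(3)[of "Suc i"] i by (auto intro!: W_measurable)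
    then show "?D i \<in> borel_measurable M" by simp
  qed auto
  have set: "{\<omega>\<in>space M. \<epsilon>\<^sup>2 \<le> (N \<omega>)\<^sup>2} \<in> events" by measurable
  \<comment> \<open>Outside \<open>D\<close> the threshold is never passed, so the stopped sum
    \<open>N\<close> is the full integral.\<close>
  have "{\<omega>\<in>space M. \<epsilon> < \<bar>simple_integral h (\<lambda>s \<omega>. W s \<omega> $ l) \<omega>\<bar>} \<subseteq> D \<union> {\<omega>\<in>space M. \<epsilon>\<^sup>2 \<le> (N \<omega>)\<^sup>2}"
  proof safe
    fix \<omega> assume \<omega>: "\<omega> \<in> space M" and big: "\<epsilon> < \<bar>simple_integral h (\<lambda>s \<omega>. W s \<omega> $ l) \<omega>\<bar>" and "\<omega> \<notin> D"
    have "ennreal (\<Sum>i<n. a i \<omega>) \<le> (\<integral>\<^sup>+s\<in>{0..T}. ennreal ((simple_process h s \<omega>)\<^sup>2) \<partial>lborel)"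
      using nn_integral_simple_process_ge[OF \<tau>] by (simp add: a_def)
    also have "\<dots> \<le> ennreal \<delta>" using sub[OF \<omega>] \<open>\<omega> \<notin> D\<close> by (meson not_le)
    finally have sum: "(\<Sum>i<n. a i \<omega>) \<le> \<delta>" using \<open>\<delta> \<ge> 0\<close> by simp
    have "J i \<omega> = 1" if "i < n" for i
    proof -
      have "(\<Sum>j\<le>i. a j \<omega>) \<le> (\<Sum>i<n. a i \<omega>)" using that a0 by (intro sum_mono2) auto
      then show ?thesis using sum by (simp add: J_def)
    qed
    then have "N \<omega> = simple_integral h (\<lambda>s \<omega>. W s \<omega> $ l) \<omega>"
      unfolding simple_integral_on_grid[OF \<tau>(1,2)] N_def
      by (intro sum.cong) (auto simp: inner_axis')
    then show "\<epsilon>\<^sup>2 \<le> (N \<omega>)\<^sup>2"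
      using big \<open>\<epsilon> > 0\<close> by (simp add: abs_le_square_iff[symmetric])
  qed
  then have "prob {\<omega>\<in>space M. \<epsilon> < \<bar>simple_integral h (\<lambda>s \<omega>. W s \<omega> $ l) \<omega>\<bar>}
      \<le> prob (D \<union> {\<omega>\<in>space M. \<epsilon>\<^sup>2 \<le> (N \<omega>)\<^sup>2})"
    using D set by (intro finite_measure_mono) auto
  also have "\<dots> \<le> prob D + prob {\<omega>\<in>space M. \<epsilon>\<^sup>2 \<le> (N \<omega>)\<^sup>2}"
    by (rule measure_Un_le[OF D set])
  finally show ?thesis using M by linarith
qed

end

context brownian_setting
begin

text \<open>Progressive measurability gives joint measurability on \<open>[0, T]\<close>, and
  Tonelli integrates out time. Without this the sets in \<open>tends_to_0_in_prob\<close> need not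
  be events.\<close>

lemma squared_distance_measurable:
  assumes H: "progressive_on F T H" and h: "simple_process_on M F T h" and T: "0 \<le> T"
  shows "(\<lambda>\<omega>. \<integral>\<^sup>+s\<in>{0..T}. ennreal ((simple_process h s \<omega> - H s \<omega>)\<^sup>2) \<partial>lborel) \<in> borel_measurable M"
proof -
  let ?R = "restrict_space borel {0..T}" and ?L = "restrict_space lborel {0..T}"
  \<comment> \<open>The progressive condition is stated over \<open>borel\<close> and the integral
    over \<open>lborel\<close>; both have the same measurable sets.\<close>
  have sets: "sets (?R \<Otimes>\<^sub>M F T) = sets (?L \<Otimes>\<^sub>M F T)"
    by (intro sets_pair_measure_cong sets_restrict_space_cong) simp_all
  have Hm: "(\<lambda>p. H (fst p) (snd p)) \<in> borel_measurable (?L \<Otimes>\<^sub>M F T)"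
  proof -
    have "(\<lambda>p. H (fst p) (snd p)) \<in> borel_measurable (?R \<Otimes>\<^sub>M F T)"
      using H T by (simp add: progressive_on_def split_beta')
    then show ?thesis using measurable_cong_sets[OF sets refl] by blast
  qed
  have hm: "(\<lambda>p. simple_process h (fst p) (snd p)) \<in> borel_measurable (?L \<Otimes>\<^sub>M F T)"
    using h
  proof (induction h)
    case (Cons x h)
    obtain s u \<xi> where x: "x = (s, u, \<xi>)" by (cases x) auto
    then have "\<xi> \<in> borel_measurable (F s)" "s \<le> T" and h: "simple_process_on M F T h"
      using Cons.prems by (auto simp: simple_process_on_Cons)
    then have [measurable]: "\<xi> \<in> borel_measurable (F T)" by (blast intro: measurable_F_mono)
    have [measurable]: "(\<lambda>r. indicator {s<..u} r :: real) \<in> borel_measurable ?L"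
      by (intro measurable_restrict_space1) simp
    have [measurable]: "(\<lambda>p. simple_process h (fst p) (snd p)) \<in> borel_measurable (?L \<Otimes>\<^sub>M F T)"
      by (rule Cons.IH[OF h])
    have "(\<lambda>p. \<xi> (snd p) * indicator {s<..u} (fst p) + simple_process h (fst p) (snd p))
        \<in> borel_measurable (?L \<Otimes>\<^sub>M F T)" by measurable
    then show ?case by (simp add: x)
  qed simp
  have "(\<lambda>p. ennreal ((simple_process h (fst p) (snd p) - H (fst p) (snd p))\<^sup>2)) \<in> borel_measurable (?L \<Otimes>\<^sub>M F T)"
    using hm Hm by simp
  from measurable_pair_swap[OF this]
  have "(\<lambda>(\<omega>, s). ennreal ((simple_process h s \<omega> - H s \<omega>)\<^sup>2)) \<in> borel_measurable (F T \<Otimes>\<^sub>M ?L)"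
    by (simp add: split_beta')
  moreover have "finite_measure ?L"
    by (intro finite_measureI) (use T in \<open>simp add: space_restrict_space emeasure_restrict_space\<close>)
  ultimately have "(\<lambda>\<omega>. \<integral>\<^sup>+s. ennreal ((simple_process h s \<omega> - H s \<omega>)\<^sup>2) \<partial>?L) \<in> borel_measurable (F T)"
    by (intro sigma_finite_measure.borel_measurable_nn_integral)
       (auto simp: finite_measure.axioms(1))
  then have "(\<lambda>\<omega>. \<integral>\<^sup>+s. ennreal ((simple_process h s \<omega> - H s \<omega>)\<^sup>2) \<partial>?L) \<in> borel_measurable M"
    by (rule measurable_F_imp_M)
  then show ?thesis by (simp add: nn_integral_restrict_space)
qed

end

section \<open>Convergence in probability against convergence along paths\<close>

lemma LIMSEQ_0_if_le:
  fixes f g :: "nat \<Rightarrow> real"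
  assumes "\<And>k. 0 \<le> f k" "\<And>k. f k \<le> g k" "g \<longlonglongrightarrow> 0"
  shows "f \<longlonglongrightarrow> 0"
  by (rule tendsto_sandwich[OF _ _ tendsto_const assms(3)]) (simp_all add: assms)

text \<open>Dominated convergence applied to the indicators of the events.\<close>

lemma (in prob_space) prob_tendsto_0:
  assumes D: "\<And>k. D k \<in> events" and ev: "AE \<omega> in M. \<forall>\<^sub>F k in sequentially. \<omega> \<notin> D k"
  shows "(\<lambda>k. prob (D k)) \<longlonglongrightarrow> 0"
proof -
  have "(\<lambda>k. \<integral>\<omega>. indicator (D k) \<omega> \<partial>M) \<longlonglongrightarrow> (\<integral>\<omega>. (0::real) \<partial>M)"
  proof (rule integral_dominated_convergence[where w = "\<lambda>_. 1"])
    show "AE \<omega> in M. (\<lambda>k. indicator (D k) \<omega> :: real) \<longlonglongrightarrow> 0"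
      using ev
    proof (rule AE_mp, intro AE_I2 impI)
      fix \<omega> assume "\<forall>\<^sub>F k in sequentially. \<omega> \<notin> D k"
      then have "\<forall>\<^sub>F k in sequentially. indicator (D k) \<omega> = (0::real)"
        by eventually_elim simp
      then show "(\<lambda>k. indicator (D k) \<omega> :: real) \<longlonglongrightarrow> 0" by (rule tendsto_eventually)
    qed
  qed (use D in \<open>auto split: split_indicator\<close>)
  then show ?thesis using D by simp
qed

text \<open>A tail intersection lies in each of its members and so has probability 0. Infinitely
  many good indices at almost every point are obtained without the summability that Borel-Cantelli
  would ask for.\<close>

lemma (in prob_space) AE_frequently_notin:
  assumes D: "\<And>k. D k \<in> events" and lim: "(\<lambda>k. prob (D k)) \<longlonglongrightarrow> 0"
  shows "AE \<omega> in M. \<forall>N. \<exists>k\<ge>N. \<omega> \<notin> D k"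
proof -
  have "AE \<omega> in M. \<exists>k\<ge>N. \<omega> \<notin> D k" for N
  proof -
    let ?B = "\<Inter>k\<in>{N..}. D k"
    have B: "?B \<in> events" using D by (intro sets.countable_INT') auto
    have "prob ?B \<le> prob (D k)" if "k \<ge> N" for k
      using that D by (intro finite_measure_mono) auto
    then have "prob ?B \<le> 0" using lim by (intro LIMSEQ_le_const[OF lim]) auto
    then have "emeasure M ?B = 0" by (simp add: emeasure_eq_measure measure_le_0_iff)
    then have "AE \<omega> in M. \<omega> \<notin> ?B" using B by (intro AE_not_in) auto
    then show ?thesis by (rule AE_mp) auto
  qed
  then show ?thesis by (simp add: AE_all_countable)
qed

text \<open>Clamping to \<open>[- k, k]\<close> provides the bounded coefficients that simple
  processes must have; on each continuous path it is inactive for large \<open>k\<close>.\<close>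

definition riemann_simple ::
    "real \<Rightarrow> (real \<Rightarrow> 'w \<Rightarrow> real) \<Rightarrow> nat \<Rightarrow> (real \<times> real \<times> ('w \<Rightarrow> real)) list"
  where "riemann_simple T H k =
    map (\<lambda>i. (grid T k i, grid T k (Suc i), \<lambda>\<omega>. max (- real k) (min (real k) (H (grid T k i) \<omega>)))) [0..<k]"

lemma simple_integral_riemann_simple:
  "simple_integral (riemann_simple T H k) \<beta> \<omega> =
    (\<Sum>i<k. max (- real k) (min (real k) (H (grid T k i) \<omega>)) * (\<beta> (grid T k (Suc i)) \<omega> - \<beta> (grid T k i) \<omega>))"
  by (simp add: simple_integral_def riemann_simple_def o_def interv_sum_list_conv_sum_set_nat atLeast0LessThan)

lemma simple_process_riemann_simple:
  "simple_process (riemann_simple T H k) r \<omega> =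
    (\<Sum>i<k. max (- real k) (min (real k) (H (grid T k i) \<omega>)) * indicator {grid T k i<..grid T k (Suc i)} r)"
  by (simp add: simple_process_def riemann_simple_def o_def interv_sum_list_conv_sum_set_nat atLeast0LessThan)

lemma grid_cell:
  assumes "0 < r" "r \<le> T" "k > 0"
  obtains i where "i < k" "r \<in> {grid T k i<..grid T k (Suc i)}"
    "\<And>j. j < k \<Longrightarrow> j \<noteq> i \<Longrightarrow> r \<notin> {grid T k j<..grid T k (Suc j)}"
proof -
  have T: "T > 0" using assms by linarith
  let ?P = "\<lambda>i. r \<le> grid T k (Suc i)"
  define i where "i = (LEAST i. ?P i)"
  have "?P (k - 1)" using assms by simp
  then have 1: "?P i" and ik: "i \<le> k - 1" unfolding i_def by (rule LeastI, rule Least_le)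
  have 2: "grid T k i < r"
  proof (cases i)
    case (Suc j)
    then have "\<not> ?P j" using not_less_Least[of j ?P] by (simp add: i_def)
    then show ?thesis using Suc by simp
  qed (use assms in simp)
  have "r \<notin> {grid T k j<..grid T k (Suc j)}" if "j \<noteq> i" for j
  proof (cases "j < i")
    case True
    then have "grid T k (Suc j) \<le> grid T k i" using T by (intro grid_mono) auto
    then show ?thesis using 2 by simp
  next
    case False
    then have "grid T k (Suc i) \<le> grid T k j" using T that by (intro grid_mono) auto
    then show ?thesis using 1 by simp
  qed
  then show ?thesis using that[of i] 1 2 ik assms(3) by simp
qed

text \<open>A fixed path is bounded and uniformly continuous on \<open>[0, T]\<close>: the clamp is
  eventually idle and the step function is uniformly close to the path.\<close>

lemma riemann_simple_converges:
  fixes H :: "real \<Rightarrow> 'w \<Rightarrow> real"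
  assumes cont: "continuous_on {0..T} (\<lambda>t. H t \<omega>)" and T: "T > 0" and \<delta>: "\<delta> > 0"
  shows "\<forall>\<^sub>F k in sequentially.
    (\<integral>\<^sup>+s\<in>{0..T}. ennreal ((simple_process (riemann_simple T H k) s \<omega> - H s \<omega>)\<^sup>2) \<partial>lborel) \<le> ennreal \<delta>"
    and "\<forall>\<^sub>F k in sequentially. simple_integral (riemann_simple T H k) \<beta> \<omega>
      = (\<Sum>i<k. H (grid T k i) \<omega> * (\<beta> (grid T k (Suc i)) \<omega> - \<beta> (grid T k i) \<omega>))"
proof -
  obtain K where K: "\<And>t. 0 \<le> t \<Longrightarrow> t \<le> T \<Longrightarrow> \<bar>H t \<omega>\<bar> \<le> K"
    using continuous_on_abs_bounded[OF cont] by blast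
  have clamp: "max (- real k) (min (real k) (H (grid T k i) \<omega>)) = H (grid T k i) \<omega>"
    if "real k \<ge> K" "i < k" for k i
    using K[of "grid T k i"] T that grid_nonneg[of T k i] grid_le[of T i k] by auto
  have ev: "\<forall>\<^sub>F k in sequentially. real k \<ge> K"
    using filterlim_real_sequentially eventually_ge_at_top filterlim_iff by blast
  then show "\<forall>\<^sub>F k in sequentially. simple_integral (riemann_simple T H k) \<beta> \<omega>
      = (\<Sum>i<k. H (grid T k i) \<omega> * (\<beta> (grid T k (Suc i)) \<omega> - \<beta> (grid T k i) \<omega>))"
    by eventually_elim (simp add: simple_integral_riemann_simple clamp)
  \<comment> \<open>A uniform error \<open>\<epsilon>\<close> costs
    \<open>\<epsilon>\<^sup>2 * T = \<delta>\<close> in the integral of the square.\<close>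
  define \<epsilon> where "\<epsilon> = sqrt (\<delta> / T)"
  have \<epsilon>: "\<epsilon> > 0" "\<epsilon>\<^sup>2 * T = \<delta>" using \<delta> T by (simp_all add: \<epsilon>_def)
  obtain d where d: "d > 0"
    "\<And>s t. 0 \<le> s \<Longrightarrow> s \<le> t \<Longrightarrow> t \<le> T \<Longrightarrow> t - s < d \<Longrightarrow> \<bar>H t \<omega> - H s \<omega>\<bar> \<le> \<epsilon>"
    using vanishing_onD[OF vanishing_on_continuous[OF cont] \<epsilon>(1)] by blast
  have "\<forall>\<^sub>F k in sequentially. real k > T / d"
    using filterlim_real_sequentially eventually_gt_at_top filterlim_iff by blast
  with ev eventually_gt_at_top[of 0]
  show "\<forall>\<^sub>F k in sequentially.
    (\<integral>\<^sup>+s\<in>{0..T}. ennreal ((simple_process (riemann_simple T H k) s \<omega> - H s \<omega>)\<^sup>2) \<partial>lborel) \<le> ennreal \<delta>"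
  proof eventually_elim
    case (elim k)
    then have mesh: "T / k < d" using d(1) by (simp add: field_simps)
    have bound: "\<bar>simple_process (riemann_simple T H k) r \<omega> - H r \<omega>\<bar> \<le> \<epsilon>" if r: "0 < r" "r \<le> T" for r
    proof -
      obtain i where i: "i < k" "r \<in> {grid T k i<..grid T k (Suc i)}"
        "\<And>j. j < k \<Longrightarrow> j \<noteq> i \<Longrightarrow> r \<notin> {grid T k j<..grid T k (Suc j)}"
        using grid_cell[OF r, of k] elim by blast
      have "simple_process (riemann_simple T H k) r \<omega> = (\<Sum>j<k. if j = i then H (grid T k i) \<omega> else 0)"
        unfolding simple_process_riemann_simple
        using i elim by (intro sum.cong) (auto simp: clamp)
      then have "simple_process (riemann_simple T H k) r \<omega> = H (grid T k i) \<omega>" using i(1) by simp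
      moreover have "\<bar>H r \<omega> - H (grid T k i) \<omega>\<bar> \<le> \<epsilon>"
        using i(2) r mesh grid_step[of T k i] T by (intro d(2)) (auto simp: grid_nonneg)
      ultimately show ?thesis by simp
    qed
    have "(\<integral>\<^sup>+s\<in>{0..T}. ennreal ((simple_process (riemann_simple T H k) s \<omega> - H s \<omega>)\<^sup>2) \<partial>lborel)
        \<le> (\<integral>\<^sup>+s. ennreal (\<epsilon>\<^sup>2) * indicator {0..T} s \<partial>lborel)"
    proof (rule nn_integral_mono_AE)
      show "AE s in lborel. ennreal ((simple_process (riemann_simple T H k) s \<omega> - H s \<omega>)\<^sup>2) * indicator {0..T} s
          \<le> ennreal (\<epsilon>\<^sup>2) * indicator {0..T} s"
        \<comment> \<open>The half-open cells miss the point 0, where the estimate fails; it is a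
          null set.\<close>
        using AE_lborel_singleton[of 0]
      proof (rule AE_mp, intro AE_I2 impI)
        fix s :: real assume "s \<noteq> 0"
        then show "ennreal ((simple_process (riemann_simple T H k) s \<omega> - H s \<omega>)\<^sup>2) * indicator {0..T} s
          \<le> ennreal (\<epsilon>\<^sup>2) * indicator {0..T} s"
          using power_mono[OF bound[of s] abs_ge_zero, of 2]
          by (auto split: split_indicator intro!: ennreal_leI)
      qed
    qed
    also have "\<dots> = ennreal \<delta>"
      using T \<epsilon> by (simp add: nn_integral_cmult_indicator ennreal_mult[symmetric])
    finally show ?case .
  qed
qed

context brownian_setting
begin

lemma simple_process_on_riemann_simple:
  assumes H: "\<And>t. t \<ge> 0 \<Longrightarrow> H t \<in> borel_measurable (F t)" and T: "T > 0"
  shows "simple_process_on M F T (riemann_simple T H k)"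
proof -
  have "0 \<le> grid T k i \<and> grid T k i \<le> grid T k (Suc i) \<and> grid T k (Suc i) \<le> T \<and>
      (\<lambda>\<omega>. max (- real k) (min (real k) (H (grid T k i) \<omega>))) \<in> borel_measurable (F (grid T k i)) \<and>
      (\<exists>c. \<forall>\<omega>\<in>space M. \<bar>max (- real k) (min (real k) (H (grid T k i) \<omega>))\<bar> \<le> c)" if "i < k" for i
  proof (intro conjI)
    show "\<exists>c. \<forall>\<omega>\<in>space M. \<bar>max (- real k) (min (real k) (H (grid T k i) \<omega>))\<bar> \<le> c"
      by (intro exI[of _ "real k"]) auto
  qed (use T that in \<open>auto intro!: grid_nonneg grid_mono grid_le borel_measurable_max borel_measurable_min H\<close>)
  then show ?thesis by (auto simp: simple_process_on_def riemann_simple_def)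
qed

lemma simple_integral_measurable:
  assumes "simple_process_on M F T h"
  shows "simple_integral h (\<lambda>s \<omega>. W s \<omega> $ l) \<in> borel_measurable M"
  using assms
proof (induction h)
  case Nil
  then show ?case by (simp add: simple_integral_def[abs_def])
next
  case (Cons x h)
  obtain s u \<xi> where x: "x = (s, u, \<xi>)" by (cases x) auto
  then have su: "0 \<le> s" "s \<le> u" and \<xi>: "\<xi> \<in> borel_measurable (F s)" and h: "simple_process_on M F T h"
    using Cons.prems by (auto simp: simple_process_on_Cons)
  have "(\<lambda>\<omega>. W r \<omega> $ l) \<in> borel_measurable M" if "r \<ge> 0" for r
    by (rule borel_measurable_continuous_on[of "\<lambda>x. x $ l", OF _ W_measurable[OF that]])
       (auto intro: continuous_intros)
  then have "(\<lambda>\<omega>. \<xi> \<omega> * (W u \<omega> $ l - W s \<omega> $ l) + simple_integral h (\<lambda>s \<omega>. W s \<omega> $ l) \<omega>) \<in> borel_measurable M"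
    using su by (intro borel_measurable_add borel_measurable_times borel_measurable_diff
        measurable_F_imp_M[OF \<xi>] Cons.IH[OF h]) auto
  then show ?case by (simp add: x simple_integral_def[abs_def])
qed

text \<open>Two sequences approximating the same integrand differ by a simple process with small
  integrated square, apart from events of small probability; the stopped isometry then controls the
  difference of their integrals.\<close>

lemma simple_integral_difference_tendsto:
  fixes H :: "real \<Rightarrow> 'w \<Rightarrow> real"
  assumes T: "T > 0" and prog: "progressive_on F T H"
    and h: "\<And>k. simple_process_on M F T (h k)" and g: "\<And>k. simple_process_on M F T (g k)"
    and cont: "\<And>\<omega>. \<omega> \<in> space M \<Longrightarrow> continuous_on {0..T} (\<lambda>t. H t \<omega>)"
    and limh: "tends_to_0_in_prob M
        (\<lambda>k \<omega>. \<integral>\<^sup>+s\<in>{0..T}. ennreal ((simple_process (h k) s \<omega> - H s \<omega>)\<^sup>2) \<partial>lborel)"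
    and limg: "tends_to_0_in_prob M
        (\<lambda>k \<omega>. \<integral>\<^sup>+s\<in>{0..T}. ennreal ((simple_process (g k) s \<omega> - H s \<omega>)\<^sup>2) \<partial>lborel)"
    and \<epsilon>: "\<epsilon> > 0"
  shows "(\<lambda>k. prob {\<omega>\<in>space M. \<epsilon> < \<bar>simple_integral (h k) (\<lambda>s \<omega>. W s \<omega> $ l) \<omega>
      - simple_integral (g k) (\<lambda>s \<omega>. W s \<omega> $ l) \<omega>\<bar>}) \<longlonglongrightarrow> 0"
proof (rule LIMSEQ_I)
  fix r :: real assume r: "r > 0"
  \<comment> \<open>Chosen so that the variance term \<open>\<delta> / \<epsilon>\<^sup>2\<close> is
    \<open>r / 4\<close>. With threshold \<open>\<delta> / 4\<close> for each sequence,
    \<open>(x - z)\<^sup>2 \<le> 2 x\<^sup>2 + 2 z\<^sup>2\<close> brings the difference back to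
    \<open>\<delta>\<close>.\<close>
  define \<delta> where "\<delta> = r * \<epsilon>\<^sup>2 / 4"
  have \<delta>: "\<delta> > 0" "\<delta> / \<epsilon>\<^sup>2 = r / 4" using r \<epsilon> by (simp_all add: \<delta>_def)
  let ?A = "\<lambda>h k \<omega>. \<integral>\<^sup>+s\<in>{0..T}. ennreal ((simple_process (h k) s \<omega> - H s \<omega>)\<^sup>2) \<partial>lborel"
  let ?D = "\<lambda>h k. {\<omega>\<in>space M. ennreal (\<delta> / 4) < ?A h k \<omega>}"
  have Dm: "?D h k \<in> events" "?D g k \<in> events" for k
    using squared_distance_measurable[OF prog h[of k] less_imp_le[OF T]]
      squared_distance_measurable[OF prog g[of k] less_imp_le[OF T]]
    by measurable
  have "(\<lambda>k. prob (?D h k)) \<longlonglongrightarrow> 0" "(\<lambda>k. prob (?D g k)) \<longlonglongrightarrow> 0"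
    using limh limg \<delta>(1) unfolding tends_to_0_in_prob_def by simp_all
  then have "\<forall>\<^sub>F k in sequentially. prob (?D h k) < r / 4" and "\<forall>\<^sub>F k in sequentially. prob (?D g k) < r / 4"
    using r by (auto elim!: order_tendstoD(2) simp del: less_divide_eq_numeral1)
  note ev = this
  have le: "prob {\<omega>\<in>space M. \<epsilon> < \<bar>simple_integral (h k) (\<lambda>s \<omega>. W s \<omega> $ l) \<omega>
      - simple_integral (g k) (\<lambda>s \<omega>. W s \<omega> $ l) \<omega>\<bar>} \<le> prob (?D h k) + prob (?D g k) + r / 4" for k
  proof -
    let ?h = "h k @ negate_simple (g k)"
    have hg: "simple_process_on M F T ?h"
      by (intro simple_process_on_append simple_process_on_negate h g)
    have "prob {\<omega>\<in>space M. \<epsilon> < \<bar>simple_integral ?h (\<lambda>s \<omega>. W s \<omega> $ l) \<omega>\<bar>}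
        \<le> prob (?D h k \<union> ?D g k) + \<delta> / \<epsilon>\<^sup>2"
    proof (rule prob_simple_integral_le[OF hg])
      fix \<omega> assume \<omega>: "\<omega> \<in> space M"
        and big: "ennreal \<delta> < (\<integral>\<^sup>+s\<in>{0..T}. ennreal ((simple_process ?h s \<omega>)\<^sup>2) \<partial>lborel)"
      show "\<omega> \<in> ?D h k \<union> ?D g k"
      proof (rule ccontr)
        assume "\<omega> \<notin> ?D h k \<union> ?D g k"
        then have small: "?A h k \<omega> \<le> ennreal (\<delta> / 4)" "?A g k \<omega> \<le> ennreal (\<delta> / 4)"
          using \<omega> by (auto simp: not_less)
        \<comment> \<open>Continuity of the path is known on \<open>[0, T]\<close> only; cut off by
          the indicator, it is Borel on the whole line.\<close>
        define H' where "H' s = indicator {0..T} s *\<^sub>R H s \<omega>" for s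
        have [measurable]: "H' \<in> borel_measurable borel"
          unfolding H'_def[abs_def]
          by (intro borel_measurable_continuous_on_indicator cont[OF \<omega>]) simp
        have AH: "?A f k \<omega> = (\<integral>\<^sup>+s\<in>{0..T}. ennreal ((simple_process (f k) s \<omega> - H' s)\<^sup>2) \<partial>lborel)" for f
          by (intro nn_integral_cong) (auto simp: H'_def split: split_indicator)
        have "(\<integral>\<^sup>+s\<in>{0..T}. ennreal ((simple_process ?h s \<omega>)\<^sup>2) \<partial>lborel)
            \<le> (\<integral>\<^sup>+s. 2 * (ennreal ((simple_process (h k) s \<omega> - H' s)\<^sup>2) * indicator {0..T} s)
              + 2 * (ennreal ((simple_process (g k) s \<omega> - H' s)\<^sup>2) * indicator {0..T} s) \<partial>lborel)"
        proof (rule nn_integral_mono)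
          fix s
          let ?a = "simple_process (h k) s \<omega> - H' s" and ?b = "simple_process (g k) s \<omega> - H' s"
          have "(simple_process ?h s \<omega>)\<^sup>2 = (?a - ?b)\<^sup>2"
            by (simp add: simple_process_append simple_process_negate)
          also have "\<dots> \<le> 2 * ?a\<^sup>2 + 2 * ?b\<^sup>2"
            using zero_le_power2[of "?a + ?b"] by (simp add: power2_eq_square algebra_simps)
          finally have "ennreal ((simple_process ?h s \<omega>)\<^sup>2) \<le> ennreal (2 * ?a\<^sup>2 + 2 * ?b\<^sup>2)"
            by (rule ennreal_leI)
          also have "\<dots> = 2 * ennreal (?a\<^sup>2) + 2 * ennreal (?b\<^sup>2)"
            by (simp add: ennreal_mult)
          finally have "ennreal ((simple_process ?h s \<omega>)\<^sup>2) \<le> 2 * ennreal (?a\<^sup>2) + 2 * ennreal (?b\<^sup>2)" .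
          then show "ennreal ((simple_process ?h s \<omega>)\<^sup>2) * indicator {0..T} s
              \<le> 2 * (ennreal (?a\<^sup>2) * indicator {0..T} s) + 2 * (ennreal (?b\<^sup>2) * indicator {0..T} s)"
            by (simp split: split_indicator)
        qed
        also have "\<dots> = 2 * ?A h k \<omega> + 2 * ?A g k \<omega>"
          unfolding AH[of h] AH[of g] by (subst nn_integral_add) (simp_all add: nn_integral_cmult)
        also have "\<dots> \<le> 2 * ennreal (\<delta> / 4) + 2 * ennreal (\<delta> / 4)"
          by (intro add_mono mult_left_mono small) auto
        also have "\<dots> = ennreal \<delta>"
        proof -
          have "2 * ennreal (\<delta> / 4) = ennreal (\<delta> / 2)"
            using \<delta> by (subst ennreal_numeral[symmetric], subst ennreal_mult[symmetric]) auto
          then show ?thesis using \<delta> by (simp add: ennreal_plus[symmetric] del: ennreal_plus)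
        qed
        finally show False using big by simp
      qed
    qed (use T \<epsilon> \<delta> Dm in auto)
    also have "prob (?D h k \<union> ?D g k) \<le> prob (?D h k) + prob (?D g k)"
      by (rule measure_Un_le[OF Dm])
    finally show ?thesis
      using \<delta> by (simp add: simple_integral_append simple_integral_negate)
  qed
  from ev have "\<forall>\<^sub>F k in sequentially. prob {\<omega>\<in>space M. \<epsilon> < \<bar>simple_integral (h k) (\<lambda>s \<omega>. W s \<omega> $ l) \<omega>
      - simple_integral (g k) (\<lambda>s \<omega>. W s \<omega> $ l) \<omega>\<bar>} < r"
  proof (eventually_elim)
    case (elim k)
    show ?case by (rule le_less_trans[OF le[of k]]) (use elim r in linarith)
  qed
  then show "\<exists>no. \<forall>k\<ge>no. norm (prob {\<omega>\<in>space M. \<epsilon> < \<bar>simple_integral (h k) (\<lambda>s \<omega>. W s \<omega> $ l) \<omega>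
      - simple_integral (g k) (\<lambda>s \<omega>. W s \<omega> $ l) \<omega>\<bar>} - 0) < r"
    by (simp add: eventually_sequentially)
qed

text \<open>The definition offers some approximating sequence, of which nothing more is known. The
  clamped Riemann processes approximate as well, so their sums tend to \<open>I\<close> in
  probability; a pathwise limit of these sums must agree with \<open>I\<close>.\<close>

lemma ito_integral_eq_riemann_limit:
  fixes H :: "real \<Rightarrow> 'w \<Rightarrow> real"
  assumes T: "T > 0" and ito: "has_ito_integral M F (\<lambda>s \<omega>. W s \<omega> $ l) T H I"
    and cont: "\<And>\<omega>. \<omega> \<in> space M \<Longrightarrow> continuous_on {0..T} (\<lambda>t. H t \<omega>)"
    and adapted: "\<And>t. t \<ge> 0 \<Longrightarrow> H t \<in> borel_measurable (F t)"
    and lim: "AE \<omega> in M. (\<lambda>k. \<Sum>i<k. H (grid T k i) \<omega> * (W (grid T k (Suc i)) \<omega> $ l - W (grid T k i) \<omega> $ l))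
      \<longlonglongrightarrow> J \<omega>"
  shows "AE \<omega> in M. I \<omega> = J \<omega>"
proof -
  let ?\<beta> = "\<lambda>s \<omega>. W s \<omega> $ l"
  obtain h where prog: "progressive_on F T H" and Im [measurable]: "I \<in> borel_measurable M"
    and h: "\<And>k. simple_process_on M F T (h k)"
    and limh: "tends_to_0_in_prob M
        (\<lambda>k \<omega>. \<integral>\<^sup>+s\<in>{0..T}. ennreal ((simple_process (h k) s \<omega> - H s \<omega>)\<^sup>2) \<partial>lborel)"
    and limI: "tends_to_0_in_prob M (\<lambda>k \<omega>. ennreal \<bar>simple_integral (h k) ?\<beta> \<omega> - I \<omega>\<bar>)"
    using ito unfolding has_ito_integral_def by blast
  define g where "g = riemann_simple T H"
  have g: "simple_process_on M F T (g k)" for k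
    unfolding g_def by (rule simple_process_on_riemann_simple[OF adapted T])
  have gm [measurable]: "simple_integral (g k) ?\<beta> \<in> borel_measurable M"
    and hm [measurable]: "simple_integral (h k) ?\<beta> \<in> borel_measurable M" for k
    by (rule simple_integral_measurable[OF g], rule simple_integral_measurable[OF h])
  have limg: "tends_to_0_in_prob M
        (\<lambda>k \<omega>. \<integral>\<^sup>+s\<in>{0..T}. ennreal ((simple_process (g k) s \<omega> - H s \<omega>)\<^sup>2) \<partial>lborel)"
    unfolding tends_to_0_in_prob_def
  proof (intro allI impI prob_tendsto_0 AE_I2)
    fix \<epsilon> :: real and k assume "\<epsilon> > 0"
    show "{\<omega>\<in>space M. ennreal \<epsilon> < (\<integral>\<^sup>+s\<in>{0..T}. ennreal ((simple_process (g k) s \<omega> - H s \<omega>)\<^sup>2) \<partial>lborel)} \<in> events"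
      using squared_distance_measurable[OF prog g[of k] less_imp_le[OF T]] by measurable
  next
    fix \<epsilon> :: real and \<omega> assume "\<epsilon> > 0" "\<omega> \<in> space M"
    show "\<forall>\<^sub>F k in sequentially. \<omega> \<notin> {\<omega>\<in>space M. ennreal \<epsilon> <
        (\<integral>\<^sup>+s\<in>{0..T}. ennreal ((simple_process (g k) s \<omega> - H s \<omega>)\<^sup>2) \<partial>lborel)}"
      using riemann_simple_converges(1)[where H = H and \<omega> = \<omega>, OF cont[OF \<open>\<omega> \<in> space M\<close>] T \<open>\<epsilon> > 0\<close>]
      unfolding g_def by eventually_elim (simp add: not_less)
  qed
  have limJ: "AE \<omega> in M. (\<lambda>k. simple_integral (g k) ?\<beta> \<omega>) \<longlonglongrightarrow> J \<omega>"
    using lim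
  proof (rule AE_mp, intro AE_I2 impI)
    fix \<omega> assume \<omega>: "\<omega> \<in> space M" and
      l: "(\<lambda>k. \<Sum>i<k. H (grid T k i) \<omega> * (W (grid T k (Suc i)) \<omega> $ l - W (grid T k i) \<omega> $ l)) \<longlonglongrightarrow> J \<omega>"
    show "(\<lambda>k. simple_integral (g k) ?\<beta> \<omega>) \<longlonglongrightarrow> J \<omega>"
      using l riemann_simple_converges(2)[where H = H and \<omega> = \<omega> and \<beta> = ?\<beta>, OF cont[OF \<omega>] T zero_less_one]
      unfolding g_def by (simp add: filterlim_cong)
  qed
  have "AE \<omega> in M. \<bar>I \<omega> - J \<omega>\<bar> \<le> 2 * inverse (real (Suc m))" for m
  proof -
    \<comment> \<open>Countably many tolerances, so that the exceptional null sets can be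
      united.\<close>
    define \<epsilon> where "\<epsilon> = inverse (real (Suc m))"
    have \<epsilon>: "\<epsilon> > 0" by (simp add: \<epsilon>_def)
    let ?G = "\<lambda>k. {\<omega>\<in>space M. 2 * \<epsilon> < \<bar>simple_integral (g k) ?\<beta> \<omega> - I \<omega>\<bar>}"
    let ?G1 = "\<lambda>k. {\<omega>\<in>space M. \<epsilon> < \<bar>simple_integral (h k) ?\<beta> \<omega> - simple_integral (g k) ?\<beta> \<omega>\<bar>}"
    let ?G2 = "\<lambda>k. {\<omega>\<in>space M. ennreal \<epsilon> < ennreal \<bar>simple_integral (h k) ?\<beta> \<omega> - I \<omega>\<bar>}"
    have Gm: "?G k \<in> events" "?G1 k \<in> events" "?G2 k \<in> events" for k by measurable
    have lim12: "(\<lambda>k. prob (?G1 k) + prob (?G2 k)) \<longlonglongrightarrow> 0 + 0"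
      using simple_integral_difference_tendsto[OF T prog h g cont limh limg \<epsilon>, of l] limI \<epsilon>
      by (intro tendsto_add) (auto simp: tends_to_0_in_prob_def)
    have le: "prob (?G k) \<le> prob (?G1 k) + prob (?G2 k)" for k
    proof -
      have "?G k \<subseteq> ?G1 k \<union> ?G2 k"
      proof
        fix \<omega> assume "\<omega> \<in> ?G k"
        then have \<omega>: "\<omega> \<in> space M" "2 * \<epsilon> < \<bar>simple_integral (g k) ?\<beta> \<omega> - I \<omega>\<bar>" by auto
        then consider "\<epsilon> < \<bar>simple_integral (h k) ?\<beta> \<omega> - simple_integral (g k) ?\<beta> \<omega>\<bar>"
          | "\<epsilon> < \<bar>simple_integral (h k) ?\<beta> \<omega> - I \<omega>\<bar>" by linarith
        then show "\<omega> \<in> ?G1 k \<union> ?G2 k"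
          using \<omega> \<epsilon> by cases (auto simp: ennreal_less_iff)
      qed
      then have "prob (?G k) \<le> prob (?G1 k \<union> ?G2 k)" using Gm by (intro finite_measure_mono) auto
      also have "\<dots> \<le> prob (?G1 k) + prob (?G2 k)" by (rule measure_Un_le[OF Gm(2,3)])
      finally show ?thesis .
    qed
    have "(\<lambda>k. prob (?G k)) \<longlonglongrightarrow> 0"
      by (rule LIMSEQ_0_if_le[OF measure_nonneg le lim12[unfolded add_0]])
    from AE_frequently_notin[OF Gm(1) this] limJ AE_space
    have "AE \<omega> in M. \<bar>I \<omega> - J \<omega>\<bar> \<le> 2 * \<epsilon>"
    proof eventually_elim
      case (elim \<omega>)
      note freq = elim(1) and l = elim(2) and \<omega> = elim(3)
      show ?case
      proof (rule ccontr)
        assume "\<not> \<bar>I \<omega> - J \<omega>\<bar> \<le> 2 * \<epsilon>"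
        then have less: "2 * \<epsilon> < \<bar>J \<omega> - I \<omega>\<bar>" by (simp add: not_le abs_minus_commute)
        have "(\<lambda>k. \<bar>simple_integral (g k) ?\<beta> \<omega> - I \<omega>\<bar>) \<longlonglongrightarrow> \<bar>J \<omega> - I \<omega>\<bar>"
          by (intro tendsto_rabs tendsto_diff l tendsto_const)
        \<comment> \<open>A limit further than \<open>2 * \<epsilon>\<close> from \<open>I\<close>
          would keep the point in all late bad events, yet almost surely it escapes them infinitely
          often.\<close>
        from order_tendstoD(1)[OF this less]
        have "\<exists>N. \<forall>k\<ge>N. \<omega> \<in> ?G k"
          using \<omega> by (simp add: eventually_sequentially)
        then show False using freq by blast
      qed
    qed
    then show ?thesis by (simp only: \<epsilon>_def)
  qed
  then have "AE \<omega> in M. \<forall>m. \<bar>I \<omega> - J \<omega>\<bar> \<le> 2 * inverse (real (Suc m))"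
    by (simp add: AE_all_countable)
  then show ?thesis
  proof eventually_elim
    case (elim \<omega>)
    have lim: "(\<lambda>m. 2 * inverse (real (Suc m))) \<longlonglongrightarrow> 2 * 0"
      by (intro tendsto_mult tendsto_const LIMSEQ_inverse_real_of_nat)
    have "\<bar>I \<omega> - J \<omega>\<bar> \<le> 2 * 0"
      by (rule LIMSEQ_le_const[OF lim]) (use elim in blast)
    then show ?case by simp
  qed
qed

end

section \<open>Pathwise form of the equations\<close>

lemma continuous_on_halfline:
  fixes f :: "real \<Rightarrow> 'b::topological_space"
  assumes "\<And>T. continuous_on {0..T} f"
  shows "continuous_on {0..} f"
  unfolding continuous_on_eq_continuous_within
proof
  fix x :: real assume "x \<in> {0..}"
  then have "continuous (at x within {0..x + 1}) f"
    using assms[of "x + 1"] by (auto simp: continuous_on_eq_continuous_within)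
  moreover have "at x within {0..} = at x within {0..x + 1}"
    by (rule at_within_nhd[of x "{..<x + 1}"]) auto
  ultimately show "continuous (at x within {0..}) f" by simp
qed

lemma continuous_on_halflineD:
  "continuous_on {0..} f \<Longrightarrow> continuous_on {0..T::real} f"
  by (rule continuous_on_subset) auto

lemma continuous_on_indefinite_integral:
  fixes f :: "real \<Rightarrow> real"
  assumes "continuous_on {0..} f"
  shows "continuous_on {0..} (\<lambda>t. integral {0..t} f)"
  by (rule continuous_on_halfline, rule indefinite_integral_continuous_1,
      rule integrable_continuous_interval, rule continuous_on_halflineD, rule assms)

text \<open>Null sets are united over the positive rationals and continuity fills in the other
  times. Time 0 arises as a limit, as the equations are identified for positive times first.\<close>

lemma (in prob_space) AE_all_times:
  fixes g :: "real \<Rightarrow> 'a \<Rightarrow> real"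
  assumes ae: "\<And>t. t > 0 \<Longrightarrow> AE \<omega> in M. g t \<omega> = 0"
    and cont: "\<And>\<omega>. \<omega> \<in> space M \<Longrightarrow> continuous_on {0..} (\<lambda>t. g t \<omega>)"
  shows "AE \<omega> in M. \<forall>t\<ge>0. g t \<omega> = 0"
proof -
  have "AE \<omega> in M. \<forall>t\<in>{0<..} \<inter> \<rat>. g t \<omega> = 0"
  proof (rule AE_ball_countable')
    show "countable ({0::real<..} \<inter> \<rat>)" by (intro countable_Int2 countable_rat)
  qed (use ae in auto)
  then show ?thesis using AE_space
  proof eventually_elim
    case (elim \<omega>)
    have cl: "closure ({0::real<..} \<inter> \<rat>) = {0..}"
      by (subst closure_open_Int_superset) (auto simp: Rats_closure_real)
    have "g t \<omega> = 0" if "t \<ge> 0" for t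
      by (rule continuous_constant_on_closure[of "{0<..} \<inter> \<rat>" "\<lambda>t. g t \<omega>"])
        (use elim cont that in \<open>auto simp: cl\<close>)
    then show ?case by blast
  qed
qed

text \<open>Integration by parts: as \<open>f\<close> has finite variation, the integral of \<open>f\<close> against a continuous
  path is a limit of Riemann sums without any probability.\<close>

lemma negligible_on_by_parts:
  assumes f: "\<And>t. 0 \<le> t \<Longrightarrow> t \<le> T \<Longrightarrow> f t - f 0 = integral {0..t} f'"
    and f': "continuous_on {0..T} f'" and b: "continuous_on {0..T} b"
  shows "negligible_on T (\<lambda>s t. (f t * b t - integral {0..t} (\<lambda>r. b r * f' r))
    - (f s * b s - integral {0..s} (\<lambda>r. b r * f' r)) - f s * (b t - b s))"
proof (rule negligible_on_cong[OF negligible_on_integral_increment[OF b f']])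
  fix s t assume st: "0 \<le> s" "s \<le> t" "t \<le> T"
  have bf: "continuous_on {0..T} (\<lambda>r. b r * f' r)" by (intro continuous_intros b f')
  have "f t - f s = integral {s..t} f'"
    using f[of s] f[of t] integral_increment[OF f' st] st by simp
  moreover have "integral {s..t} (\<lambda>r. (b t - b r) * f' r)
      = b t * integral {s..t} f' - integral {s..t} (\<lambda>r. b r * f' r)"
    using integrable_on_subinterval_continuous[OF f' st(1,3)]
      integrable_on_subinterval_continuous[OF bf st(1,3)]
    unfolding left_diff_distrib
    by (subst integral_diff) (auto intro: integrable_on_mult_right)
  ultimately show "integral {s..t} (\<lambda>r. (b t - b r) * f' r)
      = (f t * b t - integral {0..t} (\<lambda>r. b r * f' r))
        - (f s * b s - integral {0..s} (\<lambda>r. b r * f' r)) - f s * (b t - b s)"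
    using integral_increment[OF bf st] by (simp add: algebra_simps)
qed

section \<open>From Ito equations to integral equations along paths\<close>

context brownian_setting
begin

lemma W_component_continuous:
  "\<omega> \<in> space M \<Longrightarrow> continuous_on {0..} (\<lambda>t. W t \<omega> $ l)"
  by (rule continuous_on_component[OF W_continuous])

text \<open>The noise coefficient has a direction \<open>c\<close> and a scalar factor
  \<open>f\<close> that is a primitive. Three instances cover the system: \<open>f = 1\<close> with
  a row of \<open>B\<close> for \<open>v\<close>, \<open>c = 0\<close> for \<phi>, and
  \<open>f = \<phi>\<close> with \<open>c = \<gamma>\<close> for \<psi>.\<close>

lemma sde_coordinate:
  fixes X :: "real \<Rightarrow> 'w \<Rightarrow> 'a::euclidean_space" and f f' :: "real \<Rightarrow> 'w \<Rightarrow> real" and c :: "real^'m"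
  assumes sol: "solves_sde M F W b \<sigma> X" and e: "e \<in> Basis"
    and \<sigma>: "\<And>s \<omega> l. \<sigma> (X s \<omega>) l \<bullet> e = c $ l * f s \<omega>"
    and adapted: "\<And>t. t \<ge> 0 \<Longrightarrow> f t \<in> borel_measurable (F t)"
    and f: "\<And>\<omega>. \<omega> \<in> space M \<Longrightarrow> continuous_on {0..} (\<lambda>t. f t \<omega>)"
    and f': "\<And>\<omega>. \<omega> \<in> space M \<Longrightarrow> continuous_on {0..} (\<lambda>t. f' t \<omega>)"
    and prim: "AE \<omega> in M. \<forall>t\<ge>0. f t \<omega> - f 0 \<omega> = integral {0..t} (\<lambda>s. f' s \<omega>)"
    and b: "\<And>\<omega>. \<omega> \<in> space M \<Longrightarrow> continuous_on {0..} (\<lambda>t. b (X t \<omega>) \<bullet> e)"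
  shows "AE \<omega> in M. \<forall>t\<ge>0. X t \<omega> \<bullet> e - X 0 \<omega> \<bullet> e = integral {0..t} (\<lambda>s. b (X s \<omega>) \<bullet> e)
    + (f t \<omega> * (c \<bullet> W t \<omega>) - f 0 \<omega> * (c \<bullet> W 0 \<omega>) - integral {0..t} (\<lambda>s. (c \<bullet> W s \<omega>) * f' s \<omega>))"
proof -
  let ?J = "\<lambda>t \<omega> l. f t \<omega> * W t \<omega> $ l - integral {0..t} (\<lambda>r. W r \<omega> $ l * f' r \<omega>)"
  let ?g = "\<lambda>t \<omega>. X t \<omega> \<bullet> e - X 0 \<omega> \<bullet> e - integral {0..t} (\<lambda>s. b (X s \<omega>) \<bullet> e)
      - (\<Sum>l\<in>UNIV. c $ l * (?J t \<omega> l - ?J 0 \<omega> l))"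
  have X: "continuous_on {0..} (\<lambda>t. X t \<omega>)" if "\<omega> \<in> space M" for \<omega>
    using sol that by (simp add: solves_sde_def)
  have Wf: "continuous_on {0..} (\<lambda>r. W r \<omega> $ l * f' r \<omega>)" if "\<omega> \<in> space M" for \<omega> l
    by (intro continuous_on_mult W_component_continuous f' that)
  have "AE \<omega> in M. \<forall>t\<ge>0. ?g t \<omega> = 0"
  proof (rule AE_all_times)
    fix \<omega> assume "\<omega> \<in> space M"
    then show "continuous_on {0..} (\<lambda>t. ?g t \<omega>)"
      by (intro continuous_on_diff continuous_on_sum continuous_on_mult continuous_on_inner
          continuous_on_const continuous_on_indefinite_integral X b f Wf W_component_continuous)
  next
    fix t :: real assume t: "t > 0"
    then obtain I where I: "\<And>l. has_ito_integral M F (\<lambda>s \<omega>. W s \<omega> $ l) t (\<lambda>s \<omega>. \<sigma> (X s \<omega>) l \<bullet> e) (I l)"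
      and eq: "AE \<omega> in M. set_integrable lborel {0..t} (\<lambda>s. b (X s \<omega>) \<bullet> e) \<and>
        X t \<omega> \<bullet> e = X 0 \<omega> \<bullet> e + (LINT s:{0..t}|lborel. b (X s \<omega>) \<bullet> e) + (\<Sum>l\<in>UNIV. I l \<omega>)"
      using sol e unfolding solves_sde_def by (meson less_imp_le)
    have "AE \<omega> in M. I l \<omega> = c $ l * (?J t \<omega> l - ?J 0 \<omega> l)" for l
    proof (rule ito_integral_eq_riemann_limit[OF t])
      show "has_ito_integral M F (\<lambda>s \<omega>. W s \<omega> $ l) t (\<lambda>s \<omega>. c $ l * f s \<omega>) (I l)"
        using I[of l] by (simp add: \<sigma>)
      show "continuous_on {0..t} (\<lambda>s. c $ l * f s \<omega>)" if "\<omega> \<in> space M" for \<omega>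
        using continuous_on_halflineD[OF f[OF that]] by (intro continuous_on_mult continuous_on_const)
      show "(\<lambda>\<omega>. c $ l * f s \<omega>) \<in> borel_measurable (F s)" if "s \<ge> 0" for s
        using adapted[OF that] by simp
      show "AE \<omega> in M. (\<lambda>k. \<Sum>i<k. c $ l * f (grid t k i) \<omega> * (W (grid t k (Suc i)) \<omega> $ l - W (grid t k i) \<omega> $ l))
          \<longlonglongrightarrow> c $ l * (?J t \<omega> l - ?J 0 \<omega> l)"
        using prim AE_space
      proof eventually_elim
        case (elim \<omega>)
        have "negligible_on t (\<lambda>s r. (f r \<omega> * W r \<omega> $ l - integral {0..r} (\<lambda>r. W r \<omega> $ l * f' r \<omega>))
          - (f s \<omega> * W s \<omega> $ l - integral {0..s} (\<lambda>r. W r \<omega> $ l * f' r \<omega>)) - f s \<omega> * (W r \<omega> $ l - W s \<omega> $ l))"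
          by (rule negligible_on_by_parts)
             (use elim in \<open>auto intro!: continuous_on_halflineD f' W_component_continuous\<close>)
        from tendsto_mult[OF tendsto_const riemann_sum_tendsto[OF this t], of "c $ l"]
        show ?case by (simp only: sum_distrib_left mult.assoc)
      qed
    qed
    then have "AE \<omega> in M. \<forall>l. I l \<omega> = c $ l * (?J t \<omega> l - ?J 0 \<omega> l)"
      by (simp add: AE_all_countable)
    with eq show "AE \<omega> in M. ?g t \<omega> = 0"
    proof eventually_elim
      case (elim \<omega>)
      then show ?case using set_borel_integral_eq_integral(2)[of "{0..t}" "\<lambda>s. b (X s \<omega>) \<bullet> e"] by simp
    qed
  qed
  then show ?thesis using AE_space
  proof eventually_elim
    case (elim \<omega>)
    show ?case
    proof (intro allI impI)
      fix t :: real assume t: "t \<ge> 0"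
      have "integral {0..t} (\<lambda>s. (c \<bullet> W s \<omega>) * f' s \<omega>)
          = integral {0..t} (\<lambda>s. \<Sum>l\<in>UNIV. c $ l * (W s \<omega> $ l * f' s \<omega>))"
        by (simp add: inner_vec_def sum_distrib_right mult.assoc)
      also have "\<dots> = (\<Sum>l\<in>UNIV. c $ l * integral {0..t} (\<lambda>s. W s \<omega> $ l * f' s \<omega>))"
        using Wf[OF elim(2)]
        by (subst integral_sum) (auto intro!: integrable_on_mult_right integrable_continuous_interval
            continuous_on_mult_left continuous_on_halflineD)
      finally have "(\<Sum>l\<in>UNIV. c $ l * (?J t \<omega> l - ?J 0 \<omega> l))
        = f t \<omega> * (c \<bullet> W t \<omega>) - f 0 \<omega> * (c \<bullet> W 0 \<omega>) - integral {0..t} (\<lambda>s. (c \<bullet> W s \<omega>) * f' s \<omega>)"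
        by (simp add: inner_vec_def right_diff_distrib sum_subtractf sum_distrib_left mult_ac)
      then show "X t \<omega> \<bullet> e - X 0 \<omega> \<bullet> e = integral {0..t} (\<lambda>s. b (X s \<omega>) \<bullet> e)
        + (f t \<omega> * (c \<bullet> W t \<omega>) - f 0 \<omega> * (c \<bullet> W 0 \<omega>) - integral {0..t} (\<lambda>s. (c \<bullet> W s \<omega>) * f' s \<omega>))"
        using elim(1)[rule_format, OF t] by linarith
    qed
  qed
qed

text \<open>As \<open>W 0 = 0\<close> almost surely but not surely, only increments of \<open>W\<close> are used.\<close>

lemma oscillator_pathwise:
  fixes A :: "real^'d^'d" and B :: "real^'m^'d" and X :: "real \<Rightarrow> 'w \<Rightarrow> (real^'d) \<times> real \<times> real"
  assumes sol: "solves_sde M F W (oscillator_drift A a \<kappa> \<zeta>2) (oscillator_diffusion B \<gamma>) X"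
  defines "v \<equiv> \<lambda>t \<omega>. fst (X t \<omega>)" and "\<phi> \<equiv> \<lambda>t \<omega>. fst (snd (X t \<omega>))" and "\<psi> \<equiv> \<lambda>t \<omega>. snd (snd (X t \<omega>))"
  shows "AE \<omega> in M. \<forall>t\<ge>0.
    (\<forall>i. v t \<omega> $ i - v 0 \<omega> $ i = integral {0..t} (\<lambda>s. (A *v v s \<omega>) $ i) + (B *v (W t \<omega> - W 0 \<omega>)) $ i) \<and>
    \<phi> t \<omega> - \<phi> 0 \<omega> = integral {0..t} (\<lambda>s. \<psi> s \<omega>) \<and>
    \<psi> t \<omega> - \<psi> 0 \<omega> = integral {0..t} (\<lambda>s. - 2 * \<zeta>2 * \<psi> s \<omega> - (\<kappa>\<^sup>2 - a \<bullet> v s \<omega>) * \<phi> s \<omega>)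
      + (\<phi> t \<omega> * (\<gamma> \<bullet> W t \<omega>) - \<phi> 0 \<omega> * (\<gamma> \<bullet> W 0 \<omega>) - integral {0..t} (\<lambda>s. (\<gamma> \<bullet> W s \<omega>) * \<psi> s \<omega>))"
proof -
  have X: "continuous_on {0..} (\<lambda>t. X t \<omega>)" if "\<omega> \<in> space M" for \<omega>
    using sol that by (simp add: solves_sde_def)
  have Xm: "X t \<in> borel_measurable (F t)" if "t \<ge> 0" for t
    using sol that by (simp add: solves_sde_def)
  have vc: "continuous_on {0..} (\<lambda>t. v t \<omega>)" and \<phi>c: "continuous_on {0..} (\<lambda>t. \<phi> t \<omega>)"
    and \<psi>c: "continuous_on {0..} (\<lambda>t. \<psi> t \<omega>)" if "\<omega> \<in> space M" for \<omega>
    unfolding v_def \<phi>_def \<psi>_def using X[OF that] by (auto intro!: continuous_intros)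
  have inner: "x \<bullet> (y, 0, 0) = fst x \<bullet> y" "x \<bullet> (0, r, 0) = fst (snd x) * r" "x \<bullet> (0, 0, r) = snd (snd x) * r"
    for x :: "(real^'d) \<times> real \<times> real" and y r
    by (cases x; simp)+
  have comp: "fst (X t \<omega>) = v t \<omega>" "fst (snd (X t \<omega>)) = \<phi> t \<omega>" "snd (snd (X t \<omega>)) = \<psi> t \<omega>" for t \<omega>
    by (simp_all add: v_def \<phi>_def \<psi>_def)
  have drift: "fst (oscillator_drift A a \<kappa> \<zeta>2 (X t \<omega>)) = A *v v t \<omega>"
    "fst (snd (oscillator_drift A a \<kappa> \<zeta>2 (X t \<omega>))) = \<psi> t \<omega>"
    "snd (snd (oscillator_drift A a \<kappa> \<zeta>2 (X t \<omega>))) = - 2 * \<zeta>2 * \<psi> t \<omega> - (\<kappa>\<^sup>2 - a \<bullet> v t \<omega>) * \<phi> t \<omega>" for t \<omega>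
    by (simp_all add: oscillator_drift_def v_def \<phi>_def \<psi>_def split_beta)
  have diff: "fst (oscillator_diffusion B \<gamma> (X t \<omega>) l) = column l B"
    "fst (snd (oscillator_diffusion B \<gamma> (X t \<omega>) l)) = 0"
    "snd (snd (oscillator_diffusion B \<gamma> (X t \<omega>) l)) = \<gamma> $ l * \<phi> t \<omega>" for t \<omega> l
    by (simp_all add: oscillator_diffusion_def \<phi>_def split_beta)
  have 1: "AE \<omega> in M. \<forall>t\<ge>0. v t \<omega> $ i - v 0 \<omega> $ i
      = integral {0..t} (\<lambda>s. (A *v v s \<omega>) $ i) + (B *v (W t \<omega> - W 0 \<omega>)) $ i" for i
  proof -
    let ?e = "(axis i 1, 0, 0) :: (real^'d) \<times> real \<times> real"
    have e: "?e \<in> Basis" by (auto simp: Basis_prod_def zero_prod_def axis_in_Basis_iff)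
    have "AE \<omega> in M. \<forall>t\<ge>0. X t \<omega> \<bullet> ?e - X 0 \<omega> \<bullet> ?e = integral {0..t} (\<lambda>s. oscillator_drift A a \<kappa> \<zeta>2 (X s \<omega>) \<bullet> ?e)
      + (1 * (B $ i \<bullet> W t \<omega>) - 1 * (B $ i \<bullet> W 0 \<omega>) - integral {0..t} (\<lambda>s. (B $ i \<bullet> W s \<omega>) * 0))"
    proof (rule sde_coordinate[OF sol e, where f = "\<lambda>_ _. 1" and f' = "\<lambda>_ _. 0"])
      show "oscillator_diffusion B \<gamma> (X s \<omega>) l \<bullet> ?e = B $ i $ l * 1" for s \<omega> l
        by (simp add: inner diff inner_axis column_def)
      show "continuous_on {0..} (\<lambda>t. oscillator_drift A a \<kappa> \<zeta>2 (X t \<omega>) \<bullet> ?e)" if "\<omega> \<in> space M" for \<omega>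
        using bounded_linear.continuous_on[OF matrix_vector_mul_bounded_linear vc[OF that], of A]
        by (auto simp: inner drift intro!: continuous_intros)
    qed auto
    then show ?thesis
    proof eventually_elim
      case (elim \<omega>)
      then show ?case
        by (simp add: inner drift inner_axis comp matrix_vector_mul_component[of B] inner_diff_right)
    qed
  qed
  have 2: "AE \<omega> in M. \<forall>t\<ge>0. \<phi> t \<omega> - \<phi> 0 \<omega> = integral {0..t} (\<lambda>s. \<psi> s \<omega>)"
  proof -
    let ?e = "(0, 1, 0) :: (real^'d) \<times> real \<times> real"
    have e: "?e \<in> Basis" by (simp add: Basis_prod_def)
    have "AE \<omega> in M. \<forall>t\<ge>0. X t \<omega> \<bullet> ?e - X 0 \<omega> \<bullet> ?e = integral {0..t} (\<lambda>s. oscillator_drift A a \<kappa> \<zeta>2 (X s \<omega>) \<bullet> ?e)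
      + (1 * (0 \<bullet> W t \<omega>) - 1 * (0 \<bullet> W 0 \<omega>) - integral {0..t} (\<lambda>s. (0 \<bullet> W s \<omega>) * 0))"
    proof (rule sde_coordinate[OF sol e, where f = "\<lambda>_ _. 1" and f' = "\<lambda>_ _. 0"])
      show "oscillator_diffusion B \<gamma> (X s \<omega>) l \<bullet> ?e = 0 $ l * 1" for s \<omega> l
        by (simp add: inner diff)
      show "continuous_on {0..} (\<lambda>t. oscillator_drift A a \<kappa> \<zeta>2 (X t \<omega>) \<bullet> ?e)" if "\<omega> \<in> space M" for \<omega>
        using \<psi>c[OF that] by (simp add: inner drift)
    qed auto
    then show ?thesis
    proof eventually_elim
      case (elim \<omega>)
      then show ?case by (simp add: inner drift comp)
    qed
  qed
  \<comment> \<open>This coordinate comes last: the noise factor is \<phi>, and that \<phi> is a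
    primitive of \<psi> is the content of \<open>2\<close>.\<close>
  have 3: "AE \<omega> in M. \<forall>t\<ge>0. \<psi> t \<omega> - \<psi> 0 \<omega>
      = integral {0..t} (\<lambda>s. - 2 * \<zeta>2 * \<psi> s \<omega> - (\<kappa>\<^sup>2 - a \<bullet> v s \<omega>) * \<phi> s \<omega>)
      + (\<phi> t \<omega> * (\<gamma> \<bullet> W t \<omega>) - \<phi> 0 \<omega> * (\<gamma> \<bullet> W 0 \<omega>) - integral {0..t} (\<lambda>s. (\<gamma> \<bullet> W s \<omega>) * \<psi> s \<omega>))"
  proof -
    let ?e = "(0, 0, 1) :: (real^'d) \<times> real \<times> real"
    have e: "?e \<in> Basis" by (simp add: Basis_prod_def)
    have "AE \<omega> in M. \<forall>t\<ge>0. X t \<omega> \<bullet> ?e - X 0 \<omega> \<bullet> ?e = integral {0..t} (\<lambda>s. oscillator_drift A a \<kappa> \<zeta>2 (X s \<omega>) \<bullet> ?e)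
      + (\<phi> t \<omega> * (\<gamma> \<bullet> W t \<omega>) - \<phi> 0 \<omega> * (\<gamma> \<bullet> W 0 \<omega>) - integral {0..t} (\<lambda>s. (\<gamma> \<bullet> W s \<omega>) * \<psi> s \<omega>))"
    proof (rule sde_coordinate[OF sol e])
      show "oscillator_diffusion B \<gamma> (X s \<omega>) l \<bullet> ?e = \<gamma> $ l * \<phi> s \<omega>" for s \<omega> l
        by (simp add: inner diff)
      show "\<phi> t \<in> borel_measurable (F t)" if "t \<ge> 0" for t
        unfolding \<phi>_def using Xm[OF that]
        by (rule borel_measurable_continuous_on[rotated]) (auto intro!: continuous_intros)
      show "continuous_on {0..} (\<lambda>t. oscillator_drift A a \<kappa> \<zeta>2 (X t \<omega>) \<bullet> ?e)" if "\<omega> \<in> space M" for \<omega>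
        using vc[OF that] \<phi>c[OF that] \<psi>c[OF that] by (auto simp: inner drift intro!: continuous_intros)
    qed (fact 2 \<phi>c \<psi>c)+
    then show ?thesis
    proof eventually_elim
      case (elim \<omega>)
      then show ?case by (simp add: inner drift comp)
    qed
  qed
  from 1 have "AE \<omega> in M. \<forall>i. \<forall>t\<ge>0. v t \<omega> $ i - v 0 \<omega> $ i
      = integral {0..t} (\<lambda>s. (A *v v s \<omega>) $ i) + (B *v (W t \<omega> - W 0 \<omega>)) $ i"
    by (simp add: AE_all_countable)
  with 2 3 show ?thesis
  proof eventually_elim
    case (elim \<omega>)
    then show ?case by (intro allI impI conjI) (simp_all only:)
  qed
qed

end

section \<open>Logarithmic growth along a path\<close>

text \<open>A single path, free of probability: \<open>q\<close> stands for
  \<open>\<langle>a, v\<rangle>\<close> and \<open>w\<close> for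
  \<open>\<langle>\<gamma>, W\<rangle>\<close>. In the equation for \<psi> the noise term is already
  integrated by parts.\<close>

locale oscillator_path =
  fixes \<kappa> \<zeta> \<kappa>d :: real and q w \<phi> \<psi> :: "real \<Rightarrow> real"
  assumes \<kappa>d_pos: "\<kappa>d > 0" and \<kappa>d_square: "\<kappa>d\<^sup>2 = \<kappa>\<^sup>2 - \<zeta>\<^sup>2" and \<zeta>_nonneg: "\<zeta> \<ge> 0"
    and q: "continuous_on {0..} q" and w: "continuous_on {0..} w"
    and \<phi>: "continuous_on {0..} \<phi>" and \<psi>: "continuous_on {0..} \<psi>"
    and \<phi>_eq: "\<And>t. t \<ge> 0 \<Longrightarrow> \<phi> t - \<phi> 0 = integral {0..t} \<psi>"
    and \<psi>_eq: "\<And>t. t \<ge> 0 \<Longrightarrow> \<psi> t - \<psi> 0 = integral {0..t} (\<lambda>s. - 2 * \<zeta> * \<psi> s - (\<kappa>\<^sup>2 - q s) * \<phi> s)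
      + (\<phi> t * w t - \<phi> 0 * w 0 - integral {0..t} (\<lambda>s. w s * \<psi> s))"
    and start: "(\<phi> 0, \<psi> 0) \<noteq> (0, 0)"
begin

text \<open>\<open>\<psi> - \<phi> w\<close> is continuously differentiable, so that \<open>(\<phi>, \<psi> - \<phi> w)\<close> solves a linear ordinary
  differential equation with continuous coefficients.\<close>

lemma nonvanishing:
  assumes t: "t \<ge> 0"
  shows "(\<phi> t, \<psi> t) \<noteq> (0, 0)"
proof
  assume zero: "(\<phi> t, \<psi> t) = (0, 0)"
  note cont = continuous_on_halflineD[of _ t]
  define u where "u s = \<psi> s - \<phi> s * w s" for s
  define u' where "u' s = - 2 * \<zeta> * \<psi> s - (\<kappa>\<^sup>2 - q s) * \<phi> s - w s * \<psi> s" for s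
  have cu': "continuous_on {0..} u'" unfolding u'_def by (intro continuous_intros q w \<phi> \<psi>)
  have u: "u s - u 0 = integral {0..s} u'" if "s \<ge> 0" for s
  proof -
    have "(\<lambda>s. - 2 * \<zeta> * \<psi> s - (\<kappa>\<^sup>2 - q s) * \<phi> s) integrable_on {0..s}" "(\<lambda>s. w s * \<psi> s) integrable_on {0..s}"
      by (auto intro!: integrable_continuous_interval continuous_on_halflineD continuous_intros q w \<phi> \<psi>)
    then have "integral {0..s} u' = integral {0..s} (\<lambda>s. - 2 * \<zeta> * \<psi> s - (\<kappa>\<^sup>2 - q s) * \<phi> s)
        - integral {0..s} (\<lambda>s. w s * \<psi> s)"
      unfolding u'_def by (rule integral_diff)
    then show ?thesis using \<psi>_eq[OF that] unfolding u_def by linarith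
  qed
  obtain K where K: "K \<ge> 0" "\<And>s. 0 \<le> s \<Longrightarrow> s \<le> t \<Longrightarrow> \<bar>w s\<bar> \<le> K"
    by (rule continuous_on_abs_bounded[OF cont[OF w]]) blast
  obtain Q where Q: "Q \<ge> 0" "\<And>s. 0 \<le> s \<Longrightarrow> s \<le> t \<Longrightarrow> \<bar>q s\<bar> \<le> Q"
    by (rule continuous_on_abs_bounded[OF cont[OF q]]) blast
  define D where "D = 2 * \<zeta> + K"
  \<comment> \<open>The summands bound, in this order, the coefficients of the five terms of
    \<open>N'\<close> expressed through \<phi> and \<open>u\<close>.\<close>
  define L where "L = 1 + 2 * K + 2 * D + D * K + \<kappa>\<^sup>2 + Q"
  define N where "N s = (\<phi> s)\<^sup>2 + (u s)\<^sup>2" for s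
  define N' where "N' s = 2 * \<phi> s * \<psi> s + 2 * u s * u' s" for s
  have bound: "N' s + L * N s \<ge> 0" if s: "0 \<le> s" "s \<le> t" for s
  proof -
    have prod: "2 * \<bar>\<phi> s * u s\<bar> \<le> N s"
      using sum_squares_bound[of "\<bar>\<phi> s\<bar>" "\<bar>u s\<bar>"] by (simp add: N_def abs_mult)
    have sq: "(\<phi> s)\<^sup>2 \<le> N s" "(u s)\<^sup>2 \<le> N s" by (simp_all add: N_def)
    have N0: "N s \<ge> 0" by (simp add: N_def)
    have D: "\<bar>2 * \<zeta> + w s\<bar> \<le> D" "D \<ge> 0" using K(1) K(2)[OF s] \<zeta>_nonneg by (auto simp: D_def)
    have "N' s = 2 * (\<phi> s * u s) + 2 * w s * (\<phi> s)\<^sup>2 - 2 * (2 * \<zeta> + w s) * (u s)\<^sup>2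
        - (2 * \<zeta> + w s) * w s * (2 * (\<phi> s * u s)) - (\<kappa>\<^sup>2 - q s) * (2 * (\<phi> s * u s))"
      by (simp add: N'_def u'_def u_def power2_eq_square algebra_simps)
    moreover have "- (2 * (\<phi> s * u s)) \<le> N s" using prod by (intro abs_le_D2) simp
    moreover have "- (2 * w s * (\<phi> s)\<^sup>2) \<le> 2 * K * N s"
      using mult_mono[OF K(2)[OF s] sq(1) K(1) zero_le_power2] by (intro abs_le_D2) (simp add: abs_mult)
    moreover have "2 * (2 * \<zeta> + w s) * (u s)\<^sup>2 \<le> 2 * D * N s"
      using order_trans[OF mult_right_mono[OF abs_ge_self zero_le_power2] mult_mono[OF D(1) sq(2) D(2) zero_le_power2]]
      by linarith
    moreover have "(2 * \<zeta> + w s) * w s * (2 * (\<phi> s * u s)) \<le> D * K * N s"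
    proof (rule abs_le_D1)
      have "\<bar>2 * \<zeta> + w s\<bar> * \<bar>w s\<bar> \<le> D * K"
        by (rule mult_mono[OF D(1) K(2)[OF s] D(2) abs_ge_zero])
      then have "\<bar>2 * \<zeta> + w s\<bar> * \<bar>w s\<bar> * \<bar>2 * (\<phi> s * u s)\<bar> \<le> D * K * N s"
        by (rule mult_mono) (use prod D(2) K(1) in simp_all)
      then show "\<bar>(2 * \<zeta> + w s) * w s * (2 * (\<phi> s * u s))\<bar> \<le> D * K * N s"
        by (simp only: abs_mult)
    qed
    moreover have "(\<kappa>\<^sup>2 - q s) * (2 * (\<phi> s * u s)) \<le> (\<kappa>\<^sup>2 + Q) * N s"
    proof (rule abs_le_D1)
      have "\<bar>\<kappa>\<^sup>2 - q s\<bar> \<le> \<kappa>\<^sup>2 + Q" using Q(2)[OF s] zero_le_power2[of \<kappa>] by linarith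
      then show "\<bar>(\<kappa>\<^sup>2 - q s) * (2 * (\<phi> s * u s))\<bar> \<le> (\<kappa>\<^sup>2 + Q) * N s"
        unfolding abs_mult[of "\<kappa>\<^sup>2 - q s"] using Q(1) prod by (intro mult_mono) auto
    qed
    moreover have "L * N s = N s + 2 * K * N s + 2 * D * N s + D * K * N s + (\<kappa>\<^sup>2 + Q) * N s"
      by (simp add: L_def algebra_simps)
    ultimately show ?thesis by linarith
  qed
  have deriv: "(f has_real_derivative f' s) (at s)"
    if f: "\<And>s. s \<ge> 0 \<Longrightarrow> f s - f 0 = integral {0..s} f'" and f': "continuous_on {0..} f'" and s: "0 < s" "s < t"
    for f f' :: "real \<Rightarrow> real" and s
  proof -
    have "((\<lambda>s. f 0 + integral {0..s} f') has_vector_derivative 0 + f' s) (at s within {0..t})"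
      using s by (intro derivative_intros integral_has_vector_derivative cont f') auto
    then have "((\<lambda>s. f 0 + integral {0..s} f') has_real_derivative f' s) (at s within {0..t})"
      by (simp add: has_real_derivative_iff_has_vector_derivative)
    moreover have "at s within {0..t} = at s" using s by (rule at_within_Icc_at)
    ultimately have d: "((\<lambda>s. f 0 + integral {0..s} f') has_real_derivative f' s) (at s)" by simp
    show ?thesis
    proof (rule has_field_derivative_transform_within_open[OF d, of "{0<..}"])
      show "f 0 + integral {0..r} f' = f r" if r: "r \<in> {0<..}" for r
      proof -
        have "f r - f 0 = integral {0..r} f'" by (rule f) (use r in simp)
        then show ?thesis by linarith
      qed
    qed (use s in simp_all)
  qed
  \<comment> \<open>Gronwall backwards in time: from \<open>N' \<ge> - L N\<close> the weighted
    energy increases, so a zero at \<open>t\<close> forces a zero at the start.\<close>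
  have "N 0 * exp (L * 0) \<le> N t * exp (L * t)"
  proof (rule DERIV_nonneg_imp_increasing_open[OF t])
    fix s assume s: "0 < s" "s < t"
    have "((\<lambda>s. N s * exp (L * s)) has_real_derivative (N' s + L * N s) * exp (L * s)) (at s)"
      unfolding N_def
      by (auto intro!: derivative_eq_intros deriv[OF \<phi>_eq \<psi> s] deriv[OF u cu' s]
          simp: N'_def N_def algebra_simps)
    moreover have "(N' s + L * N s) * exp (L * s) \<ge> 0" using bound[of s] s by simp
    ultimately show "\<exists>y. ((\<lambda>s. N s * exp (L * s)) has_real_derivative y) (at s) \<and> 0 \<le> y" by blast
  next
    show "continuous_on {0..t} (\<lambda>s. N s * exp (L * s))"
      unfolding N_def u_def by (intro continuous_intros cont w \<phi> \<psi>)
  qed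
  then have "N 0 \<le> 0" using zero by (simp add: N_def u_def)
  then have "\<phi> 0 = 0" "u 0 = 0" by (auto simp: N_def sum_power2_le_zero_iff)
  then show False using start by (simp add: u_def)
qed

definition y where "y t = \<psi> t + \<zeta> * \<phi> t"

definition R where "R t = \<kappa>d\<^sup>2 * (\<phi> t)\<^sup>2 + (y t)\<^sup>2"

lemma R_pos: "t \<ge> 0 \<Longrightarrow> R t > 0"
proof -
  assume "t \<ge> 0"
  then have "\<phi> t \<noteq> 0 \<or> y t \<noteq> 0" using nonvanishing[of t] by (auto simp: y_def)
  then show ?thesis
    using \<kappa>d_pos by (auto simp: R_def intro: add_pos_nonneg add_nonneg_pos)
qed

text \<open>Arithmetic-geometric mean for \<open>\<kappa>d \<phi>\<close> and \<open>y\<close>; this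
  is the origin of the factor \<open>1 / \<kappa>d\<close> in the bound.\<close>

lemma abs_prod_le_R: "2 * \<bar>y t * \<phi> t\<bar> \<le> R t / \<kappa>d"
proof -
  have "2 * (\<kappa>d * \<bar>\<phi> t\<bar>) * \<bar>y t\<bar> \<le> (\<kappa>d * \<bar>\<phi> t\<bar>)\<^sup>2 + \<bar>y t\<bar>\<^sup>2" by (rule sum_squares_bound)
  then show ?thesis using \<kappa>d_pos by (simp add: R_def field_simps abs_mult)
qed

lemma square_le_R: "(\<phi> t)\<^sup>2 \<le> R t / \<kappa>d\<^sup>2"
  using \<kappa>d_pos by (simp add: R_def field_simps)

lemma continuous_y: "continuous_on {0..} y" and continuous_R: "continuous_on {0..} R"
  unfolding R_def y_def by (intro continuous_intros \<phi> \<psi>)+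

text \<open>The Ito expansion of the relative change of \<open>R\<close>, with
  \<open>(w t - w s)\<^sup>2\<close> left in place of its mean. No quadratic variation has to be
  identified, since only the expectation of these squares matters later.\<close>

definition increment where
  "increment s t = - 2 * \<zeta> * (t - s) + 2 * y s * \<phi> s / R s * q s * (t - s)
    + 2 * y s * \<phi> s / R s * (w t - w s) + (\<phi> s)\<^sup>2 / R s * (w t - w s)\<^sup>2"

text \<open>\<open>R\<close> is quadratic, so its increment is exactly a linear part plus squares.
  Each first-order error is negligible by the equations, the square of the \<phi> increment is
  negligible because \<phi> is differentiable, and only the noise survives in the square of the
  \<open>y\<close> increment.\<close>

lemma negligible_relative_increment:
  assumes T: "T > 0"
  shows "negligible_on T (\<lambda>s t. (R t - R s) / R s - increment s t)"
proof -
  note cont = continuous_on_halflineD[of _ T]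
  let ?\<alpha> = "\<lambda>s. - 2 * \<zeta> * \<psi> s - (\<kappa>\<^sup>2 - q s) * \<phi> s"
  let ?E1 = "\<lambda>s t. \<phi> t - \<phi> s - \<psi> s * (t - s)"
  let ?E2 = "\<lambda>s t. \<psi> t - \<psi> s - ?\<alpha> s * (t - s) - \<phi> s * (w t - w s)"
  have c\<alpha>: "continuous_on {0..} ?\<alpha>" by (intro continuous_intros q w \<phi> \<psi>)
  have E1: "negligible_on T ?E1"
    using negligible_on_primitive[of T \<phi> \<psi> "\<lambda>_. 0"] \<phi>_eq cont[OF \<psi>] by simp
  have E2: "negligible_on T ?E2"
  proof -
    let ?J = "\<lambda>t. \<phi> t * w t - integral {0..t} (\<lambda>s. w s * \<psi> s)"
    have "negligible_on T (\<lambda>s t. \<psi> t - \<psi> s - ?\<alpha> s * (t - s) - ((?J t - ?J 0) - (?J s - ?J 0)))"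
      by (rule negligible_on_primitive[OF _ cont[OF c\<alpha>]]) (simp add: \<psi>_eq)
    moreover have "negligible_on T (\<lambda>s t. ?J t - ?J s - \<phi> s * (w t - w s))"
      by (rule negligible_on_by_parts[OF _ cont[OF \<psi>] cont[OF w]]) (simp add: \<phi>_eq)
    ultimately show ?thesis
      by (rule negligible_on_cong[OF negligible_on_add]) simp
  qed
  let ?\<rho> = "\<lambda>s t. (?\<alpha> s + \<zeta> * \<psi> s) * (t - s)"
  let ?Ey = "\<lambda>s t. y t - y s - \<phi> s * (w t - w s) - ?\<rho> s t"
  have Ey: "negligible_on T ?Ey"
    by (rule negligible_on_cong[OF negligible_on_add[OF E2 negligible_on_cmult[OF E1, of \<zeta>]]])
       (simp add: y_def algebra_simps)
  have v\<phi>: "vanishing_on T (\<lambda>s t. \<phi> t - \<phi> s)" by (rule vanishing_on_continuous[OF cont[OF \<phi>]])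
  have v\<phi>w: "vanishing_on T (\<lambda>s t. \<phi> s * (w t - w s))"
  proof -
    obtain K where "\<And>t. 0 \<le> t \<Longrightarrow> t \<le> T \<Longrightarrow> \<bar>\<phi> t\<bar> \<le> K"
      using continuous_on_abs_bounded[OF cont[OF \<phi>]] by blast
    then show ?thesis
      by (intro vanishing_on_bounded_mult[where K = K] vanishing_on_continuous cont w) auto
  qed
  have vy: "vanishing_on T (\<lambda>s t. y t - y s)" by (rule vanishing_on_continuous[OF cont[OF continuous_y]])
  have sq\<phi>: "negligible_on T (\<lambda>s t. (\<phi> t - \<phi> s)\<^sup>2)"
  proof (rule negligible_on_cong)
    show "negligible_on T (\<lambda>s t. (\<phi> t - \<phi> s) * ?E1 s t + (\<phi> t - \<phi> s) * (\<psi> s * (t - s)))"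
      by (intro negligible_on_add negligible_on_vanishing_mult[OF v\<phi> E1]
          negligible_on_vanishing_linear[OF v\<phi>] cont \<psi>)
  qed (simp add: power2_eq_square algebra_simps)
  \<comment> \<open>A difference of squares: the sum of the two increments merely vanishes, but in
    their difference the noise cancels, leaving order \<open>t - s\<close>. Hence no Hoelder
    exponent of \<open>w\<close> enters.\<close>
  have sqy: "negligible_on T (\<lambda>s t. (y t - y s)\<^sup>2 - (\<phi> s)\<^sup>2 * (w t - w s)\<^sup>2)"
  proof (rule negligible_on_cong)
    let ?V = "\<lambda>s t. (y t - y s) + \<phi> s * (w t - w s)"
    have v: "vanishing_on T ?V" by (rule vanishing_on_add[OF vy v\<phi>w])
    show "negligible_on T (\<lambda>s t. ?V s t * ?Ey s t + ?V s t * ?\<rho> s t)"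
      by (intro negligible_on_add negligible_on_vanishing_mult[OF v Ey]
          negligible_on_vanishing_linear[OF v] continuous_on_add
          continuous_on_mult continuous_on_const cont \<psi> c\<alpha>)
  qed (simp add: power2_eq_square algebra_simps)
  obtain K\<phi> where K\<phi>: "\<And>t. 0 \<le> t \<Longrightarrow> t \<le> T \<Longrightarrow> \<bar>2 * \<kappa>d\<^sup>2 * \<phi> t\<bar> \<le> K\<phi>"
    by (rule continuous_on_abs_bounded[of 0 T "\<lambda>t. 2 * \<kappa>d\<^sup>2 * \<phi> t"]) (intro continuous_intros cont \<phi>, blast)
  obtain Ky where Ky: "\<And>t. 0 \<le> t \<Longrightarrow> t \<le> T \<Longrightarrow> \<bar>2 * y t\<bar> \<le> Ky"
    by (rule continuous_on_abs_bounded[of 0 T "\<lambda>t. 2 * y t"]) (intro continuous_intros cont continuous_y, blast)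
  \<comment> \<open>Nonvanishing makes \<open>R\<close> positive on the compact interval, so
    \<open>1 / R\<close> is continuous and bounded there.\<close>
  have cR: "continuous_on {0..T} (\<lambda>s. 1 / R s)"
  proof -
    have "R s \<noteq> 0" if "s \<in> {0..T}" for s using R_pos[of s] that by auto
    then show ?thesis by (intro continuous_intros cont continuous_R) blast
  qed
  obtain KR where KR: "\<And>t. 0 \<le> t \<Longrightarrow> t \<le> T \<Longrightarrow> \<bar>1 / R t\<bar> \<le> KR"
    by (rule continuous_on_abs_bounded[OF cR]) blast
  let ?S = "\<lambda>s t. 2 * \<kappa>d\<^sup>2 * \<phi> s * ?E1 s t + 2 * y s * ?Ey s t + \<kappa>d\<^sup>2 * (\<phi> t - \<phi> s)\<^sup>2
      + ((y t - y s)\<^sup>2 - (\<phi> s)\<^sup>2 * (w t - w s)\<^sup>2)"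
  have S: "negligible_on T ?S"
    by (intro negligible_on_add negligible_on_cmult sq\<phi> sqy
        negligible_on_bounded_mult[OF E1, where K = K\<phi>] negligible_on_bounded_mult[OF Ey, where K = Ky])
       (use K\<phi> Ky in auto)
  have "negligible_on T (\<lambda>s t. 1 / R s * ?S s t)"
    by (rule negligible_on_bounded_mult[OF S, where K = KR]) (use KR in auto)
  then show ?thesis
  proof (rule negligible_on_cong)
    fix s t :: real assume "0 \<le> s"
    then have Rs: "R s > 0" by (rule R_pos)
    have \<kappa>: "\<kappa>\<^sup>2 = \<kappa>d\<^sup>2 + \<zeta>\<^sup>2" using \<kappa>d_square by simp
    \<comment> \<open>Here \<open>\<kappa>\<^sup>2 = \<kappa>d\<^sup>2 + \<zeta>\<^sup>2\<close>
      removes the mixed term and leaves the pure decay \<open>- 2 * \<zeta> * R s\<close>.\<close>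
    have drift: "2 * \<kappa>d\<^sup>2 * \<phi> s * \<psi> s + 2 * y s * (?\<alpha> s + \<zeta> * \<psi> s) = - 2 * \<zeta> * R s + 2 * y s * \<phi> s * q s"
      unfolding R_def y_def \<kappa> by (simp add: power2_eq_square algebra_simps)
    have "?S s t = (R t - R s) - (2 * \<kappa>d\<^sup>2 * \<phi> s * \<psi> s + 2 * y s * (?\<alpha> s + \<zeta> * \<psi> s)) * (t - s)
        - 2 * y s * \<phi> s * (w t - w s) - (\<phi> s)\<^sup>2 * (w t - w s)\<^sup>2"
      unfolding R_def by (simp add: power2_eq_square algebra_simps)
    moreover have "R s * increment s t = (- 2 * \<zeta> * R s + 2 * y s * \<phi> s * q s) * (t - s)
        + 2 * y s * \<phi> s * (w t - w s) + (\<phi> s)\<^sup>2 * (w t - w s)\<^sup>2"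
      using Rs by (simp add: increment_def distrib_left distrib_right left_diff_distrib right_diff_distrib)
    ultimately have "?S s t = (R t - R s) - R s * increment s t" unfolding drift by linarith
    then show "1 / R s * ?S s t = (R t - R s) / R s - increment s t"
      using Rs by (simp add: diff_divide_distrib)
  qed
qed

text \<open>The terms with \<open>q\<close> and with squared noise are replaced by absolute bounds.
  The linear noise term is kept exact, because it is small only through cancellation in the
  mean.\<close>

lemma log_growth_le:
  assumes T: "T > 0" and \<epsilon>: "\<epsilon> > 0"
  shows "\<forall>\<^sub>F n in sequentially. ln (R T) - ln (R 0) \<le> - 2 * \<zeta> * T
    + (\<Sum>i<n. \<bar>q (grid T n i)\<bar> * (T / n)) / \<kappa>d
    + (\<Sum>i<n. 2 * y (grid T n i) * \<phi> (grid T n i) / R (grid T n i) * (w (grid T n (Suc i)) - w (grid T n i)))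
    + (\<Sum>i<n. (w (grid T n (Suc i)) - w (grid T n i))\<^sup>2) / \<kappa>d\<^sup>2 + \<epsilon>"
  using order_tendstoD(2)[OF negligible_on_riemann_sum[OF negligible_relative_increment[OF T] T] \<epsilon>]
    eventually_gt_at_top[of 0]
proof eventually_elim
  case (elim n)
  let ?g = "grid T n"
  have g0: "?g i \<ge> 0" for i using T by (simp add: grid_nonneg)
  have "ln (R T) - ln (R 0) = (\<Sum>i<n. ln (R (?g (Suc i))) - ln (R (?g i)))"
    using sum_grid_telescope[OF elim(2), of "\<lambda>t. ln (R t)" T] by simp
  \<comment> \<open>One-sided use of concavity: what is dropped is the negative second-order term
    that an Ito expansion of the logarithm would carry.\<close>
  also have "\<dots> \<le> (\<Sum>i<n. (R (?g (Suc i)) - R (?g i)) / R (?g i))"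
  proof (rule sum_mono)
    fix i
    have p: "R (?g (Suc i)) > 0" "R (?g i) > 0" using R_pos g0 by auto
    then have "ln (R (?g (Suc i))) - ln (R (?g i)) = ln (R (?g (Suc i)) / R (?g i))" by (simp add: ln_div)
    also have "\<dots> \<le> R (?g (Suc i)) / R (?g i) - 1" using p by (intro ln_le_minus_one) simp
    also have "\<dots> = (R (?g (Suc i)) - R (?g i)) / R (?g i)" using p by (simp add: diff_divide_distrib)
    finally show "ln (R (?g (Suc i))) - ln (R (?g i)) \<le> (R (?g (Suc i)) - R (?g i)) / R (?g i)" .
  qed
  also have "\<dots> \<le> (\<Sum>i<n. increment (?g i) (?g (Suc i))) + \<epsilon>"
    using elim(1) by (simp add: sum_subtractf)
  also have "(\<Sum>i<n. increment (?g i) (?g (Suc i))) \<le> (\<Sum>i<n. - 2 * \<zeta> * (T / n) + \<bar>q (?g i)\<bar> * (T / n) / \<kappa>d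
      + 2 * y (?g i) * \<phi> (?g i) / R (?g i) * (w (?g (Suc i)) - w (?g i)) + (w (?g (Suc i)) - w (?g i))\<^sup>2 / \<kappa>d\<^sup>2)"
  proof (rule sum_mono)
    fix i
    have p: "R (?g i) > 0" using R_pos g0 by auto
    have "\<bar>2 * y (?g i) * \<phi> (?g i) / R (?g i)\<bar> \<le> 1 / \<kappa>d"
      using abs_prod_le_R[of "?g i"] p \<kappa>d_pos by (simp add: abs_mult field_simps)
    then have "\<bar>2 * y (?g i) * \<phi> (?g i) / R (?g i)\<bar> * \<bar>q (?g i)\<bar> \<le> 1 / \<kappa>d * \<bar>q (?g i)\<bar>"
      by (rule mult_right_mono) simp
    then have a1: "2 * y (?g i) * \<phi> (?g i) / R (?g i) * q (?g i) \<le> \<bar>q (?g i)\<bar> / \<kappa>d"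
      using abs_ge_self[of "2 * y (?g i) * \<phi> (?g i) / R (?g i) * q (?g i)"] by (simp add: abs_mult)
    have 1: "2 * y (?g i) * \<phi> (?g i) / R (?g i) * q (?g i) * (T / n) \<le> \<bar>q (?g i)\<bar> * (T / n) / \<kappa>d"
      using mult_right_mono[OF a1, of "T / n"] T by (simp add: mult.commute)
    have a2: "(\<phi> (?g i))\<^sup>2 / R (?g i) \<le> 1 / \<kappa>d\<^sup>2"
      using square_le_R[of "?g i"] p \<kappa>d_pos by (simp add: field_simps)
    have 2: "(\<phi> (?g i))\<^sup>2 / R (?g i) * (w (?g (Suc i)) - w (?g i))\<^sup>2 \<le> (w (?g (Suc i)) - w (?g i))\<^sup>2 / \<kappa>d\<^sup>2"
      using mult_right_mono[OF a2 zero_le_power2[of "w (?g (Suc i)) - w (?g i)"]] by simp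
    show "increment (?g i) (?g (Suc i)) \<le> - 2 * \<zeta> * (T / n) + \<bar>q (?g i)\<bar> * (T / n) / \<kappa>d
      + 2 * y (?g i) * \<phi> (?g i) / R (?g i) * (w (?g (Suc i)) - w (?g i)) + (w (?g (Suc i)) - w (?g i))\<^sup>2 / \<kappa>d\<^sup>2"
      unfolding increment_def grid_step using 1 2 by linarith
  qed
  also have "\<dots> = - 2 * \<zeta> * T + (\<Sum>i<n. \<bar>q (?g i)\<bar> * (T / n)) / \<kappa>d
    + (\<Sum>i<n. 2 * y (?g i) * \<phi> (?g i) / R (?g i) * (w (?g (Suc i)) - w (?g i)))
    + (\<Sum>i<n. (w (?g (Suc i)) - w (?g i))\<^sup>2) / \<kappa>d\<^sup>2"
    using elim(2) by (simp add: sum.distrib sum_subtractf sum_divide_distrib)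
  finally show ?case by simp
qed

end

section \<open>The linear observation of the driving process\<close>

lemma inner_matrix_vector_axis:
  fixes M :: "real^'n^'m"
  shows "a \<bullet> (M *v x) = (\<Sum>i\<in>UNIV. (a \<bullet> (M *v axis i 1)) * x $ i)"
proof -
  have "M *v x = M *v (\<Sum>i\<in>UNIV. x $ i *\<^sub>R axis i 1)"
    by (simp add: basis_expansion flip: scalar_mult_eq_scaleR)
  also have "\<dots> = (\<Sum>i\<in>UNIV. x $ i *\<^sub>R (M *v axis i 1))"
    by (simp add: linear_sum[OF matrix_vector_mul_linear] matrix_vector_mult_scaleR o_def)
  finally show ?thesis by (simp add: inner_sum_right mult.commute)
qed

lemma inner_vec_lambda: "(\<chi> l. h l) \<bullet> x = (\<Sum>l\<in>UNIV. h l * x $ l)" for x :: "real^'n"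
  by (simp add: inner_vec_def)

lemma integral_reflected:
  fixes f :: "real \<Rightarrow> real"
  shows "integral {0..t} (\<lambda>s. f (t - s)) = integral {0..t} f"
proof -
  have "integral {0..t} ((\<lambda>u. f (- u)) \<circ> (+) (- t)) = integral {0 + - t..t + - t} (\<lambda>u. f (- u))"
    by (rule integral_shift_Icc_real)
  also have "\<dots> = integral {0..t} f"
    using Henstock_Kurzweil_Integration.integral_reflect_real[of t 0 f] by simp
  finally show ?thesis by (simp add: o_def)
qed

text \<open>Variation of constants in discrete form: along
  \<open>s \<mapsto> a \<bullet> (e^{(t - s)A} v s)\<close> the drift cancels and the noise
  increment meets a deterministic kernel. The ends of this function are the two terms of the
  limit.\<close>

lemma linear_observation_riemann:
  fixes A :: "real^'d^'d" and B :: "real^'m^'d" and v :: "real \<Rightarrow> real^'d" and W :: "real \<Rightarrow> real^'m"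
  assumes v: "continuous_on {0..} v" and W: "continuous_on {0..} W" and t: "t > 0"
    and eq: "\<And>s i. s \<ge> 0 \<Longrightarrow> v s $ i - v 0 $ i = integral {0..s} (\<lambda>r. (A *v v r) $ i) + (B *v (W s - W 0)) $ i"
  shows "(\<lambda>n. \<Sum>k<n. (\<chi> l. a \<bullet> (matrix_exp ((t - grid t n k) *\<^sub>R A) *v column l B))
      \<bullet> (W (grid t n (Suc k)) - W (grid t n k)))
    \<longlonglongrightarrow> a \<bullet> v t - a \<bullet> (matrix_exp (t *\<^sub>R A) *v v 0)"
proof -
  let ?E = "\<lambda>s. matrix_exp ((t - s) *\<^sub>R A)"
  \<comment> \<open>Coordinates of the row vector \<open>a^T e^{(t - s)A}\<close>, so that scalar
    product rules apply.\<close>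
  define P where "P i s = a \<bullet> (?E s *v axis i 1)" for i s
  define P' where "P' i s = - (a \<bullet> (?E s *v (A *v axis i 1)))" for i s
  have DP: "(P i has_real_derivative P' i s) (at s)" for i s
  proof -
    have "((\<lambda>s. a \<bullet> (?E s *v axis i 1)) has_real_derivative
        a \<bullet> (?E s *v (A *v axis i 1)) * (0 - 1)) (at s)"
      by (rule DERIV_chain2[OF DERIV_inner_matrix_exp]) (auto intro!: derivative_eq_intros)
    then show ?thesis unfolding P_def[abs_def] P'_def by simp
  qed
  have cP: "continuous_on S (P i)" for S i
    by (intro continuous_at_imp_continuous_on ballI DERIV_isCont[OF DP])
  have cP': "continuous_on S (P' i)" for S i
    unfolding P'_def[abs_def]
    by (intro continuous_intros continuous_on_compose2[OF continuous_on_inner_matrix_exp[of UNIV]]) auto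
  have vi: "continuous_on {0..t} (\<lambda>s. v s $ i)" for i
    by (rule continuous_on_halflineD[OF continuous_on_component[OF v]])
  have Avi: "continuous_on {0..t} (\<lambda>s. (A *v v s) $ i)" for i
    by (rule continuous_on_halflineD[OF continuous_on_component[OF
        bounded_linear.continuous_on[OF matrix_vector_mul_bounded_linear v]]])
  have EP: "negligible_on t (\<lambda>s r. P i r - P i s - P' i s * (r - s))" for i
  proof -
    have "P i r - P i 0 = integral {0..r} (P' i) + 0" if "0 \<le> r" for r
    proof -
      have "(P' i has_integral P i r - P i 0) {0..r}"
        by (rule fundamental_theorem_of_calculus[OF that])
          (rule has_vector_derivative_at_within[OF
            DP[unfolded has_real_derivative_iff_has_vector_derivative]])
      then show ?thesis by (simp add: integral_unique)
    qed
    from negligible_on_primitive[of t "P i" "P' i" "\<lambda>_. 0", OF this cP'] show ?thesis by simp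
  qed
  have EV: "negligible_on t (\<lambda>s r. v r $ i - v s $ i - (A *v v s) $ i * (r - s) - (B *v (W r - W s)) $ i)" for i
  proof -
    have "negligible_on t (\<lambda>s r. v r $ i - v s $ i - (A *v v s) $ i * (r - s)
        - ((B *v (W r - W 0)) $ i - (B *v (W s - W 0)) $ i))"
      by (rule negligible_on_primitive[OF eq Avi])
    then show ?thesis by (simp add: matrix_vector_mult_diff_distrib)
  qed
  have N: "negligible_on t (\<lambda>s r. P i r * v r $ i - P i s * v s $ i
      - (P i s * ((A *v v s) $ i * (r - s) + (B *v (W r - W s)) $ i) + v s $ i * (P' i s * (r - s))))" for i
  proof (rule negligible_on_cong)
    obtain KP where KP: "\<And>s. 0 \<le> s \<Longrightarrow> s \<le> t \<Longrightarrow> \<bar>P i s\<bar> \<le> KP"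
      by (rule continuous_on_abs_bounded[OF cP]) blast
    obtain Kv where Kv: "\<And>s. 0 \<le> s \<Longrightarrow> s \<le> t \<Longrightarrow> \<bar>v s $ i\<bar> \<le> Kv"
      by (rule continuous_on_abs_bounded[OF vi]) blast
    have vv: "vanishing_on t (\<lambda>s r. v r $ i - v s $ i)" by (rule vanishing_on_continuous[OF vi])
    \<comment> \<open>Discrete product rule: besides the two first-order errors there is the product
      of both increments, small since \<open>v\<close> is continuous and \<open>P\<close> is
      differentiable.\<close>
    show "negligible_on t (\<lambda>s r. P i s * (v r $ i - v s $ i - (A *v v s) $ i * (r - s) - (B *v (W r - W s)) $ i)
        + v s $ i * (P i r - P i s - P' i s * (r - s))
        + (v r $ i - v s $ i) * (P i r - P i s - P' i s * (r - s))
        + (v r $ i - v s $ i) * (P' i s * (r - s)))"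
      by (intro negligible_on_add negligible_on_vanishing_mult[OF vv EP]
          negligible_on_vanishing_linear[OF vv] cP'
          negligible_on_bounded_mult[OF EV, where K = KP] negligible_on_bounded_mult[OF EP, where K = Kv])
        (use KP Kv in auto)
  qed (simp add: algebra_simps)
  define f where "f s = a \<bullet> (?E s *v v s)" for s
  have f: "f s = (\<Sum>i\<in>UNIV. P i s * v s $ i)" for s
    unfolding f_def P_def by (rule inner_matrix_vector_axis)
  \<comment> \<open>\<open>A\<close> commutes past the exponential into the derivative of the
    kernel, with opposite sign.\<close>
  have cancel: "(\<Sum>i\<in>UNIV. P i s * (A *v v s) $ i) = - (\<Sum>i\<in>UNIV. v s $ i * P' i s)" for s
  proof -
    have "(\<Sum>i\<in>UNIV. P i s * (A *v v s) $ i) = a \<bullet> ((?E s ** A) *v v s)"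
      unfolding P_def matrix_vector_mul_assoc[symmetric] by (rule inner_matrix_vector_axis[symmetric])
    also have "\<dots> = - (\<Sum>i\<in>UNIV. v s $ i * P' i s)"
      by (rule trans[OF inner_matrix_vector_axis])
        (simp add: P'_def matrix_vector_mul_assoc sum_negf mult.commute)
    finally show ?thesis .
  qed
  have noise: "(\<Sum>i\<in>UNIV. P i s * (B *v x) $ i) = (\<chi> l. a \<bullet> (?E s *v column l B)) \<bullet> x" for s x
  proof -
    have "(\<Sum>i\<in>UNIV. P i s * (B *v x) $ i) = a \<bullet> ((?E s ** B) *v x)"
      unfolding P_def matrix_vector_mul_assoc[symmetric] by (rule inner_matrix_vector_axis[symmetric])
    also have "\<dots> = (\<chi> l. a \<bullet> (?E s *v column l B)) \<bullet> x"
      by (rule trans[OF inner_matrix_vector_axis])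
        (simp only: matrix_vector_mul_assoc[symmetric] inner_vec_lambda, simp only: matrix_vector_mult_basis)
    finally show ?thesis .
  qed
  have "negligible_on t (\<lambda>s r. f r - f s - (\<chi> l. a \<bullet> (?E s *v column l B)) \<bullet> (W r - W s))"
  proof (rule negligible_on_cong[OF negligible_on_sum[OF N]])
    fix s r
    have "(\<Sum>i\<in>UNIV. P i r * v r $ i - P i s * v s $ i
        - (P i s * ((A *v v s) $ i * (r - s) + (B *v (W r - W s)) $ i) + v s $ i * (P' i s * (r - s))))
      = f r - f s - ((\<Sum>i\<in>UNIV. P i s * (A *v v s) $ i) * (r - s) + (\<Sum>i\<in>UNIV. P i s * (B *v (W r - W s)) $ i)
        + (\<Sum>i\<in>UNIV. v s $ i * P' i s) * (r - s))"
      by (simp add: f sum_subtractf sum.distrib sum_distrib_right distrib_left mult.assoc)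
    also have "\<dots> = f r - f s - (\<chi> l. a \<bullet> (?E s *v column l B)) \<bullet> (W r - W s)"
      unfolding cancel noise by simp
    finally show "(\<Sum>i\<in>UNIV. P i r * v r $ i - P i s * v s $ i
        - (P i s * ((A *v v s) $ i * (r - s) + (B *v (W r - W s)) $ i) + v s $ i * (P' i s * (r - s))))
      = f r - f s - (\<chi> l. a \<bullet> (?E s *v column l B)) \<bullet> (W r - W s)" .
  qed
  from riemann_sum_tendsto[OF this t] show ?thesis
    using matrix_exp_0[of A] by (simp add: f_def)
qed

context brownian_setting
begin

text \<open>The discrete sums tend to \<open>g\<close> almost surely and their second moments are
  Riemann sums of the noise intensity, so Fatou bounds the variance without convergence in mean
  square. Subtracting the transient spares any moment condition on \<open>v 0\<close>.\<close>

lemma linear_observation_variance: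
  fixes A :: "real^'d^'d" and B :: "real^'m^'d" and a :: "real^'d" and v :: "real \<Rightarrow> 'w \<Rightarrow> real^'d"
  assumes stable: "\<And>\<mu>. complex_eigenvalue A \<mu> \<Longrightarrow> Re \<mu> < 0"
    and vm: "\<And>t. t \<ge> 0 \<Longrightarrow> v t \<in> borel_measurable M"
    and vc: "\<And>\<omega>. \<omega> \<in> space M \<Longrightarrow> continuous_on {0..} (\<lambda>t. v t \<omega>)"
    and eq: "AE \<omega> in M. \<forall>t\<ge>0. \<forall>i. v t \<omega> $ i - v 0 \<omega> $ i
      = integral {0..t} (\<lambda>s. (A *v v s \<omega>) $ i) + (B *v (W t \<omega> - W 0 \<omega>)) $ i"
    and t: "t \<ge> 0"
  defines "g \<equiv> \<lambda>\<omega>. a \<bullet> v t \<omega> - a \<bullet> (matrix_exp (t *\<^sub>R A) *v v 0 \<omega>)"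
  shows "integrable M (\<lambda>\<omega>. (g \<omega>)\<^sup>2)"
    "expectation (\<lambda>\<omega>. (g \<omega>)\<^sup>2) \<le> a \<bullet> (stationary_covariance A B *v a)"
proof -
  let ?\<sigma>2 = "a \<bullet> (stationary_covariance A B *v a)"
  have \<sigma>0: "?\<sigma>2 \<ge> 0"
    using integral_noise_intensity_le[of A 0 B a, OF stable] by simp
  have gm [measurable]: "g \<in> borel_measurable M"
  proof -
    have "(\<lambda>\<omega>. matrix_exp (t *\<^sub>R A) *v v 0 \<omega>) \<in> borel_measurable M"
      by (rule borel_measurable_continuous_on[OF _ vm])
        (auto intro: linear_continuous_on matrix_vector_mul_bounded_linear)
    then show ?thesis unfolding g_def using vm[OF t] by simp
  qed
  have "(\<integral>\<^sup>+\<omega>. ennreal ((g \<omega>)\<^sup>2) \<partial>M) \<le> ennreal ?\<sigma>2"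
  proof (cases "t = 0")
    case True
    then have "g = (\<lambda>\<omega>. 0)" using matrix_exp_0[of A] by (auto simp: g_def)
    then show ?thesis by simp
  next
    case False
    then have t: "t > 0" using t by simp
    define c where "c n k = (\<chi> l. a \<bullet> (matrix_exp ((t - grid t n k) *\<^sub>R A) *v column l B))" for n k
    define S where "S n \<omega> = (\<Sum>k<n. 1 * (c n k \<bullet> (W (grid t n (Suc k)) \<omega> - W (grid t n k) \<omega>)))" for n \<omega>
    have iso: "integrable M (\<lambda>\<omega>. (S n \<omega>)\<^sup>2)"
      "expectation (\<lambda>\<omega>. (S n \<omega>)\<^sup>2) = (\<Sum>k<n. noise_intensity A B a (t - grid t n k) * (t / n))" for n
    proof -
      have mono: "0 \<le> grid t n k \<and> grid t n k \<le> grid t n (Suc k)" for k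
        using t by (simp add: grid_nonneg grid_mono)
      have cn: "(norm (c n k))\<^sup>2 = noise_intensity A B a (t - grid t n k)" for k
        unfolding power2_norm_eq_inner by (simp add: inner_vec_def c_def noise_intensity_def power2_eq_square)
      note iso = discrete_isometry[of n "grid t n" "\<lambda>_ _. 1" "c n", OF mono, folded S_def]
      show "integrable M (\<lambda>\<omega>. (S n \<omega>)\<^sup>2)" by (rule iso(1)) auto
      have "expectation (\<lambda>\<omega>. (S n \<omega>)\<^sup>2)
          = (\<Sum>k<n. expectation (\<lambda>\<omega>. 1\<^sup>2) * (norm (c n k))\<^sup>2 * (grid t n (Suc k) - grid t n k))"
        by (rule iso(2)) auto
      then show "expectation (\<lambda>\<omega>. (S n \<omega>)\<^sup>2) = (\<Sum>k<n. noise_intensity A B a (t - grid t n k) * (t / n))"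
        by (simp add: cn grid_step prob_space)
    qed
    have lim: "AE \<omega> in M. (\<lambda>n. S n \<omega>) \<longlonglongrightarrow> g \<omega>"
      using eq AE_space
    proof eventually_elim
      case (elim \<omega>)
      have "(\<lambda>n. \<Sum>k<n. (\<chi> l. a \<bullet> (matrix_exp ((t - grid t n k) *\<^sub>R A) *v column l B))
          \<bullet> (W (grid t n (Suc k)) \<omega> - W (grid t n k) \<omega>)) \<longlonglongrightarrow> g \<omega>"
        unfolding g_def
      proof (rule linear_observation_riemann[OF vc[OF elim(2)] W_continuous[OF elim(2)] t])
        show "v s \<omega> $ i - v 0 \<omega> $ i = integral {0..s} (\<lambda>r. (A *v v r \<omega>) $ i) + (B *v (W s \<omega> - W 0 \<omega>)) $ i"
          if "s \<ge> 0" for s i using elim(1) that by blast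
      qed
      then show ?case by (simp add: S_def c_def)
    qed
    have Sm [measurable]: "(\<lambda>\<omega>. ennreal ((S n \<omega>)\<^sup>2)) \<in> borel_measurable M" for n
      using borel_measurable_integrable[OF iso(1)[of n]] by simp
    have "(\<integral>\<^sup>+\<omega>. ennreal ((g \<omega>)\<^sup>2) \<partial>M) = (\<integral>\<^sup>+\<omega>. liminf (\<lambda>n. ennreal ((S n \<omega>)\<^sup>2)) \<partial>M)"
    proof (rule nn_integral_cong_AE)
      show "AE \<omega> in M. ennreal ((g \<omega>)\<^sup>2) = liminf (\<lambda>n. ennreal ((S n \<omega>)\<^sup>2))"
        using lim
      proof eventually_elim
        case (elim \<omega>)
        have "(\<lambda>n. ennreal ((S n \<omega>)\<^sup>2)) \<longlonglongrightarrow> ennreal ((g \<omega>)\<^sup>2)"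
          by (intro tendsto_ennrealI tendsto_power elim)
        then show ?case by (rule lim_imp_Liminf[OF sequentially_bot, symmetric])
      qed
    qed
    also have "\<dots> \<le> liminf (\<lambda>n. \<integral>\<^sup>+\<omega>. ennreal ((S n \<omega>)\<^sup>2) \<partial>M)"
      by (rule nn_integral_liminf) (rule Sm)
    also have "\<dots> = liminf (\<lambda>n. ennreal (\<Sum>k<n. noise_intensity A B a (t - grid t n k) * (t / n)))"
      by (simp add: nn_integral_eq_integral iso)
    also have "\<dots> = ennreal (integral {0..t} (\<lambda>s. noise_intensity A B a (t - s)))"
    proof -
      have "continuous_on {0..t} (\<lambda>s. noise_intensity A B a (t - s))"
        by (intro continuous_on_compose2[OF continuous_on_noise_intensity[of UNIV]])
          (auto intro!: continuous_intros)
      from tendsto_ennrealI[OF riemann_sum_tendsto_integral[OF this t]]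
      show ?thesis by (rule lim_imp_Liminf[OF sequentially_bot])
    qed
    also have "\<dots> = ennreal (integral {0..t} (noise_intensity A B a))"
      by (simp only: integral_reflected)
    also have "\<dots> \<le> ennreal ?\<sigma>2"
      by (intro ennreal_leI integral_noise_intensity_le[OF stable])
    finally show ?thesis .
  qed
  note le = this
  show int: "integrable M (\<lambda>\<omega>. (g \<omega>)\<^sup>2)"
    by (rule integrableI_bounded) (use le in \<open>auto intro: le_less_trans\<close>)
  show "expectation (\<lambda>\<omega>. (g \<omega>)\<^sup>2) \<le> ?\<sigma>2"
    using le \<sigma>0 by (simp add: nn_integral_eq_integral[OF int] ennreal_le_iff)
qed

end

section \<open>The bound on the Lyapunov exponent\<close>

text \<open>Arithmetic-geometric mean with a free scale. Choosing \<open>r\<close> after taking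
  expectations recovers Cauchy-Schwarz.\<close>

lemma abs_le_scaled_square:
  fixes x r :: real
  assumes "r > 0"
  shows "\<bar>x\<bar> \<le> (x\<^sup>2 / r + r) / 2"
proof -
  have "2 * \<bar>x\<bar> * r \<le> x\<^sup>2 + r\<^sup>2" using sum_squares_bound[of "\<bar>x\<bar>" r] by simp
  then show ?thesis using assms by (simp add: field_simps power2_eq_square)
qed

text \<open>Keeps the effect of the initial value below a constant independent of \<open>T\<close>.
  The extra 1 makes the inequality for the integral strict, hence inherited by late Riemann
  sums.\<close>

lemma riemann_sum_exp_decay:
  assumes "C \<ge> 0" "c > 0" "T > 0"
  shows "\<forall>\<^sub>F n in sequentially. (\<Sum>i<n. C * exp (- c * grid T n i) * (T / n)) \<le> C / c + 1"
proof -
  have cont: "continuous_on {0..T} (\<lambda>s. C * exp (- c * s))" by (intro continuous_intros)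
  have "((\<lambda>s. C * exp (- c * s)) has_integral - C / c * exp (- c * T) - (- C / c * exp (- c * 0))) {0..T}"
    using assms by (intro fundamental_theorem_of_calculus)
      (auto intro!: derivative_eq_intros simp flip: has_real_derivative_iff_has_vector_derivative)
  then have "integral {0..T} (\<lambda>s. C * exp (- c * s)) = - C / c * exp (- c * T) - (- C / c * exp (- c * 0))"
    by (rule integral_unique)
  moreover have "0 \<le> C / c * exp (- c * T)" using assms by simp
  ultimately have "integral {0..T} (\<lambda>s. C * exp (- c * s)) < C / c + 1" by simp
  from order_tendstoD(2)[OF riemann_sum_tendsto_integral[OF cont assms(3)] this]
  show ?thesis by eventually_elim simp
qed

context brownian_setting
begin

section \<open>Growth of the oscillator in the mean\<close>

context
  fixes A :: "real^'d^'d" and B :: "real^'m^'d" and a :: "real^'d" and \<gamma> :: "real^'m"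
    and X :: "real \<Rightarrow> 'w \<Rightarrow> (real^'d) \<times> real \<times> real" and \<kappa> \<zeta>2 \<kappa>d :: real
  assumes stable: "\<And>\<mu>. complex_eigenvalue A \<mu> \<Longrightarrow> Re \<mu> < 0"
    and sol: "solves_sde M F W (oscillator_drift A a \<kappa> \<zeta>2) (oscillator_diffusion B \<gamma>) X"
    and start: "AE \<omega> in M. snd (X 0 \<omega>) \<noteq> (0, 0)"
    and \<zeta>2_nonneg: "\<zeta>2 \<ge> 0" and \<kappa>d_pos: "\<kappa>d > 0" and \<kappa>d_square: "\<kappa>d\<^sup>2 = \<kappa>\<^sup>2 - \<zeta>2\<^sup>2"
begin

definition v where "v t \<omega> = fst (X t \<omega>)"
definition \<phi> where "\<phi> t \<omega> = fst (snd (X t \<omega>))"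
definition \<psi> where "\<psi> t \<omega> = snd (snd (X t \<omega>))"
definition y where "y t \<omega> = \<psi> t \<omega> + \<zeta>2 * \<phi> t \<omega>"
definition R where "R t \<omega> = \<kappa>d\<^sup>2 * (\<phi> t \<omega>)\<^sup>2 + (y t \<omega>)\<^sup>2"
definition g where "g t \<omega> = a \<bullet> v t \<omega> - a \<bullet> (matrix_exp (t *\<^sub>R A) *v v 0 \<omega>)"

lemma X_continuous: "\<omega> \<in> space M \<Longrightarrow> continuous_on {0..} (\<lambda>t. X t \<omega>)"
  using sol by (simp add: solves_sde_def)

lemma X_adapted: "t \<ge> 0 \<Longrightarrow> X t \<in> borel_measurable (F t)"
  using sol by (simp add: solves_sde_def)

lemma components_continuous:
  assumes "\<omega> \<in> space M"
  shows "continuous_on {0..} (\<lambda>t. v t \<omega>)" "continuous_on {0..} (\<lambda>t. \<phi> t \<omega>)" "continuous_on {0..} (\<lambda>t. \<psi> t \<omega>)"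
  unfolding v_def \<phi>_def \<psi>_def using X_continuous[OF assms] by (auto intro!: continuous_intros)

lemma components_measurable:
  assumes X: "X t \<in> borel_measurable N"
  shows "v t \<in> borel_measurable N" "\<phi> t \<in> borel_measurable N" "\<psi> t \<in> borel_measurable N"
  unfolding v_def[abs_def] \<phi>_def[abs_def] \<psi>_def[abs_def]
  by (rule borel_measurable_continuous_on[OF _ X], intro continuous_intros)+

lemma X_measurable: "t \<ge> 0 \<Longrightarrow> X t \<in> borel_measurable M"
  by (rule measurable_F_imp_M[OF X_adapted])

lemma AE_v_equation:
  "AE \<omega> in M. \<forall>t\<ge>0. \<forall>i. v t \<omega> $ i - v 0 \<omega> $ i
    = integral {0..t} (\<lambda>s. (A *v v s \<omega>) $ i) + (B *v (W t \<omega> - W 0 \<omega>)) $ i"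
  using oscillator_pathwise[OF sol] unfolding v_def by eventually_elim blast

lemma AE_oscillator_path:
  "AE \<omega> in M. oscillator_path \<kappa> \<zeta>2 \<kappa>d (\<lambda>t. a \<bullet> v t \<omega>) (\<lambda>t. \<gamma> \<bullet> W t \<omega>) (\<lambda>t. \<phi> t \<omega>) (\<lambda>t. \<psi> t \<omega>)"
  using oscillator_pathwise[OF sol] start AE_space
proof eventually_elim
  case (elim \<omega>)
  note eqs = elim(1)[folded v_def \<phi>_def \<psi>_def]
  show ?case
  proof
    show "(\<phi> 0 \<omega>, \<psi> 0 \<omega>) \<noteq> (0, 0)" using elim(2) by (simp add: \<phi>_def \<psi>_def prod_eq_iff)
    show "continuous_on {0..} (\<lambda>t. a \<bullet> v t \<omega>)" "continuous_on {0..} (\<lambda>t. \<gamma> \<bullet> W t \<omega>)"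
      "continuous_on {0..} (\<lambda>t. \<phi> t \<omega>)" "continuous_on {0..} (\<lambda>t. \<psi> t \<omega>)"
      by (intro continuous_on_inner continuous_on_const components_continuous[OF elim(3)] W_continuous[OF elim(3)])+
    show "\<phi> t \<omega> - \<phi> 0 \<omega> = integral {0..t} (\<lambda>s. \<psi> s \<omega>)" if "t \<ge> 0" for t
      using eqs that by blast
    show "\<psi> t \<omega> - \<psi> 0 \<omega> = integral {0..t} (\<lambda>s. - 2 * \<zeta>2 * \<psi> s \<omega> - (\<kappa>\<^sup>2 - a \<bullet> v s \<omega>) * \<phi> s \<omega>)
      + (\<phi> t \<omega> * (\<gamma> \<bullet> W t \<omega>) - \<phi> 0 \<omega> * (\<gamma> \<bullet> W 0 \<omega>) - integral {0..t} (\<lambda>s. (\<gamma> \<bullet> W s \<omega>) * \<psi> s \<omega>))"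
      if "t \<ge> 0" for t
      using eqs that by blast
  qed (use \<zeta>2_nonneg \<kappa>d_pos \<kappa>d_square in simp_all)
qed

lemma g_variance:
  assumes "t \<ge> 0"
  shows "integrable M (\<lambda>\<omega>. (g t \<omega>)\<^sup>2)"
    "expectation (\<lambda>\<omega>. (g t \<omega>)\<^sup>2) \<le> a \<bullet> (stationary_covariance A B *v a)"
proof -
  note h = linear_observation_variance[where A = A and B = B and a = a and v = v, OF stable
      components_measurable(1)[OF X_measurable] components_continuous(1) AE_v_equation assms]
  show "integrable M (\<lambda>\<omega>. (g t \<omega>)\<^sup>2)" unfolding g_def by (rule h(1))
  show "expectation (\<lambda>\<omega>. (g t \<omega>)\<^sup>2) \<le> a \<bullet> (stationary_covariance A B *v a)"
    unfolding g_def by (rule h(2))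
qed

definition coefficient where "coefficient t \<omega> = 2 * y t \<omega> * \<phi> t \<omega> / R t \<omega>"

definition martingale_sum where
  "martingale_sum T n \<omega> = (\<Sum>i<n. coefficient (grid T n i) \<omega>
    * (\<gamma> \<bullet> (W (grid T n (Suc i)) \<omega> - W (grid T n i) \<omega>)))"

text \<open>Nonnegative, with explicitly bounded mean, so Fatou applies. The scale
  \<open>sqrt T\<close> turns a martingale variance of order \<open>T\<close> into a cost of order
  \<open>sqrt T\<close>.\<close>

definition majorant where
  "majorant r T n \<omega> = ((martingale_sum T n \<omega>)\<^sup>2 / sqrt T + sqrt T) / 2
    + (\<Sum>i<n. ((g (grid T n i) \<omega>)\<^sup>2 / r + r) / 2 * (T / n)) / \<kappa>d
    + (\<Sum>i<n. (\<gamma> \<bullet> (W (grid T n (Suc i)) \<omega> - W (grid T n i) \<omega>))\<^sup>2) / \<kappa>d\<^sup>2"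

text \<open>Where \<open>R\<close> vanishes the quotient is 0 by convention, so the bound holds at
  every point and not just almost surely; the isometry asks for bounds on all of
  \<open>space M\<close>.\<close>

lemma abs_coefficient_le: "\<bar>coefficient t \<omega>\<bar> \<le> 1 / \<kappa>d"
proof (cases "R t \<omega> = 0")
  case False
  have "0 \<le> R t \<omega>" by (simp add: R_def)
  then have p: "R t \<omega> > 0" using False by simp
  have "2 * (\<kappa>d * \<bar>\<phi> t \<omega>\<bar>) * \<bar>y t \<omega>\<bar> \<le> (\<kappa>d * \<bar>\<phi> t \<omega>\<bar>)\<^sup>2 + \<bar>y t \<omega>\<bar>\<^sup>2" by (rule sum_squares_bound)
  then have "2 * \<bar>y t \<omega>\<bar> * \<bar>\<phi> t \<omega>\<bar> * \<kappa>d \<le> R t \<omega>" by (simp add: R_def power_mult_distrib mult_ac)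
  then show ?thesis using p \<kappa>d_pos by (simp add: coefficient_def abs_mult field_simps)
qed (use \<kappa>d_pos in \<open>simp add: coefficient_def\<close>)

lemma coefficient_adapted: "t \<ge> 0 \<Longrightarrow> coefficient t \<in> borel_measurable (F t)"
proof -
  assume "t \<ge> 0"
  note [measurable] = components_measurable[OF X_adapted[OF this]]
  show ?thesis unfolding coefficient_def[abs_def] R_def y_def by measurable
qed

text \<open>The isometry with coefficients at most \<open>1 / \<kappa>d\<close>; the bound is
  uniform in the mesh and linear in \<open>T\<close>.\<close>

lemma martingale_sum_variance:
  assumes T: "T > 0"
  shows "integrable M (\<lambda>\<omega>. (martingale_sum T n \<omega>)\<^sup>2)"
    "expectation (\<lambda>\<omega>. (martingale_sum T n \<omega>)\<^sup>2) \<le> (norm \<gamma>)\<^sup>2 / \<kappa>d\<^sup>2 * T"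
proof -
  have mono: "0 \<le> grid T n i \<and> grid T n i \<le> grid T n (Suc i)" for i
    using T by (simp add: grid_nonneg grid_mono)
  have m: "coefficient (grid T n i) \<in> borel_measurable (F (grid T n i))" for i
    using T by (intro coefficient_adapted grid_nonneg) simp
  have b: "\<exists>K. \<forall>\<omega>\<in>space M. \<bar>coefficient (grid T n i) \<omega>\<bar> \<le> K" for i
    using abs_coefficient_le by blast
  note iso = discrete_isometry[of n "grid T n" "\<lambda>i. coefficient (grid T n i)" "\<lambda>_. \<gamma>", OF mono m b,
      folded martingale_sum_def]
  show "integrable M (\<lambda>\<omega>. (martingale_sum T n \<omega>)\<^sup>2)" by (rule iso(1))
  have sq: "(coefficient (grid T n i) \<omega>)\<^sup>2 \<le> 1 / \<kappa>d\<^sup>2" for i \<omega>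
    using power_mono[OF abs_coefficient_le abs_ge_zero, of "grid T n i" \<omega> 2] by (simp add: power_divide)
  have "expectation (\<lambda>\<omega>. (coefficient (grid T n i) \<omega>)\<^sup>2) \<le> expectation (\<lambda>_. 1 / \<kappa>d\<^sup>2)" for i
  proof (rule integral_mono)
    show "integrable M (\<lambda>\<omega>. (coefficient (grid T n i) \<omega>)\<^sup>2)"
      using sq measurable_F_imp_M[OF m] by (intro integrable_const_bound[of _ "1 / \<kappa>d\<^sup>2"]) auto
  qed (use sq in auto)
  then have e: "expectation (\<lambda>\<omega>. (coefficient (grid T n i) \<omega>)\<^sup>2) \<le> 1 / \<kappa>d\<^sup>2" for i
    by (simp add: prob_space)
  have "expectation (\<lambda>\<omega>. (martingale_sum T n \<omega>)\<^sup>2) \<le> (\<Sum>i<n. 1 / \<kappa>d\<^sup>2 * (norm \<gamma>)\<^sup>2 * (T / n))"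
    unfolding iso(2) grid_step using T e by (intro sum_mono mult_right_mono) auto
  also have "\<dots> \<le> (norm \<gamma>)\<^sup>2 / \<kappa>d\<^sup>2 * T" using T by (cases "n = 0") auto
  finally show "expectation (\<lambda>\<omega>. (martingale_sum T n \<omega>)\<^sup>2) \<le> (norm \<gamma>)\<^sup>2 / \<kappa>d\<^sup>2 * T" .
qed

lemma majorant_expectation:
  assumes T: "T > 0" and r: "r > 0"
  defines "\<sigma>2 \<equiv> a \<bullet> (stationary_covariance A B *v a)"
  shows "integrable M (majorant r T n)"
    "expectation (majorant r T n) \<le> ((norm \<gamma>)\<^sup>2 / \<kappa>d\<^sup>2 + 1) / 2 * sqrt T
      + ((\<sigma>2 / r + r) / (2 * \<kappa>d) + (norm \<gamma>)\<^sup>2 / \<kappa>d\<^sup>2) * T"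
proof -
  have g0: "0 \<le> grid T n i" "grid T n i \<le> grid T n (Suc i)" for i
    using T by (simp_all add: grid_nonneg grid_mono)
  note gv = g_variance[OF g0(1)] and iv = increment_moments(3,4)[OF g0, of \<gamma>]
    and mv = martingale_sum_variance[OF T, of n]
  have \<sigma>0: "\<sigma>2 \<ge> 0"
    unfolding \<sigma>2_def using integral_noise_intensity_le[of A 0 B a, OF stable] by simp
  show "integrable M (majorant r T n)"
    unfolding majorant_def[abs_def] using gv(1) iv(1) mv(1) by simp
  have "expectation (majorant r T n) = (expectation (\<lambda>\<omega>. (martingale_sum T n \<omega>)\<^sup>2) / sqrt T + sqrt T) / 2
    + (\<Sum>i<n. (expectation (\<lambda>\<omega>. (g (grid T n i) \<omega>)\<^sup>2) / r + r) / 2 * (T / n)) / \<kappa>d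
    + (\<Sum>i<n. T / n * (norm \<gamma>)\<^sup>2) / \<kappa>d\<^sup>2"
    unfolding majorant_def[abs_def] using gv(1) iv mv(1) by (simp add: prob_space grid_step)
  also have "\<dots> \<le> ((norm \<gamma>)\<^sup>2 / \<kappa>d\<^sup>2 * T / sqrt T + sqrt T) / 2
    + (\<Sum>i<n. (\<sigma>2 / r + r) / 2 * (T / n)) / \<kappa>d + (\<Sum>i<n. T / n * (norm \<gamma>)\<^sup>2) / \<kappa>d\<^sup>2"
    using mv(2) gv(2) T r \<kappa>d_pos unfolding \<sigma>2_def
    by (intro add_mono divide_right_mono sum_mono mult_right_mono order_refl) auto
  also have "\<dots> \<le> ((norm \<gamma>)\<^sup>2 / \<kappa>d\<^sup>2 * T / sqrt T + sqrt T) / 2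
    + (\<sigma>2 / r + r) / 2 * T / \<kappa>d + T * (norm \<gamma>)\<^sup>2 / \<kappa>d\<^sup>2"
  proof -
    \<comment> \<open>Equalities for positive \<open>n\<close>; for \<open>n = 0\<close> the sums
      are empty and only the inequality holds.\<close>
    have "(\<Sum>i<n. (\<sigma>2 / r + r) / 2 * (T / n)) \<le> (\<sigma>2 / r + r) / 2 * T"
      "(\<Sum>i<n. T / n * (norm \<gamma>)\<^sup>2) \<le> T * (norm \<gamma>)\<^sup>2"
      using T r \<sigma>0 by (cases "n = 0"; simp)+
    then show ?thesis by (intro add_mono divide_right_mono order_refl) (use \<kappa>d_pos in auto)
  qed
  also have "(norm \<gamma>)\<^sup>2 / \<kappa>d\<^sup>2 * T / sqrt T = (norm \<gamma>)\<^sup>2 / \<kappa>d\<^sup>2 * sqrt T"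
  proof -
    have "T / sqrt T = sqrt T" using T by (simp add: real_div_sqrt)
    then show ?thesis by (metis times_divide_eq_right)
  qed
  also have "((norm \<gamma>)\<^sup>2 / \<kappa>d\<^sup>2 * sqrt T + sqrt T) / 2
      + (\<sigma>2 / r + r) / 2 * T / \<kappa>d + T * (norm \<gamma>)\<^sup>2 / \<kappa>d\<^sup>2
    = ((norm \<gamma>)\<^sup>2 / \<kappa>d\<^sup>2 + 1) / 2 * sqrt T + ((\<sigma>2 / r + r) / (2 * \<kappa>d) + (norm \<gamma>)\<^sup>2 / \<kappa>d\<^sup>2) * T"
  proof -
    have "(x / z * q + q) / 2 + p / 2 * u / k + u * x / z = (x / z + 1) / 2 * q + (p / (2 * k) + x / z) * u"
      for x z q p u k :: real
      by (simp add: distrib_right add_divide_distrib)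
    then show ?thesis .
  qed
  finally show "expectation (majorant r T n) \<le> ((norm \<gamma>)\<^sup>2 / \<kappa>d\<^sup>2 + 1) / 2 * sqrt T
      + ((\<sigma>2 / r + r) / (2 * \<kappa>d) + (norm \<gamma>)\<^sup>2 / \<kappa>d\<^sup>2) * T" .
qed

text \<open>Equivalence of norms in one direction, from
  \<open>\<psi> = y - \<zeta>2 * \<phi>\<close>; a constant factor does not change the
  exponent.\<close>

lemma square_norm_le_R:
  "(norm (snd (X t \<omega>)))\<^sup>2 \<le> (1 / \<kappa>d\<^sup>2 + 2 + 2 * \<zeta>2\<^sup>2 / \<kappa>d\<^sup>2) * R t \<omega>"
proof -
  have "(norm (snd (X t \<omega>)))\<^sup>2 = (\<phi> t \<omega>)\<^sup>2 + (\<psi> t \<omega>)\<^sup>2"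
    by (simp add: norm_prod_def \<phi>_def \<psi>_def)
  moreover have "(\<psi> t \<omega>)\<^sup>2 \<le> 2 * (y t \<omega>)\<^sup>2 + 2 * (\<zeta>2 * \<phi> t \<omega>)\<^sup>2"
  proof -
    have "(\<psi> t \<omega>)\<^sup>2 = (y t \<omega> - \<zeta>2 * \<phi> t \<omega>)\<^sup>2" by (simp add: y_def)
    then show ?thesis
      using zero_le_power2[of "y t \<omega> + \<zeta>2 * \<phi> t \<omega>"] by (simp add: power2_eq_square algebra_simps)
  qed
  moreover have "(y t \<omega>)\<^sup>2 \<le> R t \<omega>" by (simp add: R_def)
  moreover have \<phi>R: "(\<phi> t \<omega>)\<^sup>2 \<le> R t \<omega> / \<kappa>d\<^sup>2" using \<kappa>d_pos by (simp add: R_def field_simps)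
  moreover have "(\<zeta>2 * \<phi> t \<omega>)\<^sup>2 \<le> \<zeta>2\<^sup>2 * (R t \<omega> / \<kappa>d\<^sup>2)"
    using mult_left_mono[OF \<phi>R zero_le_power2[of \<zeta>2]] by (simp add: power_mult_distrib)
  ultimately have "(norm (snd (X t \<omega>)))\<^sup>2 \<le> R t \<omega> / \<kappa>d\<^sup>2 + 2 * R t \<omega> + 2 * (\<zeta>2\<^sup>2 * (R t \<omega> / \<kappa>d\<^sup>2))"
    by linarith
  then show ?thesis by (simp add: algebra_simps)
qed

text \<open>All terms that do not grow with \<open>T\<close> are gathered in \<Theta>, chosen before
  \<open>T\<close> and \<open>r\<close>. It depends on the arbitrary initial state and is therefore
  claimed to be measurable, not integrable.\<close>

lemma growth_le_majorant:
  obtains \<Theta> :: "'w \<Rightarrow> real" where "\<Theta> \<in> borel_measurable M"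
    "\<And>T r. T > 0 \<Longrightarrow> r > 0 \<Longrightarrow> AE \<omega> in M. \<forall>\<^sub>F n in sequentially.
      2 * ln (norm (snd (X T \<omega>))) + 2 * \<zeta>2 * T - \<Theta> \<omega> \<le> majorant r T n \<omega>"
proof -
  obtain C c where C: "C \<ge> 0" and c: "c > 0" and decay: "\<And>t a x. t \<ge> 0 \<Longrightarrow>
      \<bar>a \<bullet> (matrix_exp (t *\<^sub>R A) *v x)\<bar> \<le> C * exp (- c * t) * (norm a * norm x)"
    using matrix_exp_decay[OF stable] by blast
  define C2 where "C2 = 1 / \<kappa>d\<^sup>2 + 2 + 2 * \<zeta>2\<^sup>2 / \<kappa>d\<^sup>2"
  have C2: "C2 > 0" unfolding C2_def using \<kappa>d_pos by (intro add_pos_nonneg) auto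
  define K where "K \<omega> = C * (norm a * norm (v 0 \<omega>))" for \<omega>
  \<comment> \<open>\<open>ln C2\<close> compares the norms, \<open>ln (R 0 \<omega>)\<close> is the
    starting level, the quotient by \<open>\<kappa>d\<close> bounds the transient, and the last 1 is
    the tolerance spent in \<open>log_growth_le\<close>.\<close>
  define \<Theta> where "\<Theta> \<omega> = ln C2 + ln (R 0 \<omega>) + (K \<omega> / c + 1) / \<kappa>d + 1" for \<omega>
  have "\<Theta> \<in> borel_measurable M"
  proof -
    note [measurable] = components_measurable[OF X_measurable[of 0], OF order_refl]
    show ?thesis unfolding \<Theta>_def[abs_def] K_def R_def y_def by measurable
  qed
  moreover have "AE \<omega> in M. \<forall>\<^sub>F n in sequentially.
      2 * ln (norm (snd (X T \<omega>))) + 2 * \<zeta>2 * T - \<Theta> \<omega> \<le> majorant r T n \<omega>" if T: "T > 0" and r: "r > 0" for T r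
    using AE_oscillator_path
  proof eventually_elim
    case (elim \<omega>)
    interpret op: oscillator_path \<kappa> \<zeta>2 \<kappa>d "\<lambda>t. a \<bullet> v t \<omega>" "\<lambda>t. \<gamma> \<bullet> W t \<omega>" "\<lambda>t. \<phi> t \<omega>" "\<lambda>t. \<psi> t \<omega>"
      by (rule elim)
    have opy: "op.y t = y t \<omega>" for t by (simp add: op.y_def y_def)
    have opR: "op.R t = R t \<omega>" for t by (simp add: op.R_def R_def opy)
    have K0: "K \<omega> \<ge> 0" using C by (simp add: K_def)
    have log: "2 * ln (norm (snd (X T \<omega>))) \<le> ln C2 + ln (R T \<omega>)"
    proof -
      have "snd (X T \<omega>) \<noteq> 0" using op.nonvanishing[of T] T by (auto simp: \<phi>_def \<psi>_def prod_eq_iff)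
      then have n: "norm (snd (X T \<omega>)) > 0" by simp
      have "R T \<omega> > 0" using op.R_pos[of T] T by (simp add: opR)
      have "2 * ln (norm (snd (X T \<omega>))) = ln ((norm (snd (X T \<omega>)))\<^sup>2)" using n by (simp add: ln_realpow)
      also have "\<dots> \<le> ln (C2 * R T \<omega>)"
        unfolding C2_def using square_norm_le_R[of T \<omega>] n by (intro ln_mono) auto
      also have "\<dots> = ln C2 + ln (R T \<omega>)" using C2 \<open>R T \<omega> > 0\<close> by (simp add: ln_mult)
      finally show ?thesis .
    qed
    show ?case
      using op.log_growth_le[OF T zero_less_one] riemann_sum_exp_decay[OF K0 c T]
    proof eventually_elim
      case (elim n)
      let ?g = "grid T n"
      have "(\<Sum>i<n. \<bar>a \<bullet> v (?g i) \<omega>\<bar> * (T / n))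
          \<le> (\<Sum>i<n. ((g (?g i) \<omega>)\<^sup>2 / r + r) / 2 * (T / n) + K \<omega> * exp (- c * ?g i) * (T / n))"
      proof (rule sum_mono)
        fix i
        have "\<bar>a \<bullet> (matrix_exp (?g i *\<^sub>R A) *v v 0 \<omega>)\<bar> \<le> K \<omega> * exp (- c * ?g i)"
          using decay[of "?g i" a "v 0 \<omega>"] T by (simp add: grid_nonneg K_def mult_ac)
        then have "\<bar>a \<bullet> v (?g i) \<omega>\<bar> \<le> ((g (?g i) \<omega>)\<^sup>2 / r + r) / 2 + K \<omega> * exp (- c * ?g i)"
          using abs_le_scaled_square[OF r, of "g (?g i) \<omega>"] unfolding g_def by linarith
        then have "\<bar>a \<bullet> v (?g i) \<omega>\<bar> * (T / n)
            \<le> (((g (?g i) \<omega>)\<^sup>2 / r + r) / 2 + K \<omega> * exp (- c * ?g i)) * (T / n)"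
          using T by (intro mult_right_mono) auto
        then show "\<bar>a \<bullet> v (?g i) \<omega>\<bar> * (T / n)
            \<le> ((g (?g i) \<omega>)\<^sup>2 / r + r) / 2 * (T / n) + K \<omega> * exp (- c * ?g i) * (T / n)"
          by (simp only: distrib_right)
      qed
      also have "\<dots> \<le> (\<Sum>i<n. ((g (?g i) \<omega>)\<^sup>2 / r + r) / 2 * (T / n)) + (K \<omega> / c + 1)"
        using elim(2) by (simp only: sum.distrib add_left_mono)
      finally have "(\<Sum>i<n. \<bar>a \<bullet> v (?g i) \<omega>\<bar> * (T / n)) / \<kappa>d
          \<le> ((\<Sum>i<n. ((g (?g i) \<omega>)\<^sup>2 / r + r) / 2 * (T / n)) + (K \<omega> / c + 1)) / \<kappa>d"
        using \<kappa>d_pos by (intro divide_right_mono) auto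
      then have obs: "(\<Sum>i<n. \<bar>a \<bullet> v (?g i) \<omega>\<bar> * (T / n)) / \<kappa>d
          \<le> (\<Sum>i<n. ((g (?g i) \<omega>)\<^sup>2 / r + r) / 2 * (T / n)) / \<kappa>d + (K \<omega> / c + 1) / \<kappa>d"
        by (simp only: add_divide_distrib)
      have mart: "martingale_sum T n \<omega> \<le> ((martingale_sum T n \<omega>)\<^sup>2 / sqrt T + sqrt T) / 2"
        using abs_le_scaled_square[of "sqrt T" "martingale_sum T n \<omega>"] T by simp
      have growth: "ln (R T \<omega>) - ln (R 0 \<omega>) \<le> - 2 * \<zeta>2 * T + (\<Sum>i<n. \<bar>a \<bullet> v (?g i) \<omega>\<bar> * (T / n)) / \<kappa>d
        + martingale_sum T n \<omega>
        + (\<Sum>i<n. (\<gamma> \<bullet> (W (?g (Suc i)) \<omega> - W (?g i) \<omega>))\<^sup>2) / \<kappa>d\<^sup>2 + 1"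
        using elim(1) by (simp only: opy opR martingale_sum_def coefficient_def inner_diff_right)
      show ?case unfolding majorant_def \<Theta>_def using log obs mart growth by linarith
    qed
  qed
  ultimately show ?thesis by (rule that)
qed

text \<open>Fatou as the mesh tends to 0: the growth lies below the majorant for all large
  \<open>n\<close>, hence below its lower limit. \<open>ennreal\<close> replaces negative growth by
  0, harmless against a nonnegative majorant.\<close>

lemma expected_growth_le:
  obtains \<Theta> :: "'w \<Rightarrow> real" where "\<Theta> \<in> borel_measurable M"
    "\<And>T r. T > 0 \<Longrightarrow> r > 0 \<Longrightarrow>
      (\<integral>\<^sup>+\<omega>. ennreal ((2 * ln (norm (snd (X T \<omega>))) + 2 * \<zeta>2 * T - \<Theta> \<omega>) / T) \<partial>M)
      \<le> ennreal (((norm \<gamma>)\<^sup>2 / \<kappa>d\<^sup>2 + 1) / 2 * (sqrt T / T)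
        + ((a \<bullet> (stationary_covariance A B *v a) / r + r) / (2 * \<kappa>d) + (norm \<gamma>)\<^sup>2 / \<kappa>d\<^sup>2))"
proof -
  let ?\<sigma>2 = "a \<bullet> (stationary_covariance A B *v a)"
  obtain \<Theta> where \<Theta>: "\<Theta> \<in> borel_measurable M"
    "\<And>T r. T > 0 \<Longrightarrow> r > 0 \<Longrightarrow> AE \<omega> in M. \<forall>\<^sub>F n in sequentially.
      2 * ln (norm (snd (X T \<omega>))) + 2 * \<zeta>2 * T - \<Theta> \<omega> \<le> majorant r T n \<omega>"
    using growth_le_majorant by blast
  have "(\<integral>\<^sup>+\<omega>. ennreal ((2 * ln (norm (snd (X T \<omega>))) + 2 * \<zeta>2 * T - \<Theta> \<omega>) / T) \<partial>M)
      \<le> ennreal (((norm \<gamma>)\<^sup>2 / \<kappa>d\<^sup>2 + 1) / 2 * (sqrt T / T)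
        + ((?\<sigma>2 / r + r) / (2 * \<kappa>d) + (norm \<gamma>)\<^sup>2 / \<kappa>d\<^sup>2))" (is "_ \<le> ennreal ?b")
    if T: "T > 0" and r: "r > 0" for T r
  proof -
    note int = majorant_expectation(1)[OF T r] and e = majorant_expectation(2)[OF T r]
    have nonneg: "majorant r T n \<omega> \<ge> 0" for n \<omega>
      unfolding majorant_def using T r \<kappa>d_pos by (intro add_nonneg_nonneg sum_nonneg divide_nonneg_pos) auto
    have "(\<integral>\<^sup>+\<omega>. ennreal ((2 * ln (norm (snd (X T \<omega>))) + 2 * \<zeta>2 * T - \<Theta> \<omega>) / T) \<partial>M)
        \<le> (\<integral>\<^sup>+\<omega>. liminf (\<lambda>n. ennreal (majorant r T n \<omega> / T)) \<partial>M)"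
    proof (rule nn_integral_mono_AE)
      show "AE \<omega> in M. ennreal ((2 * ln (norm (snd (X T \<omega>))) + 2 * \<zeta>2 * T - \<Theta> \<omega>) / T)
          \<le> liminf (\<lambda>n. ennreal (majorant r T n \<omega> / T))"
        using \<Theta>(2)[OF T r]
      proof eventually_elim
        case (elim \<omega>)
        then show ?case
        proof (intro Liminf_bounded, eventually_elim)
          case (elim n)
          then show ?case using T by (intro ennreal_leI divide_right_mono) auto
        qed
      qed
    qed
    also have "\<dots> \<le> liminf (\<lambda>n. \<integral>\<^sup>+\<omega>. ennreal (majorant r T n \<omega> / T) \<partial>M)"
      using borel_measurable_integrable[OF int] by (intro nn_integral_liminf) simp
    also have "\<dots> \<le> ennreal ?b"
    proof (rule Liminf_le)
      show "\<forall>\<^sub>F n in sequentially. (\<integral>\<^sup>+\<omega>. ennreal (majorant r T n \<omega> / T) \<partial>M) \<le> ennreal ?b"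
      proof (rule always_eventually, rule allI)
        fix n
        have "(\<integral>\<^sup>+\<omega>. ennreal (majorant r T n \<omega> / T) \<partial>M) = ennreal (expectation (majorant r T n) / T)"
          using int[of n] nonneg T by (subst nn_integral_eq_integral) auto
        also have "\<dots> \<le> ennreal ?b"
        proof (rule ennreal_leI)
          have "expectation (majorant r T n) / T \<le> (((norm \<gamma>)\<^sup>2 / \<kappa>d\<^sup>2 + 1) / 2 * sqrt T
            + ((?\<sigma>2 / r + r) / (2 * \<kappa>d) + (norm \<gamma>)\<^sup>2 / \<kappa>d\<^sup>2) * T) / T"
            using T by (intro divide_right_mono e) auto
          then show "expectation (majorant r T n) / T \<le> ?b"
            using T by (simp add: add_divide_distrib)
        qed
        finally show "(\<integral>\<^sup>+\<omega>. ennreal (majorant r T n \<omega> / T) \<partial>M) \<le> ennreal ?b" .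
      qed
    qed simp
    finally show ?thesis .
  qed
  with \<Theta>(1) show ?thesis by (rule that)
qed

text \<open>Fatou as \<open>T\<close> tends to infinity: the rescaled growth converges almost surely
  to a constant, which equals its own expectation. \<Theta> is divided by \<open>T\<close> along
  each path, so its missing moments do not matter.\<close>

lemma lyapunov_exponent_le_scaled:
  assumes lyap: "lyapunov_exponent M (\<lambda>t \<omega>. snd (X t \<omega>)) lam" and r: "r > 0"
  shows "2 * lam + 2 * \<zeta>2 \<le> (a \<bullet> (stationary_covariance A B *v a) / r + r) / (2 * \<kappa>d) + (norm \<gamma>)\<^sup>2 / \<kappa>d\<^sup>2"
proof -
  let ?m = "(a \<bullet> (stationary_covariance A B *v a) / r + r) / (2 * \<kappa>d) + (norm \<gamma>)\<^sup>2 / \<kappa>d\<^sup>2"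
  let ?K = "((norm \<gamma>)\<^sup>2 / \<kappa>d\<^sup>2 + 1) / 2"
  \<comment> \<open>\<open>ennreal\<close> identifies all nonpositive reals with 0, so a comparison
    can be carried back to the reals only below a nonnegative bound.\<close>
  have m0: "?m \<ge> 0"
    using integral_noise_intensity_le[of A 0 B a, OF stable] r \<kappa>d_pos by simp
  obtain \<Theta> where \<Theta>: "\<Theta> \<in> borel_measurable M" and
    le': "\<And>T r. T > 0 \<Longrightarrow> r > 0 \<Longrightarrow>
      (\<integral>\<^sup>+\<omega>. ennreal ((2 * ln (norm (snd (X T \<omega>))) + 2 * \<zeta>2 * T - \<Theta> \<omega>) / T) \<partial>M)
      \<le> ennreal (?K * (sqrt T / T)
        + ((a \<bullet> (stationary_covariance A B *v a) / r + r) / (2 * \<kappa>d) + (norm \<gamma>)\<^sup>2 / \<kappa>d\<^sup>2))"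
    by (rule expected_growth_le) blast
  note le = le'[OF _ r]
  \<comment> \<open>Fatou needs a sequence; integer times starting at 1 avoid division by 0.\<close>
  define f where "f k \<omega> = (2 * ln (norm (snd (X (real (Suc k)) \<omega>))) + 2 * \<zeta>2 * real (Suc k) - \<Theta> \<omega>) / real (Suc k)"
    for k \<omega>
  have at_top: "filterlim (\<lambda>k. real (Suc k)) at_top sequentially"
    by (rule filterlim_compose[OF filterlim_real_sequentially filterlim_Suc])
  have lim: "AE \<omega> in M. (\<lambda>k. f k \<omega>) \<longlonglongrightarrow> 2 * lam + 2 * \<zeta>2"
    using lyap[unfolded lyapunov_exponent_def, THEN conjunct2]
  proof eventually_elim
    case (elim \<omega>)
    have "(\<lambda>k. 2 * (ln (norm (snd (X (real (Suc k)) \<omega>))) / real (Suc k)) + 2 * \<zeta>2 - \<Theta> \<omega> * inverse (real (Suc k)))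
        \<longlonglongrightarrow> 2 * lam + 2 * \<zeta>2 - \<Theta> \<omega> * 0"
      by (intro tendsto_intros filterlim_compose[OF elim at_top] LIMSEQ_inverse_real_of_nat)
    moreover have "f k \<omega> = 2 * (ln (norm (snd (X (real (Suc k)) \<omega>))) / real (Suc k)) + 2 * \<zeta>2
        - \<Theta> \<omega> * inverse (real (Suc k))" for k
    proof -
      have "(2 * x + 2 * z * n - c) / n = 2 * (x / n) + 2 * z - c * inverse n" if "n > 0" for x z n c :: real
        using that by (simp add: field_simps)
      then show ?thesis unfolding f_def by simp
    qed
    ultimately show ?case by simp
  qed
  have fm: "(\<lambda>\<omega>. ennreal (f k \<omega>)) \<in> borel_measurable M" for k
  proof -
    have "(\<lambda>\<omega>. norm (snd (X (real (Suc k)) \<omega>))) \<in> borel_measurable M"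
      by (rule borel_measurable_continuous_on[OF _ X_measurable]) (auto intro!: continuous_intros)
    then show ?thesis unfolding f_def using \<Theta> by simp
  qed
  have "ennreal (2 * lam + 2 * \<zeta>2) = (\<integral>\<^sup>+\<omega>. ennreal (2 * lam + 2 * \<zeta>2) \<partial>M)"
    by (simp add: emeasure_space_1)
  also have "\<dots> = (\<integral>\<^sup>+\<omega>. liminf (\<lambda>k. ennreal (f k \<omega>)) \<partial>M)"
  proof (rule nn_integral_cong_AE)
    show "AE \<omega> in M. ennreal (2 * lam + 2 * \<zeta>2) = liminf (\<lambda>k. ennreal (f k \<omega>))"
      using lim
    proof eventually_elim
      case (elim \<omega>)
      show ?case by (rule lim_imp_Liminf[OF sequentially_bot tendsto_ennrealI[OF elim], symmetric])
    qed
  qed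
  also have "\<dots> \<le> liminf (\<lambda>k. \<integral>\<^sup>+\<omega>. ennreal (f k \<omega>) \<partial>M)" by (rule nn_integral_liminf[OF fm])
  also have "\<dots> \<le> liminf (\<lambda>k. ennreal (?K * (sqrt (real (Suc k)) / real (Suc k)) + ?m))"
    unfolding f_def by (intro Liminf_mono always_eventually allI le) simp
  also have "\<dots> = ennreal (?K * 0 + ?m)"
  proof -
    have "((\<lambda>T. sqrt T / T) \<longlongrightarrow> (0::real)) at_top" by real_asymp
    from filterlim_compose[OF this at_top]
    have "(\<lambda>k. ?K * (sqrt (real (Suc k)) / real (Suc k)) + ?m) \<longlonglongrightarrow> ?K * 0 + ?m"
      by (intro tendsto_intros)
    then show ?thesis by (intro lim_imp_Liminf[OF sequentially_bot] tendsto_ennrealI)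
  qed
  finally show ?thesis using m0 by (simp add: ennreal_le_iff)
qed

text \<open>\<open>s\<^sup>2 / r + r\<close> is least at \<open>r = s\<close>, with value
  \<open>2 * s\<close>. For \<open>s = 0\<close> this scale is forbidden, and \<open>r\<close> tends
  to 0 from the right instead.\<close>

lemma lyapunov_exponent_le:
  assumes lyap: "lyapunov_exponent M (\<lambda>t \<omega>. snd (X t \<omega>)) lam"
  shows "lam \<le> - \<zeta>2 + sqrt (a \<bullet> (stationary_covariance A B *v a)) / (2 * \<kappa>d) + (norm \<gamma>)\<^sup>2 / (2 * \<kappa>d\<^sup>2)"
proof -
  define s where "s = sqrt (a \<bullet> (stationary_covariance A B *v a))"
  have \<sigma>0: "a \<bullet> (stationary_covariance A B *v a) \<ge> 0"
    using integral_noise_intensity_le[of A 0 B a, OF stable] by simp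
  then have s: "s \<ge> 0" "a \<bullet> (stationary_covariance A B *v a) = s\<^sup>2" by (simp_all add: s_def)
  note le = lyapunov_exponent_le_scaled[OF lyap, unfolded s(2)]
  have "2 * lam + 2 * \<zeta>2 \<le> s / \<kappa>d + (norm \<gamma>)\<^sup>2 / \<kappa>d\<^sup>2"
  proof (cases "s = 0")
    case True
    have lim: "((\<lambda>r. r / (2 * \<kappa>d) + (norm \<gamma>)\<^sup>2 / \<kappa>d\<^sup>2) \<longlongrightarrow> 0 / (2 * \<kappa>d) + (norm \<gamma>)\<^sup>2 / \<kappa>d\<^sup>2) (at_right 0)"
      using \<kappa>d_pos by (intro tendsto_intros) auto
    have "2 * lam + 2 * \<zeta>2 \<le> 0 / (2 * \<kappa>d) + (norm \<gamma>)\<^sup>2 / \<kappa>d\<^sup>2"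
    proof (rule tendsto_lowerbound[OF lim])
      show "\<forall>\<^sub>F r in at_right 0. 2 * lam + 2 * \<zeta>2 \<le> r / (2 * \<kappa>d) + (norm \<gamma>)\<^sup>2 / \<kappa>d\<^sup>2"
        using eventually_at_right_less[of 0] by eventually_elim (use le True in simp)
    qed simp
    then show ?thesis using True by simp
  next
    case False
    then have "s > 0" using s by simp
    then have "s\<^sup>2 / s + s = 2 * s" by (simp add: power2_eq_square)
    then show ?thesis using le[OF \<open>s > 0\<close>] \<kappa>d_pos by simp
  qed
  then show ?thesis unfolding s_def[symmetric] by (simp add: field_simps)
qed

end

end

section \<open>The block and pendulum system\<close>

text \<open>Every coordinate of \<open>\<Phi> x\<close> is a coordinate of \<open>x\<close>, so the
  Ito integrals carry over verbatim and linearity of the integral is never invoked.\<close>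

lemma solves_sde_transfer:
  fixes \<Phi> :: "'a::euclidean_space \<Rightarrow> 'b::euclidean_space"
  assumes sol: "solves_sde M F W b \<sigma> X" and lin: "linear \<Phi>"
    and basis: "\<And>e'. e' \<in> Basis \<Longrightarrow> \<exists>e\<in>Basis. \<forall>x. \<Phi> x \<bullet> e' = x \<bullet> e"
    and b: "\<And>x. b' (\<Phi> x) = \<Phi> (b x)" and \<sigma>: "\<And>x l. \<sigma>' (\<Phi> x) l = \<Phi> (\<sigma> x l)"
  shows "solves_sde M F W b' \<sigma>' (\<lambda>t \<omega>. \<Phi> (X t \<omega>))"
proof -
  have cont: "continuous_on S \<Phi>" for S
    using lin by (intro linear_continuous_on) (simp add: linear_conv_bounded_linear)
  show ?thesis
    unfolding solves_sde_def
  proof (intro conjI ballI allI impI)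
    fix t :: real assume "t \<ge> 0"
    then show "(\<lambda>\<omega>. \<Phi> (X t \<omega>)) \<in> borel_measurable (F t)"
      using sol by (intro borel_measurable_continuous_on[OF cont]) (simp add: solves_sde_def)
  next
    fix \<omega> assume "\<omega> \<in> space M"
    then have "continuous_on {0..} (\<lambda>t. X t \<omega>)" using sol by (simp add: solves_sde_def)
    then show "continuous_on {0..} (\<lambda>t. \<Phi> (X t \<omega>))"
      by (rule continuous_on_compose2[OF cont[of UNIV]]) simp
  next
    fix t :: real and e' :: 'b assume "t \<ge> 0" "e' \<in> Basis"
    then obtain e where "e \<in> Basis" and e: "\<And>x. \<Phi> x \<bullet> e' = x \<bullet> e" using basis by blast
    then show "\<exists>I. (\<forall>l. has_ito_integral M F (\<lambda>s \<omega>. W s \<omega> $ l) t (\<lambda>s \<omega>. \<sigma>' (\<Phi> (X s \<omega>)) l \<bullet> e') (I l)) \<and>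
      (AE \<omega> in M. set_integrable lborel {0..t} (\<lambda>s. b' (\<Phi> (X s \<omega>)) \<bullet> e') \<and>
        \<Phi> (X t \<omega>) \<bullet> e' = \<Phi> (X 0 \<omega>) \<bullet> e' + (LINT s:{0..t}|lborel. b' (\<Phi> (X s \<omega>)) \<bullet> e') + (\<Sum>l\<in>UNIV. I l \<omega>))"
      using sol \<open>t \<ge> 0\<close> unfolding solves_sde_def b \<sigma> e by blast
  qed
qed

definition pendulum_embed :: "real \<times> real \<times> real \<times> real \<Rightarrow> (real^2) \<times> real \<times> real"
  where "pendulum_embed = (\<lambda>(\<eta>, \<eta>', \<phi>, \<phi>'). (vector [\<eta>, \<eta>'], \<phi>, \<phi>'))"

context
  fixes \<zeta>1 chi \<nu> :: real
  assumes pos: "\<zeta>1 > 0" "chi > 0" "\<nu> > 0"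
begin

definition block_A :: "real^2^2" where "block_A = vector [vector [0, 1], vector [- chi\<^sup>2, - 2 * \<zeta>1]]"
definition block_B :: "real^1^2" where "block_B = vector [vec 0, vec \<nu>]"
text \<open>The sign comes from \<open>\<kappa>\<^sup>2 - a \<bullet> v\<close>. This is also the
  second row of \<open>block_A\<close>: the pendulum is forced by the acceleration of the
  block.\<close>

definition block_a :: "real^2" where "block_a = vector [- chi\<^sup>2, - 2 * \<zeta>1]"

lemma block_A_mult: "block_A *v x = vector [x $ 2, - chi\<^sup>2 * x $ 1 - 2 * \<zeta>1 * x $ 2]"
  by (simp add: vec_eq_iff forall_2 block_A_def matrix_vector_mult_def sum_2)

text \<open>Eigenvalues satisfy \<open>\<mu>\<^sup>2 + 2 \<zeta>1 \<mu> + chi\<^sup>2 = 0\<close>. A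
  nonreal root has real part \<open>- \<zeta>1\<close> by the imaginary part of the equation; at a
  nonnegative real number all terms are nonnegative and \<open>chi\<^sup>2\<close> is
  positive.\<close>

lemma block_stable:
  assumes "complex_eigenvalue block_A \<mu>"
  shows "Re \<mu> < 0"
proof -
  obtain x where "x \<noteq> 0" and x: "map_matrix complex_of_real block_A *v x = \<mu> *s x"
    using assms unfolding complex_eigenvalue_def by blast
  have x1: "x $ 2 = \<mu> * x $ 1"
    using arg_cong[OF x, of "\<lambda>z. z $ 1"] by (simp add: block_A_def matrix_vector_mult_def sum_2)
  have x2: "- (complex_of_real chi)\<^sup>2 * x $ 1 - 2 * complex_of_real \<zeta>1 * x $ 2 = \<mu> * x $ 2"
    using arg_cong[OF x, of "\<lambda>z. z $ 2"] by (simp add: block_A_def matrix_vector_mult_def sum_2)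
  have "x $ 1 \<noteq> 0" using \<open>x \<noteq> 0\<close> x1 by (auto simp: vec_eq_iff forall_2)
  have "x $ 1 * (\<mu>\<^sup>2 + 2 * complex_of_real \<zeta>1 * \<mu> + (complex_of_real chi)\<^sup>2)
      = \<mu> * (\<mu> * x $ 1) - (- (complex_of_real chi)\<^sup>2 * x $ 1 - 2 * complex_of_real \<zeta>1 * (\<mu> * x $ 1))"
    by (simp add: power2_eq_square algebra_simps)
  also have "\<dots> = 0" using x2 unfolding x1 by simp
  finally have eq: "\<mu>\<^sup>2 + 2 * complex_of_real \<zeta>1 * \<mu> + (complex_of_real chi)\<^sup>2 = 0"
    using \<open>x $ 1 \<noteq> 0\<close> by simp
  have re: "(Re \<mu>)\<^sup>2 - (Im \<mu>)\<^sup>2 + 2 * \<zeta>1 * Re \<mu> + chi\<^sup>2 = 0"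
    using arg_cong[OF eq, of Re] by (simp add: Re_power2)
  have im: "2 * Im \<mu> * (Re \<mu> + \<zeta>1) = 0"
    using arg_cong[OF eq, of Im] by (simp add: Im_power2 algebra_simps)
  show ?thesis
  proof (cases "Im \<mu> = 0")
    case True
    show ?thesis
    proof (rule ccontr)
      assume "\<not> Re \<mu> < 0"
      then have "0 \<le> (Re \<mu>)\<^sup>2 + 2 * \<zeta>1 * Re \<mu>" using pos by simp
      moreover have "chi\<^sup>2 > 0" using pos by simp
      moreover have "(Re \<mu>)\<^sup>2 + 2 * \<zeta>1 * Re \<mu> + chi\<^sup>2 = 0" using re True by simp
      ultimately show False by linarith
    qed
  next
    case False
    then show ?thesis using im pos by simp
  qed
qed

text \<open>\<open>V\<close> below is the quadratic form of the solution of the Lyapunov equation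
  \<open>A Q + Q A\<^sup>T + B B\<^sup>T = 0\<close>, which is diagonal with entries \<open>c\<^sub>1\<close> and \<open>c\<^sub>2\<close>.\<close>

lemma block_stationary_variance:
  "block_a \<bullet> (stationary_covariance block_A block_B *v block_a) = \<nu>\<^sup>2 * ((chi\<^sup>2 + 4 * \<zeta>1\<^sup>2) / (4 * \<zeta>1))"
proof -
  define p where "p x t = block_a \<bullet> (matrix_exp (t *\<^sub>R block_A) *v x)" for x t
  let ?p1 = "p (axis 1 1)" and ?p2 = "p (axis 2 1)"
  have lin: "p (r *\<^sub>R x + s *\<^sub>R z) t = r * p x t + s * p z t" for r s x z t
    by (simp add: p_def matrix_vector_right_distrib matrix_vector_mult_scaleR inner_add_right)
  have dp: "(p x has_real_derivative p (block_A *v x) t) (at t)" for x t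
    unfolding p_def[abs_def] by (rule DERIV_inner_matrix_exp)
  have A1: "block_A *v axis 1 1 = 0 *\<^sub>R axis 1 1 + (- chi\<^sup>2) *\<^sub>R axis 2 1"
    and A2: "block_A *v axis 2 1 = 1 *\<^sub>R axis 1 1 + (- 2 * \<zeta>1) *\<^sub>R axis 2 1"
    by (simp_all add: block_A_mult vec_eq_iff forall_2 axis_def)
  have d1: "(?p1 has_real_derivative - chi\<^sup>2 * ?p2 t) (at t)" for t
    using dp[of "axis 1 1" t] unfolding A1 lin by simp
  have d2: "(?p2 has_real_derivative ?p1 t - 2 * \<zeta>1 * ?p2 t) (at t)" for t
    using dp[of "axis 2 1" t] unfolding A2 lin by simp
  have ni: "noise_intensity block_A block_B block_a t = \<nu>\<^sup>2 * (?p2 t)\<^sup>2" for t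
  proof -
    have "column 1 block_B = \<nu> *\<^sub>R axis 2 1"
      by (simp add: column_def block_B_def vec_eq_iff forall_2 axis_def)
    then show ?thesis
      by (simp add: noise_intensity_def p_def matrix_vector_mult_scaleR power_mult_distrib UNIV_1)
  qed
  define c\<^sub>1 c\<^sub>2 where "c\<^sub>1 = \<nu>\<^sup>2 / (4 * \<zeta>1 * chi\<^sup>2)" and "c\<^sub>2 = \<nu>\<^sup>2 / (4 * \<zeta>1)"
  have c12: "c\<^sub>1 * chi\<^sup>2 = c\<^sub>2" "4 * \<zeta>1 * c\<^sub>2 = \<nu>\<^sup>2" using pos by (simp_all add: c\<^sub>1_def c\<^sub>2_def)
  define V where "V t = c\<^sub>1 * (?p1 t)\<^sup>2 + c\<^sub>2 * (?p2 t)\<^sup>2" for t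
  \<comment> \<open>\<open>V\<close> decreases at exactly the noise intensity: the mixed terms
    cancel by \<open>c\<^sub>1 * chi\<^sup>2 = c\<^sub>2\<close>, and
    \<open>4 * \<zeta>1 * c\<^sub>2 = \<nu>\<^sup>2\<close> fixes the remaining coefficient.\<close>
  have dV: "((\<lambda>t. - V t) has_real_derivative noise_intensity block_A block_B block_a t) (at t)" for t
  proof -
    have "((\<lambda>t. - V t) has_real_derivative - (c\<^sub>1 * (2 * ?p1 t * (- chi\<^sup>2 * ?p2 t))
        + c\<^sub>2 * (2 * ?p2 t * (?p1 t - 2 * \<zeta>1 * ?p2 t)))) (at t)"
      unfolding V_def by (auto intro!: derivative_eq_intros d1 d2)
    moreover have "- (c\<^sub>1 * (2 * ?p1 t * (- chi\<^sup>2 * ?p2 t)) + c\<^sub>2 * (2 * ?p2 t * (?p1 t - 2 * \<zeta>1 * ?p2 t)))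
        = 2 * ?p1 t * ?p2 t * (c\<^sub>1 * chi\<^sup>2 - c\<^sub>2) + (4 * \<zeta>1 * c\<^sub>2) * (?p2 t)\<^sup>2"
      by (simp add: power2_eq_square algebra_simps)
    ultimately show ?thesis by (simp only: ni c12 diff_self mult_zero_right add_0)
  qed
  obtain C c where "C \<ge> 0" and c: "c > 0" and decay: "\<And>t a x. t \<ge> 0 \<Longrightarrow>
      \<bar>a \<bullet> (matrix_exp (t *\<^sub>R block_A) *v x)\<bar> \<le> C * exp (- c * t) * (norm a * norm x)"
    using matrix_exp_decay[of block_A, OF block_stable] by blast
  have p0: "(p x \<longlongrightarrow> 0) at_top" for x
  proof (rule Lim_null_comparison)
    show "\<forall>\<^sub>F t in at_top. norm (p x t) \<le> C * exp (- c * t) * (norm block_a * norm x)"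
      using eventually_ge_at_top[of 0] by eventually_elim (simp only: p_def real_norm_def decay)
    have "((\<lambda>t. exp (- c * t)) \<longlongrightarrow> 0) at_top" using c by real_asymp
    then have "((\<lambda>t. C * exp (- c * t) * (norm block_a * norm x)) \<longlongrightarrow> C * 0 * (norm block_a * norm x)) at_top"
      by (intro tendsto_intros)
    then show "((\<lambda>t. C * exp (- c * t) * (norm block_a * norm x)) \<longlongrightarrow> 0) at_top" by simp
  qed
  have "(V \<longlongrightarrow> c\<^sub>1 * 0\<^sup>2 + c\<^sub>2 * 0\<^sup>2) at_top"
    unfolding V_def[abs_def] by (intro tendsto_intros p0)
  then have V: "(V \<longlongrightarrow> 0) at_top" by simp
  \<comment> \<open>Since \<open>V\<close> tends to 0 by stability, the whole integral is its
    initial value.\<close>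
  have "(noise_intensity block_A block_B block_a has_integral V 0) {0..}"
  proof (rule has_integral_to_inf)
    show "noise_intensity block_A block_B block_a integrable_on {0..t}" for t
      by (intro integrable_continuous_interval continuous_on_noise_intensity)
    have int: "integral {0..t} (noise_intensity block_A block_B block_a) = V 0 - V t" if "t \<ge> 0" for t
    proof -
      have "(noise_intensity block_A block_B block_a has_integral - V t - - V 0) {0..t}"
        by (rule fundamental_theorem_of_calculus[OF that])
          (rule has_vector_derivative_at_within[OF dV[unfolded has_real_derivative_iff_has_vector_derivative]])
      then show ?thesis by (simp add: integral_unique)
    qed
    have "((\<lambda>t. V 0 - V t) \<longlongrightarrow> V 0 - 0) at_top" by (intro tendsto_intros V)
    moreover have "\<forall>\<^sub>F t in at_top. V 0 - V t = integral {0..t} (noise_intensity block_A block_B block_a)"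
      using eventually_ge_at_top[of 0] by eventually_elim (simp add: int)
    ultimately show "((\<lambda>t. integral {0..t} (noise_intensity block_A block_B block_a)) \<longlongrightarrow> V 0) at_top"
      by (simp add: filterlim_cong)
  qed (rule noise_intensity_nonneg)
  moreover have "(noise_intensity block_A block_B block_a has_integral
      block_a \<bullet> (stationary_covariance block_A block_B *v block_a)) {0..}"
    by (rule inner_stationary_covariance) (rule block_stable)
  ultimately have "block_a \<bullet> (stationary_covariance block_A block_B *v block_a) = V 0"
    by (rule has_integral_unique[rotated])
  \<comment> \<open>At time 0 the exponential is the identity, so \<open>V 0\<close> is the
    quadratic form at the entries of \<open>block_a\<close>.\<close>
  moreover have "?p1 0 = - chi\<^sup>2" "?p2 0 = - 2 * \<zeta>1"
    using matrix_exp_0[of block_A] by (simp_all add: p_def inner_axis block_a_def)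
  moreover have "c\<^sub>1 * (chi\<^sup>2)\<^sup>2 = c\<^sub>2 * chi\<^sup>2" using c12(1) by (simp add: power2_eq_square)
  ultimately show ?thesis by (simp add: V_def c\<^sub>2_def power_mult_distrib algebra_simps add_divide_distrib)
qed

lemma pendulum_solves_oscillator:
  assumes "solves_sde M F W (pendulum_drift \<zeta>1 chi \<kappa> \<zeta>2) (pendulum_diffusion \<nu>) X"
  shows "solves_sde M F W (oscillator_drift block_A block_a \<kappa> \<zeta>2) (oscillator_diffusion block_B (vec \<nu>))
    (\<lambda>t \<omega>. pendulum_embed (X t \<omega>))"
proof (rule solves_sde_transfer[OF assms])
  show "linear pendulum_embed"
    by (rule linearI) (auto simp: pendulum_embed_def vec_eq_iff forall_2)
next
  fix e' :: "(real^2) \<times> real \<times> real" assume "e' \<in> Basis"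
  then consider i where "e' = (axis i 1, 0, 0)" | "e' = (0, 1, 0)" | "e' = (0, 0, 1)"
    by (auto simp: Basis_prod_def Basis_vec_def zero_prod_def)
  then show "\<exists>e\<in>Basis. \<forall>x. pendulum_embed x \<bullet> e' = x \<bullet> e"
  proof cases
    case 1
    consider "i = 1" | "i = 2" using exhaust_2 by blast
    then show ?thesis
    proof cases
      case a: 1
      show ?thesis
        by (intro bexI[of _ "(1, 0, 0, 0)"])
          (auto simp: 1 a pendulum_embed_def inner_axis Basis_prod_def zero_prod_def)
    next
      case a: 2
      show ?thesis
        by (intro bexI[of _ "(0, 1, 0, 0)"])
          (auto simp: 1 a pendulum_embed_def inner_axis Basis_prod_def zero_prod_def)
    qed
  next
    case 2
    then show ?thesis
      by (intro bexI[of _ "(0, 0, 1, 0)"]) (auto simp: pendulum_embed_def Basis_prod_def zero_prod_def)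
  next
    case 3
    then show ?thesis
      by (intro bexI[of _ "(0, 0, 0, 1)"]) (auto simp: pendulum_embed_def Basis_prod_def zero_prod_def)
  qed
next
  show "oscillator_drift block_A block_a \<kappa> \<zeta>2 (pendulum_embed x) = pendulum_embed (pendulum_drift \<zeta>1 chi \<kappa> \<zeta>2 x)" for x
    by (cases x) (simp add: oscillator_drift_def pendulum_drift_def pendulum_embed_def block_A_mult
        block_a_def vec_eq_iff forall_2 inner_vec_def sum_2 algebra_simps)
next
  show "oscillator_diffusion block_B (vec \<nu>) (pendulum_embed x) l = pendulum_embed (pendulum_diffusion \<nu> x l)" for x l
    by (cases x) (simp add: oscillator_diffusion_def pendulum_diffusion_def pendulum_embed_def block_B_def
        column_def vec_eq_iff forall_2)
qed

end

theorem proposition4p2: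
  fixes M :: "'w measure" and F :: "real \<Rightarrow> 'w measure"
    and \<kappa> \<zeta>2 \<kappa>d :: real
  assumes "prob_space M"
    and "filtration (space M) F" and "\<forall>t. subalgebra M (F t)"
    and "\<kappa> > 0" and "\<zeta>2 > 0" and "\<zeta>2 < \<kappa>"
    and "\<kappa>d = sqrt (\<kappa>\<^sup>2 - \<zeta>2\<^sup>2)"
  shows
    "(\<forall>(A :: real^'d^'d) (B :: real^'m^'d) (a :: real^'d) (\<gamma> :: real^'m)
        (W :: real \<Rightarrow> 'w \<Rightarrow> real^'m) (X :: real \<Rightarrow> 'w \<Rightarrow> (real^'d) \<times> real \<times> real) (lam :: real).
        (\<forall>\<mu>. complex_eigenvalue A \<mu> \<longrightarrow> Re \<mu> < 0) \<and>
        controllable_pair A B \<and>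
        brownian_motion M F W \<and>
        solves_sde M F W (oscillator_drift A a \<kappa> \<zeta>2) (oscillator_diffusion B \<gamma>) X \<and>
        lyapunov_exponent M (\<lambda>t \<omega>. snd (X t \<omega>)) lam \<longrightarrow>
        lam \<le> - \<zeta>2 + sqrt (a \<bullet> (stationary_covariance A B *v a)) / (2 * \<kappa>d)
              + (norm \<gamma>)\<^sup>2 / (2 * \<kappa>d\<^sup>2))
     \<and>
     (\<forall>(\<zeta>1 :: real) (chi :: real) (\<nu> :: real)
        (W :: real \<Rightarrow> 'w \<Rightarrow> real^1) (X :: real \<Rightarrow> 'w \<Rightarrow> real \<times> real \<times> real \<times> real) (lam :: real).
        \<zeta>1 > 0 \<and> chi > 0 \<and> \<nu> > 0 \<and>
        brownian_motion M F W \<and>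
        solves_sde M F W (pendulum_drift \<zeta>1 chi \<kappa> \<zeta>2) (pendulum_diffusion \<nu>) X \<and>
        lyapunov_exponent M (\<lambda>t \<omega>. snd (snd (X t \<omega>))) lam \<longrightarrow>
        lam \<le> - \<zeta>2 + \<nu> / (2 * \<kappa>d) * sqrt ((chi\<^sup>2 + 4 * \<zeta>1\<^sup>2) / (4 * \<zeta>1))
              + \<nu>\<^sup>2 / (2 * \<kappa>d\<^sup>2))"
proof (intro conjI allI impI)
  have "\<zeta>2\<^sup>2 < \<kappa>\<^sup>2" using assms(4-6) by (intro power_strict_mono) auto
  then have \<kappa>d: "\<kappa>d > 0" "\<kappa>d\<^sup>2 = \<kappa>\<^sup>2 - \<zeta>2\<^sup>2" using assms(7) by simp_all
  have setting: "brownian_setting M F W" if "brownian_motion M F W" for W :: "real \<Rightarrow> 'w \<Rightarrow> real^'n"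
    using assms(1-3) that by (simp add: brownian_setting_def brownian_setting_axioms_def)
  {
    fix A :: "real^'d^'d" and B :: "real^'m^'d" and a :: "real^'d" and \<gamma> :: "real^'m"
      and W :: "real \<Rightarrow> 'w \<Rightarrow> real^'m" and X :: "real \<Rightarrow> 'w \<Rightarrow> (real^'d) \<times> real \<times> real" and lam :: real
    assume h: "(\<forall>\<mu>. complex_eigenvalue A \<mu> \<longrightarrow> Re \<mu> < 0) \<and>
        controllable_pair A B \<and>
        brownian_motion M F W \<and>
        solves_sde M F W (oscillator_drift A a \<kappa> \<zeta>2) (oscillator_diffusion B \<gamma>) X \<and>
        lyapunov_exponent M (\<lambda>t \<omega>. snd (X t \<omega>)) lam"
    then have "brownian_motion M F W" by (elim conjE)
    then interpret brownian_setting M F W by (rule setting)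
    show "lam \<le> - \<zeta>2 + sqrt (a \<bullet> (stationary_covariance A B *v a)) / (2 * \<kappa>d)
              + (norm \<gamma>)\<^sup>2 / (2 * \<kappa>d\<^sup>2)"
      by (rule lyapunov_exponent_le[where X = X and \<kappa> = \<kappa>])
        (use h \<kappa>d assms(5) in \<open>auto simp: lyapunov_exponent_def\<close>)
  next
    fix \<zeta>1 chi \<nu> :: real
      and W :: "real \<Rightarrow> 'w \<Rightarrow> real^1" and X :: "real \<Rightarrow> 'w \<Rightarrow> real \<times> real \<times> real \<times> real" and lam :: real
    assume h: "\<zeta>1 > 0 \<and> chi > 0 \<and> \<nu> > 0 \<and>
        brownian_motion M F W \<and>
        solves_sde M F W (pendulum_drift \<zeta>1 chi \<kappa> \<zeta>2) (pendulum_diffusion \<nu>) X \<and>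
        lyapunov_exponent M (\<lambda>t \<omega>. snd (snd (X t \<omega>))) lam"
    then have pos: "\<zeta>1 > 0" "chi > 0" "\<nu> > 0" by auto
    from h have "brownian_motion M F W" by (elim conjE)
    then interpret brownian_setting M F W by (rule setting)
    have snd_embed: "snd (pendulum_embed x) = snd (snd x)" for x
      by (cases x) (simp add: pendulum_embed_def)
    let ?A = "block_A \<zeta>1 chi" and ?B = "block_B \<nu>" and ?a = "block_a \<zeta>1 chi"
    have "lam \<le> - \<zeta>2 + sqrt (?a \<bullet> (stationary_covariance ?A ?B *v ?a)) / (2 * \<kappa>d)
        + (norm (vec \<nu> :: real^1))\<^sup>2 / (2 * \<kappa>d\<^sup>2)"
    proof (rule lyapunov_exponent_le[where \<kappa> = \<kappa>])
      show "solves_sde M F W (oscillator_drift ?A ?a \<kappa> \<zeta>2) (oscillator_diffusion ?B (vec \<nu>))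
          (\<lambda>t \<omega>. pendulum_embed (X t \<omega>))"
        using pendulum_solves_oscillator[OF pos] h by blast
      show "lyapunov_exponent M (\<lambda>t \<omega>. snd (pendulum_embed (X t \<omega>))) lam"
        using h by (simp add: snd_embed)
      show "AE \<omega> in M. snd (pendulum_embed (X 0 \<omega>)) \<noteq> (0, 0)"
        using h by (simp add: snd_embed lyapunov_exponent_def)
    qed (use block_stable[OF pos] \<kappa>d assms(5) in auto)
    moreover have "sqrt (?a \<bullet> (stationary_covariance ?A ?B *v ?a)) = \<nu> * sqrt ((chi\<^sup>2 + 4 * \<zeta>1\<^sup>2) / (4 * \<zeta>1))"
      using pos by (simp only: block_stationary_variance[OF pos] real_sqrt_mult) simp
    moreover have "norm (vec \<nu> :: real^1) = \<nu>"
      using pos by (simp add: norm_vec_def L2_set_def)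
    ultimately show "lam \<le> - \<zeta>2 + \<nu> / (2 * \<kappa>d) * sqrt ((chi\<^sup>2 + 4 * \<zeta>1\<^sup>2) / (4 * \<zeta>1))
              + \<nu>\<^sup>2 / (2 * \<kappa>d\<^sup>2)"
      by simp
  }
qed

end
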